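(* Let $p\ge0$ and let $H:\mathcal{P}_p(\mathbb{R}^d)\to\mathbb{R}$ admit first and second order flat derivatives that are jointly continuous and $\mathcal{C}^2$ in the spatial variables. Suppose that $\sup_{\mu\in\mathcal{P}_p(\mathbb{R}^d)}\|\nabla\frac{\delta H}{\delta m}(\mu,0)\|_2<+\infty$ and that there exists $\lambda>0$ such that (i) for all $(\mu,x,y)\in\mathcal{P}_p(\mathbb{R}^d)\times\mathbb{R}^d\times\mathbb{R}^d$, $\big\langle\nabla\frac{\delta H}{\delta m}(\mu,x)-\nabla\frac{\delta H}{\delta m}(\mu,y),x-y\big\rangle\ge\lambda\|x-y\|_2^2$; (ii) $\|\mathcal{D}_m^2H\|_{\mathbf{op},\infty}<+\infty$ and $\lambda>\|\mathcal{D}_m^2H\|_{\mathbf{op},\infty}$. Let $(\widetilde X^{(n)})_{n\ge1}$ be a sequence of independent copies of the mean field Langevin process $(X_t)_{t\ge0}$ (with law $\mu_t^X$ at time $t$, $\mu^X_0\in\mathcal{P}_2(\mathbb{R}^d)$), synchronously coupled to the particles $X^{(1)},\dots,X^{(n)}$ of the $n$-particle mean field Langevin system. Then there is a constant $C(d)$ depending only on $d$ such that, for all $T\ge0$ and all $t\in[0,T]$, $$\mathbb{E}\big[\|X_t^{(1)}-\widetilde X_t^{(1)}\|^2\big]\le\begin{cases}\frac{\alpha_1(T)}{\beta_1}\big(e^{\beta_1t}-1\big)&\text{if }\beta_1\ne0,\\ \alpha_1(T)\,t&\text{if }\beta_1=0,\end{cases}$$ where $$\alpha_1(T):=\|\mathcal{D}_m^2H\|_{\mathbf{op},\infty}\,C(d)\Big(\sup_{t\in[0,T]}\int\|x\|_2^2\,\mu_t^X(dx)\Big)\delta_d(n),\qquad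 \beta_1:=3\|\mathcal{D}_m^2H\|_{\mathbf{op},\infty}-2\lambda,$$ $$\delta_d(n):=\begin{cases}n^{-1/2}&\text{if }d<4,\\ n^{-1/2}\ln(n+1)&\text{if }d=4,\\ n^{-2/d}&\text{if }d>4.\end{cases}$$ Moreover, setting $$\alpha:=2d+2\sup_\mu\Big\|\nabla\frac{\delta H}{\delta m}(\mu,0)\Big\|_2,\qquad \beta:=-2\Big(\lambda-\sup_\mu\Big\|\nabla\frac{\delta H}{\delta m}(\mu,0)\Big\|_2\Big),$$ this upper bound is uniform in time if, and only if, $\beta<0$ and $\beta_1<0$, in which case $$\sup_{t\ge0}\mathbb{E}\big[\|X_t^{(1)}-\widetilde X_t^{(1)}\|^2\big]\le\frac{\|\mathcal{D}_m^2H\|_{\mathbf{op},\infty}\,C(d)}{2\lambda-3\|\mathcal{D}_m^2H\|_{\mathbf{op},\infty}}\Big(\int\|x\|_2^2\,\mu_0^X(dx)-\frac{\alpha}{\beta}\Big)\delta_d(n).$$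
   Context: $d\ge1$ and $n\ge1$ are integers. $\mathcal{P}_p(\mathbb{R}^d)$ is the set of probability measures on $\mathbb{R}^d$ with finite $p$-th moment, equipped with its weak topology. A (first) flat derivative of $H$ is a continuous map $\frac{\delta H}{\delta m}:\mathcal{P}_p(\mathbb{R}^d)\times\mathbb{R}^d\to\mathbb{R}$ such that (1) for every compact $K\subset\mathcal{P}_p(\mathbb{R}^d)$ there is $C_K\ge0$ with $\sup_{\mu\in K}|\frac{\delta H}{\delta m}(\mu,x)|\le C_K(1+\|x\|^p)$ for all $x\in\mathbb{R}^d$; (2) for all $\mu_0,\mu_1\in\mathcal{P}_p(\mathbb{R}^d)$, $H(\mu_1)-H(\mu_0)=\int_0^1\int_{\mathbb{R}^d}\frac{\delta H}{\delta m}(t\mu_1+(1-t)\mu_0,x)(\mu_1-\mu_0)(dx)\,dt$. The second flat derivative $\frac{\delta^2H}{\delta m^2}(\mu,x,y)$ is the flat derivative (new variable $y$) of $\mu\mapsto\frac{\delta H}{\delta m}(\mu,x)$. Intrinsic derivatives: $\mathcal{D}_mH(\mu,x):=\nabla_x\frac{\delta H}{\delta m}(\mu,x)$, $\mathcal{D}^2_mH(\mu,x,y):=\nabla^2_{x,y}\frac{\delta^2H}{\delta m^2}(\mu,x,y)$ (mixed second derivative), and $\|\mathcal{D}_m^2H\|_{\mathbf{op},\infty}:=\sup_{\mu,x,y}\|\mathcal{D}_m^2H(\mu,x,y)\|_2$, with $\|\cdot\|_2$ the operator norm for matrices (Euclidean norm for vectors). Mean field Langevin process: a solution of $dX_t=\sqrt2\,dB_t-\mathcal{D}_mH(\mu^X_t,X_t)\,dt$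 with $\mu^X_t=\mathrm{Law}(X_t)$, $B$ a standard $d$-dimensional Brownian motion. The $n$-particle system is $$dX_t^{(i)}=\sqrt2\,dB_t^{(i)}-\mathcal{D}_mH(\mu_{\mathbf{X}_t},X_t^{(i)})\,dt,\quad i=1,\dots,n,\qquad \mu_{\mathbf{X}_t}:=\frac1n\sum_{j=1}^n\delta_{X_t^{(j)}},$$ with $B^{(1)},\dots,B^{(n)}$ i.i.d. standard $d$-dimensional Brownian motions. Synchronous coupling means that $\widetilde X^{(i)}$ solves $d\widetilde X_t^{(i)}=\sqrt2\,dB_t^{(i)}-\mathcal{D}_mH(\mu_t^X,\widetilde X_t^{(i)})\,dt$ with the same Brownian motion $B^{(i)}$ and the same initial condition $\widetilde X_0^{(i)}=X_0^{(i)}$, the $X^{(i)}_0$ being i.i.d. with law $\mu_0^X$.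
   Formalization: The "only if" is false as stated (without interaction the bound is 0); for nonzero interaction it is proved for the bound with the Gronwall moment estimate inserted, while with the actual moments only β₁<0 is necessary; C(d) is chosen per type of sample points. *)

theory Defs
  imports "HOL-Probability.Probability"
begin

section \<open>Probability measures with finite moments, weak topology\<close>

definition Pp :: "real \<Rightarrow> (real ^ 'd) measure set" where
  "Pp p = {\<mu>. prob_space \<mu> \<and> sets \<mu> = sets borel \<and> integrable \<mu> (\<lambda>x. norm x powr p)}"

text \<open>The initial topology for the maps \<open>\<mu> \<mapsto> \<integral> f d\<mu>\<close>, with \<open>f\<close> bounded and continuous; on the
  codomain (functions of \<open>f\<close>), \<open>euclidean\<close> is the topology of pointwise convergence.\<close>

definition weak_topology :: "real \<Rightarrow> (real ^ 'd) measure topology" where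
  "weak_topology p =
    pullback_topology (Pp p) (\<lambda>\<mu> (f :: (real ^ 'd) \<Rightarrow>\<^sub>C real). \<integral>x. f x \<partial>\<mu>) euclidean"

definition second_moment :: "(real ^ 'd) measure \<Rightarrow> real" where
  "second_moment \<mu> = (\<integral>x. (norm x)\<^sup>2 \<partial>\<mu>)"

text \<open>The measure \<open>t \<mu>\<^sub>1 + (1 - t) \<mu>\<^sub>0\<close>.\<close>

definition mixture :: "real \<Rightarrow> (real ^ 'd) measure \<Rightarrow> (real ^ 'd) measure \<Rightarrow> (real ^ 'd) measure" where
  "mixture t \<mu>1 \<mu>0 =
    measure_of UNIV (sets borel) (\<lambda>A. ennreal t * emeasure \<mu>1 A + ennreal (1 - t) * emeasure \<mu>0 A)"

definition empirical_measure :: "nat \<Rightarrow> (nat \<Rightarrow> real ^ 'd) \<Rightarrow> (real ^ 'd) measure" where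
  "empirical_measure n x = distr (uniform_count_measure {1..n}) borel x"

section \<open>Flat and intrinsic derivatives\<close>

definition flat_derivative ::
  "real \<Rightarrow> ((real ^ 'd) measure \<Rightarrow> real) \<Rightarrow> ((real ^ 'd) measure \<Rightarrow> real ^ 'd \<Rightarrow> real) \<Rightarrow> bool" where
  "flat_derivative p H dH \<longleftrightarrow>
    continuous_map (prod_topology (weak_topology p) euclidean) euclideanreal (\<lambda>(\<mu>, x). dH \<mu> x) \<and>
    (\<forall>K. compactin (weak_topology p) K \<longrightarrow>
      (\<exists>C\<ge>0. \<forall>\<mu>\<in>K. \<forall>x. \<bar>dH \<mu> x\<bar> \<le> C * (1 + norm x powr p))) \<and>
    (\<forall>\<mu>0\<in>Pp p. \<forall>\<mu>1\<in>Pp p.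
      H \<mu>1 - H \<mu>0 =
        (LINT t:{0..1}|lborel.
          (\<integral>x. dH (mixture t \<mu>1 \<mu>0) x \<partial>\<mu>1) - (\<integral>x. dH (mixture t \<mu>1 \<mu>0) x \<partial>\<mu>0)))"

definition second_flat_derivative ::
  "real \<Rightarrow> ((real ^ 'd) measure \<Rightarrow> real ^ 'd \<Rightarrow> real) \<Rightarrow>
    ((real ^ 'd) measure \<Rightarrow> real ^ 'd \<Rightarrow> real ^ 'd \<Rightarrow> real) \<Rightarrow> bool" where
  "second_flat_derivative p dH d2H \<longleftrightarrow>
    (\<forall>x. flat_derivative p (\<lambda>\<mu>. dH \<mu> x) (\<lambda>\<mu> y. d2H \<mu> x y))"

definition C2 :: "('a::euclidean_space \<Rightarrow> real) \<Rightarrow> bool" where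
  "C2 f \<longleftrightarrow>
    (\<exists>f' f''. (\<forall>x. (f has_derivative blinfun_apply (f' x)) (at x)) \<and>
      (\<forall>x. (f' has_derivative blinfun_apply (f'' x)) (at x)) \<and> continuous_on UNIV f'')"

definition gradient :: "('a::euclidean_space \<Rightarrow> real) \<Rightarrow> 'a \<Rightarrow> 'a" where
  "gradient f x = (THE g. GDERIV f x :> g)"

definition intrinsic_deriv ::
  "((real ^ 'd) measure \<Rightarrow> real ^ 'd \<Rightarrow> real) \<Rightarrow> (real ^ 'd) measure \<Rightarrow> real ^ 'd \<Rightarrow> real ^ 'd" where
  "intrinsic_deriv dH \<mu> x = gradient (dH \<mu>) x"

text \<open>Entry \<open>(i, j)\<close> is the mixed derivative in \<open>x\<^sub>i\<close> and \<open>y\<^sub>j\<close>.\<close>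

definition intrinsic_deriv2 ::
  "((real ^ 'd) measure \<Rightarrow> real ^ 'd \<Rightarrow> real ^ 'd \<Rightarrow> real) \<Rightarrow>
    (real ^ 'd) measure \<Rightarrow> real ^ 'd \<Rightarrow> real ^ 'd \<Rightarrow> real ^ 'd ^ 'd" where
  "intrinsic_deriv2 d2H \<mu> x y = jacobian (\<lambda>y. gradient (\<lambda>x. d2H \<mu> x y) x) (at y)"

definition deriv2_opnorms ::
  "real \<Rightarrow> ((real ^ 'd) measure \<Rightarrow> real ^ 'd \<Rightarrow> real ^ 'd \<Rightarrow> real) \<Rightarrow> real set" where
  "deriv2_opnorms p d2H =
    (\<lambda>(\<mu>, x, y). onorm ((*v) (intrinsic_deriv2 d2H \<mu> x y))) ` (Pp p \<times> UNIV \<times> UNIV)"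

definition grad0_norms ::
  "real \<Rightarrow> ((real ^ 'd) measure \<Rightarrow> real ^ 'd \<Rightarrow> real) \<Rightarrow> real set" where
  "grad0_norms p dH = (\<lambda>\<mu>. norm (intrinsic_deriv dH \<mu> 0)) ` Pp p"

section \<open>Brownian motion and Langevin dynamics\<close>

text \<open>Time is \<open>[0, \<infinity>)\<close>; values of processes and filtrations at negative times play no role.\<close>

definition path_space :: "(real \<Rightarrow> real ^ 'd) measure" where
  "path_space = (\<Pi>\<^sub>M t\<in>{0..}. borel)"

definition sample_path :: "(real \<Rightarrow> 'w \<Rightarrow> real ^ 'd) \<Rightarrow> 'w \<Rightarrow> real \<Rightarrow> real ^ 'd" where
  "sample_path X \<omega> = (\<lambda>t\<in>{0..}. X t \<omega>)"

definition filtered_prob_space :: "'w measure \<Rightarrow> (real \<Rightarrow> 'w measure) \<Rightarrow> bool" where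
  "filtered_prob_space M \<F> \<longleftrightarrow>
    prob_space M \<and> filtration (space M) \<F> \<and> (\<forall>t. subalgebra M (\<F> t))"

definition adapted_continuous ::
  "'w measure \<Rightarrow> (real \<Rightarrow> 'w measure) \<Rightarrow> (real \<Rightarrow> 'w \<Rightarrow> real ^ 'd) \<Rightarrow> bool" where
  "adapted_continuous M \<F> X \<longleftrightarrow>
    (\<forall>t\<ge>0. X t \<in> borel_measurable (\<F> t)) \<and> (AE \<omega> in M. continuous_on {0..} (\<lambda>t. X t \<omega>))"

definition brownian_motion ::
  "'w measure \<Rightarrow> (real \<Rightarrow> 'w measure) \<Rightarrow> (real \<Rightarrow> 'w \<Rightarrow> real ^ 'd) \<Rightarrow> bool" where
  "brownian_motion M \<F> B \<longleftrightarrow>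
    adapted_continuous M \<F> B \<and>
    (AE \<omega> in M. B 0 \<omega> = 0) \<and>
    (\<forall>s t. 0 \<le> s \<longrightarrow> s < t \<longrightarrow>
      prob_space.indep_set M (sets (\<F> s))
        (sets (vimage_algebra (space M) (\<lambda>\<omega>. B t \<omega> - B s \<omega>) borel)) \<and>
      distributed M lborel (\<lambda>\<omega>. B t \<omega> - B s \<omega>)
        (\<lambda>x. ennreal (\<Prod>k\<in>UNIV. normal_density 0 (sqrt (t - s)) (x $ k))))"

text \<open>\<open>X\<close> solves \<open>dX\<^sub>t = \<surd>2 dB\<^sub>t - b\<^sub>t dt\<close>, where the drift \<open>b\<close> may depend on \<open>X\<close>; as the diffusion
  coefficient is constant, no stochastic integral is involved.\<close>

definition langevin_solution ::
  "'w measure \<Rightarrow> (real \<Rightarrow> 'w measure) \<Rightarrow> (real \<Rightarrow> 'w \<Rightarrow> real ^ 'd) \<Rightarrow>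
    (real \<Rightarrow> 'w \<Rightarrow> real ^ 'd) \<Rightarrow> (real \<Rightarrow> 'w \<Rightarrow> real ^ 'd) \<Rightarrow> bool" where
  "langevin_solution M \<F> B b X \<longleftrightarrow>
    adapted_continuous M \<F> X \<and>
    (AE \<omega> in M. \<forall>t\<ge>0.
      set_integrable lborel {0..t} (\<lambda>s. b s \<omega>) \<and>
      X t \<omega> = X 0 \<omega> + sqrt 2 *\<^sub>R B t \<omega> - (LINT s:{0..t}|lborel. b s \<omega>))"

definition law :: "'w measure \<Rightarrow> (real \<Rightarrow> 'w \<Rightarrow> real ^ 'd) \<Rightarrow> real \<Rightarrow> (real ^ 'd) measure" where
  "law M X t = distr M borel (X t)"

definition mean_field_langevin ::
  "real \<Rightarrow> ((real ^ 'd) measure \<Rightarrow> real ^ 'd \<Rightarrow> real) \<Rightarrow> 'w measure \<Rightarrow> (real \<Rightarrow> 'w measure) \<Rightarrow>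
    (real \<Rightarrow> 'w \<Rightarrow> real ^ 'd) \<Rightarrow> (real \<Rightarrow> 'w \<Rightarrow> real ^ 'd) \<Rightarrow> bool" where
  "mean_field_langevin p dH M \<F> W X \<longleftrightarrow>
    brownian_motion M \<F> W \<and>
    (\<forall>t\<ge>0. law M X t \<in> Pp p) \<and>
    langevin_solution M \<F> W (\<lambda>s \<omega>. intrinsic_deriv dH (law M X s) (X s \<omega>)) X"

definition particle_system ::
  "((real ^ 'd) measure \<Rightarrow> real ^ 'd \<Rightarrow> real) \<Rightarrow> nat \<Rightarrow> 'w measure \<Rightarrow> (real \<Rightarrow> 'w measure) \<Rightarrow>
    (nat \<Rightarrow> real \<Rightarrow> 'w \<Rightarrow> real ^ 'd) \<Rightarrow> (nat \<Rightarrow> real \<Rightarrow> 'w \<Rightarrow> real ^ 'd) \<Rightarrow> bool" where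
  "particle_system dH n M \<F> B Xs \<longleftrightarrow>
    prob_space.indep_vars M (\<lambda>_. path_space) (\<lambda>i. sample_path (B i)) {1..n} \<and>
    (\<forall>i\<in>{1..n}. brownian_motion M \<F> (B i) \<and>
      langevin_solution M \<F> (B i)
        (\<lambda>s \<omega>. intrinsic_deriv dH (empirical_measure n (\<lambda>j. Xs j s \<omega>)) (Xs i s \<omega>)) (Xs i))"

text \<open>The processes \<open>Xt 1, Xt 2, \<dots>\<close> are independent with the same law on path space as \<open>X\<close>.\<close>

definition independent_copies ::
  "'w measure \<Rightarrow> (real \<Rightarrow> 'w \<Rightarrow> real ^ 'd) \<Rightarrow> (nat \<Rightarrow> real \<Rightarrow> 'w \<Rightarrow> real ^ 'd) \<Rightarrow> bool" where
  "independent_copies M X Xt \<longleftrightarrow>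
    prob_space.indep_vars M (\<lambda>_. path_space) (\<lambda>i. sample_path (Xt i)) {1..} \<and>
    (\<forall>i\<ge>1. distr M path_space (sample_path (Xt i)) = distr M path_space (sample_path X))"

definition synchronously_coupled ::
  "((real ^ 'd) measure \<Rightarrow> real ^ 'd \<Rightarrow> real) \<Rightarrow> nat \<Rightarrow> 'w measure \<Rightarrow> (real \<Rightarrow> 'w measure) \<Rightarrow>
    (nat \<Rightarrow> real \<Rightarrow> 'w \<Rightarrow> real ^ 'd) \<Rightarrow> (real \<Rightarrow> 'w \<Rightarrow> real ^ 'd) \<Rightarrow>
    (nat \<Rightarrow> real \<Rightarrow> 'w \<Rightarrow> real ^ 'd) \<Rightarrow> (nat \<Rightarrow> real \<Rightarrow> 'w \<Rightarrow> real ^ 'd) \<Rightarrow> bool" where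
  "synchronously_coupled dH n M \<F> B X Xs Xt \<longleftrightarrow>
    prob_space.indep_vars M (\<lambda>_. borel) (\<lambda>i. Xs i 0) {1..n} \<and>
    (\<forall>i\<in>{1..n}.
      law M (Xs i) 0 = law M X 0 \<and>
      (AE \<omega> in M. Xt i 0 \<omega> = Xs i 0 \<omega>) \<and>
      langevin_solution M \<F> (B i)
        (\<lambda>s \<omega>. intrinsic_deriv dH (law M X s) (Xt i s \<omega>)) (Xt i))"

section \<open>The bounds\<close>

definition rate :: "nat \<Rightarrow> nat \<Rightarrow> real" where
  "rate d n =
    (if d < 4 then real n powr (-1/2)
     else if d = 4 then real n powr (-1/2) * ln (real n + 1)
     else real n powr (-2 / real d))"

text \<open>\<open>L\<close> stands for the supremum of the operator norms of the second intrinsic derivative, and \<open>m T\<close>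
  for (an upper bound of) the second moments of the process on \<open>[0, T]\<close>.\<close>

definition alpha1 :: "real \<Rightarrow> real \<Rightarrow> (real \<Rightarrow> real) \<Rightarrow> nat \<Rightarrow> nat \<Rightarrow> real \<Rightarrow> real" where
  "alpha1 L C m d n T = L * C * m T * rate d n"

definition chaos_bound ::
  "real \<Rightarrow> real \<Rightarrow> real \<Rightarrow> (real \<Rightarrow> real) \<Rightarrow> nat \<Rightarrow> nat \<Rightarrow> real \<Rightarrow> real \<Rightarrow> real" where
  "chaos_bound \<beta>1 L C m d n T t =
    (if \<beta>1 \<noteq> 0 then alpha1 L C m d n T / \<beta>1 * (exp (\<beta>1 * t) - 1) else alpha1 L C m d n T * t)"

text \<open>The solution of \<open>u' = \<alpha> + \<beta> u\<close> with \<open>u 0 = m0\<close>, i.e. the Gronwall estimate of the second moment.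
  Whether the chaos bound is uniform in time depends on \<open>\<beta>\<close> only once the actual second moments are
  replaced by this estimate: for \<open>\<lambda> > 0\<close> the actual second moments are always bounded in time.\<close>

definition gronwall_bound :: "real \<Rightarrow> real \<Rightarrow> real \<Rightarrow> real \<Rightarrow> real" where
  "gronwall_bound \<alpha> \<beta> m0 t =
    (if \<beta> \<noteq> 0 then exp (\<beta> * t) * m0 + \<alpha> / \<beta> * (exp (\<beta> * t) - 1) else m0 + \<alpha> * t)"

definition uniform_in_time :: "(real \<Rightarrow> real \<Rightarrow> real) \<Rightarrow> bool" where
  "uniform_in_time U \<longleftrightarrow> (\<exists>K. \<forall>T\<ge>0. \<forall>t\<in>{0..T}. U T t \<le> K)"

end

theory Submission
  imports Defs
begin

text \<open>Put \<open>b(\<mu>, x) = D\<^sub>m H(\<mu>, x)\<close> and \<open>Z\<^sub>i = X\<^sub>i - X'\<^sub>i\<close>, where \<open>X'\<^sub>i\<close> is the copy coupled to the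
particle \<open>X\<^sub>i\<close>. The common Brownian motion cancels in \<open>Z\<^sub>i\<close>, and \<open>b\<close> is continuous along weakly
continuous curves of measures because it is the gradient of a convex function that depends
continuously on the curve parameter. So \<open>Z\<^sub>i\<close> is a continuously differentiable path with \<open>Z\<^sub>i(0) = 0\<close>,
and the coupling is controlled by ordinary calculus, path by path. Let \<open>L\<close> be the supremum of the
operator norms of the second intrinsic derivative and \<open>w(\<mu>, \<nu>)\<close> the supremum of
\<open>|\<integral>f d\<mu> - \<integral>f d\<nu>|\<close> over all \<open>f\<close> with Lipschitz constant 1. Then \<open>b(\<cdot>, x)\<close> is \<open>L\<close>-Lipschitz for \<open>w\<close>, which
follows from finite differences in \<open>x\<close> of the formula that defines the second flat derivative. With
the strong convexity in \<open>x\<close>, this gives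

\<open>(|Z\<^sub>i|\<^sup>2)' \<le> -2\<lambda> |Z\<^sub>i|\<^sup>2 + 2L |Z\<^sub>i| (avg |Z\<^sub>j| + w\<^sub>t)\<close>,

where \<open>w\<^sub>t\<close> is the distance of the empirical measure of the independent copies from their law \<open>\<mu>\<^sub>t\<close>.
For the average \<open>z\<close> of the \<open>|Z\<^sub>j|\<^sup>2\<close> one gets \<open>z' \<le> (3L - 2\<lambda>) z + L w\<^sub>t\<^sup>2\<close>, and for the first particle
\<open>(|Z\<^sub>1|\<^sup>2)' \<le> (2L - 2\<lambda>) |Z\<^sub>1|\<^sup>2 + L z + L w\<^sub>t\<^sup>2\<close>. If \<open>u\<close> solves \<open>u' = (3L - 2\<lambda>) u + \<alpha>\<^sub>1\<close> and bounds \<open>E z\<close>, then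
it also solves the second equation with \<open>z\<close> replaced by \<open>u\<close>. Hence \<open>u\<close>, which is the bound of the
theorem, controls the first particle as well, directly and not by symmetry.
Gronwall's inequality is taken in expectation by means of Riemann sums and Fatou's lemma
(\<open>gronwall_in_expectation\<close>), so that only the measurability at fixed times matters.

The expectation of \<open>w\<^sub>t\<^sup>2\<close> is at most \<open>C(d)\<close> times the second moment of \<open>\<mu>\<^sub>t\<close> times \<open>\<delta>\<^sub>d(n)\<close>
(\<open>empirical_lipschitz_deviation\<close>). The space is cut into shells of geometrically growing radii, every shell
into nested dyadic cells, and a Lipschitz function is telescoped along the cell corners. The
deviations of the cell frequencies are of order \<open>n^(-1/2)\<close>, and Chebyshev's inequality bounds the mass
of the outer shells, where coarser cells are enough. The exponent obtained is \<open>-2 / max(d, 4)\<close>.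

The second moments of the mean field process satisfy the Gronwall estimate (\<open>langevin_second_moment\<close>). The
drift may grow arbitrarily fast, but it is monotone; so the implicit Euler scheme is well defined, its
second moments obey a discrete Gronwall inequality that uses only the independence of the Brownian
increments, and it converges to the process path by path. Fatou's lemma carries the estimate over.

For the statements about uniformity in time, the bound is the second moment factor times a function
of \<open>t\<close> that is bounded exactly if \<open>3L - 2\<lambda> < 0\<close>, and the Gronwall estimate of the second moments is
bounded exactly if \<open>\<beta> < 0\<close>. The supremum of the actual second moments over a time interval of
positive length never vanishes: a process that stays at the origin would make the Brownian motion deterministic.\<close>

section \<open>Gradients\<close>

text \<open>The gradient is a definite description, so that every use of it rests on the uniqueness of the
representing vector. The explicit formula transfers differentiability from the derivative to
the gradient.\<close>

lemma has_derivative_gradient: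
  fixes f :: "'a::euclidean_space \<Rightarrow> real"
  assumes f: "(f has_derivative f') (at x)"
  shows "(f has_derivative (\<lambda>h. gradient f x \<bullet> h)) (at x)"
    and "gradient f x = (\<Sum>b\<in>Basis. f' b *\<^sub>R b)"
proof -
  interpret linear f' using has_derivative_linear[OF f] .
  let ?g = "\<Sum>b\<in>Basis. f' b *\<^sub>R b"
  have eq: "f' h = ?g \<bullet> h" for h
  proof -
    have "f' h = f' (\<Sum>b\<in>Basis. (h \<bullet> b) *\<^sub>R b)" by (simp add: euclidean_representation)
    also have "\<dots> = (\<Sum>b\<in>Basis. (h \<bullet> b) * f' b)" by (simp add: sum scale)
    also have "\<dots> = ?g \<bullet> h" by (simp add: inner_sum_left inner_commute[of h] mult.commute)
    finally show ?thesis .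
  qed
  have "(f has_derivative (\<lambda>h. h \<bullet> ?g)) (at x)"
    by (rule has_derivative_eq_rhs[OF f], rule ext, subst eq, rule inner_commute)
  then have g: "GDERIV f x :> ?g" by (simp only: gderiv_def)
  have "g = ?g" if "GDERIV f x :> g" for g
  proof -
    have "(\<lambda>h. h \<bullet> g) = (\<lambda>h. h \<bullet> ?g)"
      using has_derivative_unique[of f "\<lambda>h. h \<bullet> g" x "\<lambda>h. h \<bullet> ?g"] that g
      unfolding gderiv_def by blast
    then have "h \<bullet> g = h \<bullet> ?g" for h by metis
    then show ?thesis by (metis vector_eq_ldot)
  qed
  then show grad: "gradient f x = ?g" unfolding gradient_def using g by (intro the_equality)
  show "(f has_derivative (\<lambda>h. gradient f x \<bullet> h)) (at x)"
    using g unfolding grad by (simp only: gderiv_def inner_commute)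
qed

lemma C2_has_derivative_gradient:
  assumes "C2 f"
  shows "(f has_derivative (\<lambda>h. gradient f x \<bullet> h)) (at x)"
  using assms has_derivative_gradient(1) unfolding C2_def by blast

text \<open>The mixed second derivative bounds the Lipschitz constant in \<open>y\<close> of the gradient in \<open>x\<close>; a second use of
the mean value inequality, now in \<open>x\<close>, turns this into a bound for the mixed second difference. In this
form the bound can be integrated against measures without differentiating under the integral.\<close>

lemma mixed_difference_le:
  fixes F :: "real ^ 'd \<Rightarrow> real ^ 'd \<Rightarrow> real"
  assumes C2: "C2 (\<lambda>(x, y). F x y)"
    and L: "\<And>x y. onorm ((*v) (jacobian (\<lambda>y. gradient (\<lambda>x. F x y) x) (at y))) \<le> L"
  shows "\<bar>(F x' y' - F x y') - (F x' y - F x y)\<bar> \<le> L * norm (x' - x) * norm (y' - y)"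
proof -
  obtain f' f'' where
    f': "\<And>z. ((\<lambda>(x, y). F x y) has_derivative blinfun_apply (f' z)) (at z)" and
    f'': "\<And>z. (f' has_derivative blinfun_apply (f'' z)) (at z)"
    using C2 unfolding C2_def by blast
  have Fx: "((\<lambda>x. F x y) has_derivative (\<lambda>h. f' (x, y) (h, 0))) (at x)" for x y
  proof -
    have "((\<lambda>x. (x, y)) has_derivative (\<lambda>h. (h, 0))) (at x)"
      by (auto intro!: derivative_eq_intros)
    from has_derivative_compose[OF this f'] show ?thesis by simp
  qed
  have G: "gradient (\<lambda>x. F x y) x = (\<Sum>b\<in>Basis. f' (x, y) (b, 0) *\<^sub>R b)" for x y
    by (rule has_derivative_gradient(2)[OF Fx])
  have Gdiff: "(\<lambda>y. gradient (\<lambda>x. F x y) x) differentiable (at y)" for x y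
  proof -
    have "((\<lambda>y. (x, y)) has_derivative (\<lambda>h. (0, h))) (at y)"
      by (auto intro!: derivative_eq_intros)
    from has_derivative_compose[OF this f'']
    have 1: "((\<lambda>y. f' (x, y)) has_derivative (\<lambda>h. f'' (x, y) (0, h))) (at y)" .
    have "((\<lambda>y. \<Sum>b\<in>Basis. f' (x, y) (b, 0) *\<^sub>R b) has_derivative
        (\<lambda>h. \<Sum>b\<in>Basis. f'' (x, y) (0, h) (b, 0) *\<^sub>R b)) (at y)"
      by (intro has_derivative_sum has_derivative_scaleR_left
          bounded_linear.has_derivative[OF blinfun.bounded_linear_left 1])
    then show ?thesis unfolding G differentiable_def by blast
  qed
  have Glip: "norm (gradient (\<lambda>x. F x y') x - gradient (\<lambda>x. F x y) x) \<le> L * norm (y' - y)" for x y y'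
  proof (rule differentiable_bound[of UNIV _ "\<lambda>y h. jacobian (\<lambda>y. gradient (\<lambda>x. F x y) x) (at y) *v h"])
    fix z show "((\<lambda>y. gradient (\<lambda>x. F x y) x) has_derivative
        (\<lambda>h. jacobian (\<lambda>y. gradient (\<lambda>x. F x y) x) (at z) *v h)) (at z within UNIV)"
      using jacobian_works[THEN iffD1, OF Gdiff[of x z]] by simp
  qed (use L in auto)
  have "norm ((F x' y' - F x' y) - (F x y' - F x y)) \<le> L * norm (y' - y) * norm (x' - x)"
  proof (rule differentiable_bound[of UNIV "\<lambda>x. F x y' - F x y"
        "\<lambda>x h. (gradient (\<lambda>x. F x y') x - gradient (\<lambda>x. F x y) x) \<bullet> h"])
    fix z
    show "((\<lambda>x. F x y' - F x y) has_derivative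
        (\<lambda>h. (gradient (\<lambda>x. F x y') z - gradient (\<lambda>x. F x y) z) \<bullet> h)) (at z within UNIV)"
      using has_derivative_diff[OF has_derivative_gradient(1)[OF Fx] has_derivative_gradient(1)[OF Fx]]
      by (simp add: inner_diff_left)
    show "onorm (\<lambda>h. (gradient (\<lambda>x. F x y') z - gradient (\<lambda>x. F x y) z) \<bullet> h) \<le> L * norm (y' - y)"
    proof (rule onorm_le)
      fix h
      have "norm ((gradient (\<lambda>x. F x y') z - gradient (\<lambda>x. F x y) z) \<bullet> h)
          \<le> norm (gradient (\<lambda>x. F x y') z - gradient (\<lambda>x. F x y) z) * norm h"
        by (simp add: Cauchy_Schwarz_ineq2)
      also have "\<dots> \<le> L * norm (y' - y) * norm h" by (intro mult_right_mono Glip) simp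
      finally show "norm ((gradient (\<lambda>x. F x y') z - gradient (\<lambda>x. F x y) z) \<bullet> h) \<le> L * norm (y' - y) * norm h" .
    qed
  qed auto
  then show ?thesis by (simp add: algebra_simps)
qed

text \<open>The tangent inequality of convex functions, from the mean value theorem along a segment and the
monotonicity of the gradient.\<close>

lemma monotone_gradient_subgradient:
  fixes f :: "'a::euclidean_space \<Rightarrow> real"
  assumes f: "\<And>x. (f has_derivative (\<lambda>h. b x \<bullet> h)) (at x)"
    and mono: "\<And>x y. (b x - b y) \<bullet> (x - y) \<ge> 0"
  shows "b x \<bullet> h \<le> f (x + h) - f x"
proof -
  have "\<exists>\<xi>\<in>{0<..<1}. f (x + 1 *\<^sub>R h) - f (x + 0 *\<^sub>R h) = (\<lambda>t. b (x + \<xi> *\<^sub>R h) \<bullet> (t *\<^sub>R h)) (1 - 0)"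
  proof (rule mvt_simple)
    fix t :: real
    have "((\<lambda>t. x + t *\<^sub>R h) has_derivative (\<lambda>t. t *\<^sub>R h)) (at t within {0..1})"
      by (auto intro!: derivative_eq_intros)
    from has_derivative_compose[OF this f]
    show "((\<lambda>t. f (x + t *\<^sub>R h)) has_derivative (\<lambda>s. b (x + t *\<^sub>R h) \<bullet> (s *\<^sub>R h))) (at t within {0..1})" .
  qed simp
  then obtain \<xi> where \<xi>: "0 < \<xi>" "f (x + h) - f x = b (x + \<xi> *\<^sub>R h) \<bullet> h" by auto
  have "0 \<le> (b (x + \<xi> *\<^sub>R h) - b x) \<bullet> h"
    using mono[of "x + \<xi> *\<^sub>R h" x] \<xi> by (simp add: zero_le_mult_iff)
  then show ?thesis using \<xi> by (simp add: inner_diff_left)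
qed

text \<open>A directional derivative of a convex function lies below the difference quotient in that direction.
The quotient for a fixed step is jointly continuous, and at the limit point it is close to the
derivative if the step is small. This gives upper semicontinuity of all directional derivatives, and
opposite directions give continuity.\<close>

lemma convex_gradient_jointly_continuous:
  fixes \<phi> :: "'s::topological_space \<Rightarrow> 'a::euclidean_space \<Rightarrow> real"
  assumes cont: "continuous_on (S \<times> UNIV) (\<lambda>(s, x). \<phi> s x)"
    and deriv: "\<And>s x. s \<in> S \<Longrightarrow> (\<phi> s has_derivative (\<lambda>h. b s x \<bullet> h)) (at x)"
    and mono: "\<And>s x y. s \<in> S \<Longrightarrow> (b s x - b s y) \<bullet> (x - y) \<ge> 0"
  shows "continuous_on (S \<times> UNIV) (\<lambda>(s, x). b s x)"
proof -
  have upper: "\<forall>\<^sub>F z in at (s0, x0) within S \<times> UNIV. b (fst z) (snd z) \<bullet> h < b s0 x0 \<bullet> h + e"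
    if s0: "s0 \<in> S" and e: "e > 0" for s0 x0 h and e :: real
  proof -
    have "((\<lambda>r. (\<phi> s0 (x0 + r *\<^sub>R h) - \<phi> s0 x0) / r) \<longlongrightarrow> b s0 x0 \<bullet> h) (at 0)"
    proof -
      have 0: "((\<lambda>r. x0 + r *\<^sub>R h) has_derivative (\<lambda>r. r *\<^sub>R h)) (at 0)"
        by (auto intro!: derivative_eq_intros)
      have "((\<lambda>r. \<phi> s0 (x0 + r *\<^sub>R h)) has_derivative (\<lambda>r. b s0 (x0 + 0 *\<^sub>R h) \<bullet> (r *\<^sub>R h))) (at 0)"
        by (rule has_derivative_compose[OF 0 deriv[OF s0]])
      moreover have "(\<lambda>r. r * (b s0 x0 \<bullet> h)) = (*) (b s0 x0 \<bullet> h)" by (simp add: fun_eq_iff)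
      ultimately have "((\<lambda>r. \<phi> s0 (x0 + r *\<^sub>R h)) has_field_derivative (b s0 x0 \<bullet> h)) (at 0)"
        by (simp add: has_field_derivative_def)
      then show ?thesis by (simp add: DERIV_def)
    qed
    then have "\<forall>\<^sub>F r in at 0. (\<phi> s0 (x0 + r *\<^sub>R h) - \<phi> s0 x0) / r < b s0 x0 \<bullet> h + e"
      using e by (intro order_tendstoD(2)) auto
    \<comment> \<open>Only positive steps bound the derivative from above.\<close>
    then have "\<forall>\<^sub>F r in at_right 0. (\<phi> s0 (x0 + r *\<^sub>R h) - \<phi> s0 x0) / r < b s0 x0 \<bullet> h + e"
      by (simp add: eventually_at_split)
    moreover have "\<forall>\<^sub>F r in at_right (0::real). 0 < r" by (rule eventually_at_right_less)
    ultimately have "\<forall>\<^sub>F r in at_right 0. 0 < r \<and> (\<phi> s0 (x0 + r *\<^sub>R h) - \<phi> s0 x0) / r < b s0 x0 \<bullet> h + e"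
      by eventually_elim simp
    then obtain r where r: "0 < r" "(\<phi> s0 (x0 + r *\<^sub>R h) - \<phi> s0 x0) / r < b s0 x0 \<bullet> h + e"
      using eventually_happens'[OF trivial_limit_at_right_real] by blast
    have "continuous_on (S \<times> UNIV) (\<lambda>z. (\<phi> (fst z) (snd z + r *\<^sub>R h) - \<phi> (fst z) (snd z)) / r)"
    proof (intro continuous_intros)
      have 2: "continuous_on (S \<times> UNIV) (\<lambda>z. (fst z, snd z + r *\<^sub>R h))"
        by (intro continuous_intros)
      show "continuous_on (S \<times> UNIV) (\<lambda>z. \<phi> (fst z) (snd z + r *\<^sub>R h))"
        using continuous_on_compose2[OF cont 2 image_subsetI] by auto
      show "continuous_on (S \<times> UNIV) (\<lambda>z. \<phi> (fst z) (snd z))" using cont by (simp add: case_prod_beta)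
    qed (use r in auto)
    then have "((\<lambda>z. (\<phi> (fst z) (snd z + r *\<^sub>R h) - \<phi> (fst z) (snd z)) / r) \<longlongrightarrow>
        (\<phi> s0 (x0 + r *\<^sub>R h) - \<phi> s0 x0) / r) (at (s0, x0) within S \<times> UNIV)"
      using s0 unfolding continuous_on_def by auto
    from order_tendstoD(2)[OF this r(2)]
    have ev: "\<forall>\<^sub>F z in at (s0, x0) within S \<times> UNIV.
        (\<phi> (fst z) (snd z + r *\<^sub>R h) - \<phi> (fst z) (snd z)) / r < b s0 x0 \<bullet> h + e" .
    have "\<forall>\<^sub>F z in at (s0, x0) within S \<times> UNIV. z \<in> S \<times> UNIV"
      by (simp add: eventually_at_filter)
    with ev show ?thesis
    proof eventually_elim
      case (elim z)
      then have "fst z \<in> S" by auto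
      from monotone_gradient_subgradient[of "\<phi> (fst z)" "b (fst z)", OF deriv mono, OF this this]
      have "b (fst z) (snd z) \<bullet> (r *\<^sub>R h) \<le> \<phi> (fst z) (snd z + r *\<^sub>R h) - \<phi> (fst z) (snd z)" .
      then have "b (fst z) (snd z) \<bullet> h \<le> (\<phi> (fst z) (snd z + r *\<^sub>R h) - \<phi> (fst z) (snd z)) / r"
        using r by (simp add: le_divide_eq mult.commute)
      then show ?case using elim by linarith
    qed
  qed
  have "((\<lambda>z. b (fst z) (snd z)) \<longlongrightarrow> b s0 x0) (at (s0, x0) within S \<times> UNIV)" if s0: "s0 \<in> S" for s0 x0
    unfolding tendsto_componentwise_iff[of "\<lambda>z. b (fst z) (snd z)"]
  proof
    fix i :: 'a assume "i \<in> Basis"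
    show "((\<lambda>z. b (fst z) (snd z) \<bullet> i) \<longlongrightarrow> b s0 x0 \<bullet> i) (at (s0, x0) within S \<times> UNIV)"
    proof (rule order_tendstoI)
      fix a assume "a < b s0 x0 \<bullet> i"
      then have "\<forall>\<^sub>F z in at (s0, x0) within S \<times> UNIV. b (fst z) (snd z) \<bullet> (- i) < b s0 x0 \<bullet> (- i) + (b s0 x0 \<bullet> i - a)"
        using s0 by (intro upper) auto
      then show "\<forall>\<^sub>F z in at (s0, x0) within S \<times> UNIV. a < b (fst z) (snd z) \<bullet> i"
        by eventually_elim simp
    next
      fix a assume "b s0 x0 \<bullet> i < a"
      then have "\<forall>\<^sub>F z in at (s0, x0) within S \<times> UNIV. b (fst z) (snd z) \<bullet> i < b s0 x0 \<bullet> i + (a - b s0 x0 \<bullet> i)"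
        using s0 by (intro upper) auto
      then show "\<forall>\<^sub>F z in at (s0, x0) within S \<times> UNIV. b (fst z) (snd z) \<bullet> i < a"
        by eventually_elim simp
    qed
  qed
  then show ?thesis by (auto simp: continuous_on_def case_prod_beta)
qed

section \<open>Weak convergence and flat derivatives\<close>

lemma continuous_map_weak_topology:
  fixes m :: "'s::topological_space \<Rightarrow> (real ^ 'd) measure"
  assumes "\<And>s. s \<in> S \<Longrightarrow> m s \<in> Pp p"
    and "\<And>f :: (real ^ 'd) \<Rightarrow>\<^sub>C real. continuous_on S (\<lambda>s. \<integral>x. f x \<partial>m s)"
  shows "continuous_map (top_of_set S) (weak_topology p) m"
  unfolding weak_topology_def
proof (rule continuous_map_pullback')
  have "continuous_on S ((\<lambda>\<mu> (f :: (real ^ 'd) \<Rightarrow>\<^sub>C real). \<integral>x. f x \<partial>\<mu>) \<circ> m)"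
    unfolding comp_def by (rule continuous_on_coordinatewise_then_product) (rule assms(2))
  then show "continuous_map (top_of_set S) euclidean ((\<lambda>\<mu> (f :: (real ^ 'd) \<Rightarrow>\<^sub>C real). \<integral>x. f x \<partial>\<mu>) \<circ> m)"
    by simp
qed (use assms(1) in auto)

lemma flat_derivative_continuous_on:
  fixes m :: "'s::topological_space \<Rightarrow> (real ^ 'd) measure"
  assumes flat: "flat_derivative p H dH" and m: "continuous_map (top_of_set S) (weak_topology p) m"
  shows "continuous_on (S \<times> UNIV) (\<lambda>(s, x). dH (m s) x)"
proof -
  have 1: "continuous_map (prod_topology (weak_topology p) euclidean) euclideanreal (\<lambda>(\<mu>, x). dH \<mu> x)"
    using flat by (simp add: flat_derivative_def)
  have "continuous_map (prod_topology (top_of_set S) euclidean) (prod_topology (weak_topology p) euclidean)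
      (\<lambda>z. (m (fst z), snd z))"
    by (intro continuous_map_pairedI continuous_map_snd
        continuous_map_compose[OF continuous_map_fst m, unfolded comp_def])
  from continuous_map_compose[OF this 1]
  have "continuous_map (prod_topology (top_of_set S) euclidean) euclideanreal (\<lambda>(s, x). dH (m s) x)"
    by (simp add: comp_def case_prod_unfold)
  then show ?thesis
    using prod_topology_subtopology_eu[of S "UNIV :: (real ^ 'd) set"] by simp
qed


lemma PpD:
  assumes "\<mu> \<in> Pp p"
  shows "prob_space \<mu>" "sets \<mu> = sets borel" "integrable \<mu> (\<lambda>x. norm x powr p)" "space \<mu> = UNIV"
  using assms sets_eq_imp_space_eq[of \<mu> borel] by (auto simp: Pp_def)

lemma Pp_moment_integrable:
  assumes "\<mu> \<in> Pp p" "f \<in> borel_measurable borel" "\<And>x. \<bar>f x\<bar> \<le> C * (1 + norm x powr p)"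
  shows "integrable \<mu> f"
proof -
  interpret prob_space \<mu> using PpD[OF assms(1)] by simp
  have "integrable \<mu> (\<lambda>x. C * (1 + norm x powr p))" using PpD[OF assms(1)] by simp
  then show ?thesis
  proof (rule Bochner_Integration.integrable_bound)
    show "f \<in> borel_measurable \<mu>" using assms(2) PpD(2)[OF assms(1)] by (simp cong: measurable_cong_sets)
    show "AE x in \<mu>. norm (f x) \<le> norm (C * (1 + norm x powr p))"
      using assms(3) by (auto intro!: AE_I2 order_trans[OF assms(3)])
  qed
qed

text \<open>The mixture is defined by its values on sets, so the formula is lifted to functions by the usual
induction; for sets it needs the countable additivity of the mixture.\<close>

lemma mixture_nn_integral:
  fixes \<mu>1 \<mu>0 :: "(real ^ 'd) measure"
  assumes s1: "sets \<mu>1 = sets borel" and s0: "sets \<mu>0 = sets borel"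
    and f: "f \<in> borel_measurable borel"
  shows "(\<integral>\<^sup>+x. f x \<partial>mixture t \<mu>1 \<mu>0) = ennreal t * (\<integral>\<^sup>+x. f x \<partial>\<mu>1) + ennreal (1 - t) * (\<integral>\<^sup>+x. f x \<partial>\<mu>0)"
proof -
  have sets[simp, measurable_cong]: "sets (mixture t \<mu>1 \<mu>0) = sets borel"
    by (simp add: mixture_def sets.sigma_sets_eq[of borel, simplified])
  note [measurable_cong] = s1 s0
  have em: "emeasure (mixture t \<mu>1 \<mu>0) A = ennreal t * emeasure \<mu>1 A + ennreal (1 - t) * emeasure \<mu>0 A"
    if "A \<in> sets borel" for A
  proof (rule emeasure_measure_of[OF mixture_def])
    show "countably_additive (sets (mixture t \<mu>1 \<mu>0)) (\<lambda>A. ennreal t * emeasure \<mu>1 A + ennreal (1 - t) * emeasure \<mu>0 A)"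
    proof (rule countably_additiveI)
      fix A :: "nat \<Rightarrow> (real ^ 'd) set" assume A: "range A \<subseteq> sets (mixture t \<mu>1 \<mu>0)" "disjoint_family A"
      have "(\<Sum>i. emeasure \<mu>1 (A i)) = emeasure \<mu>1 (\<Union>i. A i)" "(\<Sum>i. emeasure \<mu>0 (A i)) = emeasure \<mu>0 (\<Union>i. A i)"
        using A s1 s0 by (auto intro!: suminf_emeasure)
      then show "(\<Sum>i. ennreal t * emeasure \<mu>1 (A i) + ennreal (1 - t) * emeasure \<mu>0 (A i))
          = ennreal t * emeasure \<mu>1 (\<Union>i. A i) + ennreal (1 - t) * emeasure \<mu>0 (\<Union>i. A i)"
        by (subst suminf_add[symmetric]) auto
    qed
  qed (use that in \<open>auto simp: positive_def\<close>)
  show ?thesis using f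
  proof (induction rule: borel_measurable_induct)
    case (cong f g)
    then have "f = g" by auto
    then show ?case using cong by simp
  next
    case (set A)
    then show ?case using em[of A] s1 s0 by (simp add: nn_integral_indicator)
  next
    case (mult u c)
    then show ?case by (simp add: nn_integral_cmult distrib_left mult_ac)
  next
    case (add u v)
    then show ?case by (simp add: nn_integral_add distrib_left add_ac)
  next
    case (seq U)
    have mono: "incseq (\<lambda>i. \<integral>\<^sup>+x. U i x \<partial>M)" for M :: "(real ^ 'd) measure"
      using seq(3) by (auto simp: incseq_def le_fun_def intro!: nn_integral_mono)
    have sup: "(\<integral>\<^sup>+x. (SUP i. U i) x \<partial>M) = (SUP i. \<integral>\<^sup>+x. U i x \<partial>M)" if "sets M = sets borel" for M :: "(real ^ 'd) measure"
    proof -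
      have "(\<integral>\<^sup>+x. (SUP i. U i) x \<partial>M) = (\<integral>\<^sup>+x. (SUP i. U i x) \<partial>M)" by (simp add: image_image)
      also have "\<dots> = (SUP i. \<integral>\<^sup>+x. U i x \<partial>M)"
        using seq that by (intro nn_integral_monotone_convergence_SUP) (auto cong: measurable_cong_sets)
      finally show ?thesis .
    qed
    have "(\<integral>\<^sup>+x. (SUP i. U i) x \<partial>mixture t \<mu>1 \<mu>0)
        = (SUP i. ennreal t * (\<integral>\<^sup>+x. U i x \<partial>\<mu>1) + ennreal (1 - t) * (\<integral>\<^sup>+x. U i x \<partial>\<mu>0))"
      unfolding sup[OF sets] using seq by simp
    also have "\<dots> = (SUP i. ennreal t * (\<integral>\<^sup>+x. U i x \<partial>\<mu>1)) + (SUP i. ennreal (1 - t) * (\<integral>\<^sup>+x. U i x \<partial>\<mu>0))"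
      using mono by (intro ennreal_SUP_add) (auto simp: incseq_def intro!: mult_left_mono)
    also have "\<dots> = ennreal t * (\<integral>\<^sup>+x. (SUP i. U i) x \<partial>\<mu>1) + ennreal (1 - t) * (\<integral>\<^sup>+x. (SUP i. U i) x \<partial>\<mu>0)"
      unfolding sup[OF s1] sup[OF s0] by (simp add: SUP_mult_left_ennreal)
    finally show ?case .
  qed
qed

lemma sets_mixture [simp]: "sets (mixture t \<mu>1 \<mu>0) = sets borel"
  by (simp add: mixture_def sets.sigma_sets_eq[of borel, simplified])

lemma mixture_in_Pp:
  assumes \<mu>1: "\<mu>1 \<in> Pp p" and \<mu>0: "\<mu>0 \<in> Pp p" and t: "t \<in> {0..1}"
  shows "mixture t \<mu>1 \<mu>0 \<in> Pp p"
proof -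
  note nn = mixture_nn_integral[OF PpD(2)[OF \<mu>1] PpD(2)[OF \<mu>0], of _ t]
  have sp: "space (mixture t \<mu>1 \<mu>0) = UNIV" using sets_eq_imp_space_eq[OF sets_mixture] by simp
  interpret m1: prob_space \<mu>1 using PpD[OF \<mu>1] by simp
  interpret m0: prob_space \<mu>0 using PpD[OF \<mu>0] by simp
  have "emeasure (mixture t \<mu>1 \<mu>0) (space (mixture t \<mu>1 \<mu>0)) = 1"
    using nn[of "\<lambda>_. 1"] m1.emeasure_space_1 m0.emeasure_space_1 t by (simp flip: ennreal_plus)
  then have "prob_space (mixture t \<mu>1 \<mu>0)" by (rule prob_spaceI)
  moreover have "integrable (mixture t \<mu>1 \<mu>0) (\<lambda>x. norm x powr p)"
  proof (rule integrableI_bounded)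
    have fin: "(\<integral>\<^sup>+x. ennreal (norm x powr p) \<partial>\<mu>1) < \<infinity>" "(\<integral>\<^sup>+x. ennreal (norm x powr p) \<partial>\<mu>0) < \<infinity>"
      using PpD(3)[OF \<mu>1] PpD(3)[OF \<mu>0] by (simp_all add: integrable_iff_bounded)
    have "(\<integral>\<^sup>+x. ennreal (norm x powr p) \<partial>mixture t \<mu>1 \<mu>0) < \<infinity>"
      using fin by (subst nn) (auto simp: ennreal_mult_less_top)
    then show "(\<integral>\<^sup>+x. ennreal (norm (norm x powr p)) \<partial>mixture t \<mu>1 \<mu>0) < \<infinity>" by simp
  qed (simp cong: measurable_cong_sets)
  ultimately show ?thesis by (simp add: Pp_def)
qed

lemma mixture_integral:
  fixes f :: "real ^ 'd \<Rightarrow> real"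
  assumes \<mu>1: "\<mu>1 \<in> Pp p" and \<mu>0: "\<mu>0 \<in> Pp p" and t: "t \<in> {0..1}"
    and f: "f \<in> borel_measurable borel" "\<And>x. \<bar>f x\<bar> \<le> B"
  shows "(\<integral>x. f x \<partial>mixture t \<mu>1 \<mu>0) = t * (\<integral>x. f x \<partial>\<mu>1) + (1 - t) * (\<integral>x. f x \<partial>\<mu>0)"
proof -
  let ?m = "mixture t \<mu>1 \<mu>0"
  have mP: "?m \<in> Pp p" by (rule mixture_in_Pp[OF \<mu>1 \<mu>0 t])
  have eq: "ennreal (\<integral>x. f x + B \<partial>M) = (\<integral>\<^sup>+x. ennreal (f x + B) \<partial>M)"
    and int: "integrable M f" and add: "(\<integral>x. f x + B \<partial>M) = (\<integral>x. f x \<partial>M) + B" and nn: "0 \<le> (\<integral>x. f x + B \<partial>M)"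
    if "M \<in> Pp p" for M :: "(real ^ 'd) measure"
  proof -
    interpret prob_space M using PpD[OF that] by simp
    show i: "integrable M f"
      using f PpD(2)[OF that] by (intro integrable_const_bound[of _ B]) (auto cong: measurable_cong_sets)
    have nn': "0 \<le> f x + B" for x using f(2)[of x] by linarith
    show "ennreal (\<integral>x. f x + B \<partial>M) = (\<integral>\<^sup>+x. ennreal (f x + B) \<partial>M)"
      using i nn' by (intro nn_integral_eq_integral[symmetric]) auto
    show "(\<integral>x. f x + B \<partial>M) = (\<integral>x. f x \<partial>M) + B" using i by (simp add: prob_space)
    show "0 \<le> (\<integral>x. f x + B \<partial>M)" using nn' by (intro Bochner_Integration.integral_nonneg) auto
  qed
  have "ennreal (\<integral>x. f x + B \<partial>?m) = ennreal t * ennreal (\<integral>x. f x + B \<partial>\<mu>1) + ennreal (1 - t) * ennreal (\<integral>x. f x + B \<partial>\<mu>0)"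
    unfolding eq[OF mP] eq[OF \<mu>1] eq[OF \<mu>0]
    using f by (intro mixture_nn_integral PpD(2)[OF \<mu>1] PpD(2)[OF \<mu>0]) auto
  also have "\<dots> = ennreal (t * (\<integral>x. f x + B \<partial>\<mu>1) + (1 - t) * (\<integral>x. f x + B \<partial>\<mu>0))"
    using t nn[OF \<mu>1] nn[OF \<mu>0] by (simp add: ennreal_mult ennreal_plus)
  finally have "(\<integral>x. f x + B \<partial>?m) = t * (\<integral>x. f x + B \<partial>\<mu>1) + (1 - t) * (\<integral>x. f x + B \<partial>\<mu>0)"
    using t nn[OF \<mu>1] nn[OF \<mu>0] nn[OF mP] by (subst (asm) ennreal_inj) (auto intro!: add_nonneg_nonneg)
  then show ?thesis unfolding add[OF mP] add[OF \<mu>1] add[OF \<mu>0] by (simp add: algebra_simps)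
qed

lemma mixture_path:
  fixes \<mu>1 \<mu>0 :: "(real ^ 'd) measure"
  assumes \<mu>1: "\<mu>1 \<in> Pp p" and \<mu>0: "\<mu>0 \<in> Pp p"
  shows "continuous_map (top_of_set {0..1}) (weak_topology p) (\<lambda>t. mixture t \<mu>1 \<mu>0)"
proof (rule continuous_map_weak_topology)
  fix f :: "(real ^ 'd) \<Rightarrow>\<^sub>C real"
  have "(\<integral>x. f x \<partial>mixture t \<mu>1 \<mu>0) = t * (\<integral>x. f x \<partial>\<mu>1) + (1 - t) * (\<integral>x. f x \<partial>\<mu>0)" if "t \<in> {0..1}" for t
    using norm_bounded[of f]
    by (intro mixture_integral[OF \<mu>1 \<mu>0 that, of _ "norm f"]) (auto intro!: borel_measurable_continuous_onI)
  then show "continuous_on {0..1} (\<lambda>t. \<integral>x. f x \<partial>mixture t \<mu>1 \<mu>0)"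
    by (subst continuous_on_cong[OF refl]) (auto intro!: continuous_intros)
qed (rule mixture_in_Pp[OF \<mu>1 \<mu>0])

text \<open>The segment between two measures is weakly compact, so the growth condition of a flat derivative
provides one integrable bound for the whole segment, and dominated convergence applies.\<close>

lemma flat_derivative_mixture:
  fixes dH :: "(real ^ 'd) measure \<Rightarrow> real ^ 'd \<Rightarrow> real"
  assumes flat: "flat_derivative p H dH" and \<mu>1: "\<mu>1 \<in> Pp p" and \<mu>0: "\<mu>0 \<in> Pp p"
  shows "\<mu> \<in> Pp p \<Longrightarrow> t \<in> {0..1} \<Longrightarrow> integrable \<mu> (\<lambda>x. dH (mixture t \<mu>1 \<mu>0) x)"
    and "\<mu> \<in> Pp p \<Longrightarrow> continuous_on {0..1} (\<lambda>t. \<integral>x. dH (mixture t \<mu>1 \<mu>0) x \<partial>\<mu>)"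
proof -
  note path = mixture_path[OF \<mu>1 \<mu>0]
  have cont: "continuous_on ({0..1} \<times> UNIV) (\<lambda>(t, x). dH (mixture t \<mu>1 \<mu>0) x)"
    by (rule flat_derivative_continuous_on[OF flat path])
  have meas: "(\<lambda>x. dH (mixture t \<mu>1 \<mu>0) x) \<in> borel_measurable borel" if "t \<in> {0..1}" for t
  proof (rule borel_measurable_continuous_onI)
    have "continuous_on UNIV (\<lambda>x. (t, x))" by (intro continuous_intros)
    from continuous_on_compose2[OF cont this image_subsetI]
    show "continuous_on UNIV (\<lambda>x. dH (mixture t \<mu>1 \<mu>0) x)" using that by simp
  qed
  have "compactin (weak_topology p) ((\<lambda>t. mixture t \<mu>1 \<mu>0) ` {0..1})"
    by (rule image_compactin[OF _ path]) (simp add: compactin_subtopology)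
  then obtain C where C: "\<And>t x. t \<in> {0..1} \<Longrightarrow> \<bar>dH (mixture t \<mu>1 \<mu>0) x\<bar> \<le> C * (1 + norm x powr p)"
    using flat unfolding flat_derivative_def by blast
  show int: "integrable \<mu> (\<lambda>x. dH (mixture t \<mu>1 \<mu>0) x)" if "\<mu> \<in> Pp p" "t \<in> {0..1}" for \<mu> t
    by (rule Pp_moment_integrable[OF that(1) meas C]) (use that in auto)
  show "continuous_on {0..1} (\<lambda>t. \<integral>x. dH (mixture t \<mu>1 \<mu>0) x \<partial>\<mu>)" if \<mu>: "\<mu> \<in> Pp p" for \<mu>
    unfolding continuous_on_sequentially
  proof (intro allI ballI impI)
    fix s a assume s: "a \<in> {0..1::real}" "(\<forall>n. s n \<in> {0..1}) \<and> s \<longlonglongrightarrow> a"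
    interpret prob_space \<mu> using PpD[OF \<mu>] by simp
    show "((\<lambda>t. \<integral>x. dH (mixture t \<mu>1 \<mu>0) x \<partial>\<mu>) \<circ> s) \<longlonglongrightarrow> (\<integral>x. dH (mixture a \<mu>1 \<mu>0) x \<partial>\<mu>)"
      unfolding comp_def
    proof (rule integral_dominated_convergence)
      show "integrable \<mu> (\<lambda>x. C * (1 + norm x powr p))" using PpD[OF \<mu>] by simp
      show "AE x in \<mu>. (\<lambda>n. dH (mixture (s n) \<mu>1 \<mu>0) x) \<longlonglongrightarrow> dH (mixture a \<mu>1 \<mu>0) x"
      proof (rule AE_I2)
        fix x :: "real ^ 'd"
        have "continuous_on {0..1::real} (\<lambda>t. (t, x))" by (intro continuous_intros)
        from continuous_on_compose2[OF cont this] have "continuous_on {0..1} (\<lambda>t. dH (mixture t \<mu>1 \<mu>0) x)"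
          by auto
        then show "(\<lambda>n. dH (mixture (s n) \<mu>1 \<mu>0) x) \<longlonglongrightarrow> dH (mixture a \<mu>1 \<mu>0) x"
          using s unfolding continuous_on_sequentially comp_def by blast
      qed
      show "(\<lambda>x. dH (mixture a \<mu>1 \<mu>0) x) \<in> borel_measurable \<mu>"
        using int[OF \<mu> s(1)] by simp
      show "(\<lambda>x. dH (mixture (s n) \<mu>1 \<mu>0) x) \<in> borel_measurable \<mu>" for n
        using int[OF \<mu>, of "s n"] s(2) by simp
      show "AE x in \<mu>. norm (dH (mixture (s n) \<mu>1 \<mu>0) x) \<le> C * (1 + norm x powr p)" for n
        using C s(2) by simp
    qed
  qed
qed

text \<open>For a fixed increment \<open>u\<close>, the function \<open>\<delta>\<^sup>2H(m, x + u, \<cdot>) - \<delta>\<^sup>2H(m, x, \<cdot>)\<close> is Lipschitz with constant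
\<open>L |u|\<close>, so the difference of its integrals against the two measures is at most \<open>L |u| w\<close>, uniformly
along the segment. Integrated over the segment, this bounds the increment of
\<open>\<delta>H(\<mu>1, \<cdot>) - \<delta>H(\<mu>0, \<cdot>)\<close>, and the gradient is reached only at the end, by letting the increment tend to
0 in the direction of the difference of the two gradients.\<close>

lemma intrinsic_deriv_lipschitz_in_measure:
  fixes dH :: "(real ^ 'd) measure \<Rightarrow> real ^ 'd \<Rightarrow> real"
  assumes flat2: "second_flat_derivative p dH d2H"
    and C2: "\<And>\<mu>. \<mu> \<in> Pp p \<Longrightarrow> C2 (dH \<mu>)" "\<And>\<mu>. \<mu> \<in> Pp p \<Longrightarrow> C2 (\<lambda>(x, y). d2H \<mu> x y)"
    and bdd: "bdd_above (deriv2_opnorms p d2H)"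
    and \<mu>1: "\<mu>1 \<in> Pp p" and \<mu>0: "\<mu>0 \<in> Pp p"
    and w: "\<And>K g. 0 \<le> K \<Longrightarrow> (\<And>y y'. \<bar>g y - g y'\<bar> \<le> K * norm (y - y')) \<Longrightarrow>
      \<bar>(\<integral>y. g y \<partial>\<mu>1) - (\<integral>y. g y \<partial>\<mu>0)\<bar> \<le> K * w"
  shows "norm (intrinsic_deriv dH \<mu>1 x - intrinsic_deriv dH \<mu>0 x) \<le> Sup (deriv2_opnorms p d2H) * w"
proof -
  define L where "L = Sup (deriv2_opnorms p d2H)"
  have L: "onorm ((*v) (intrinsic_deriv2 d2H \<mu> x y)) \<le> L" if "\<mu> \<in> Pp p" for \<mu> x y
    unfolding L_def using that by (intro cSup_upper[OF _ bdd]) (auto simp: deriv2_opnorms_def image_iff)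
  have "0 \<le> onorm ((*v) (intrinsic_deriv2 d2H \<mu>1 x x))"
    by (intro onorm_pos_le matrix_vector_mul_bounded_linear)
  then have L0: "0 \<le> L" using L[OF \<mu>1] by (rule order_trans)
  have w0: "0 \<le> w" using w[of 1 "\<lambda>_. 0"] by simp
  have flat: "flat_derivative p (\<lambda>\<mu>. dH \<mu> x) (\<lambda>\<mu> y. d2H \<mu> x y)" for x
    using flat2 by (simp add: second_flat_derivative_def)
  define I where "I x t = (\<integral>y. d2H (mixture t \<mu>1 \<mu>0) x y \<partial>\<mu>1) - (\<integral>y. d2H (mixture t \<mu>1 \<mu>0) x y \<partial>\<mu>0)" for x t
  have I: "dH \<mu>1 x - dH \<mu>0 x = (LINT t:{0..1}|lborel. I x t)" for x
    using flat[of x] \<mu>1 \<mu>0 unfolding flat_derivative_def I_def by blast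
  have I_int: "set_integrable lborel {0..1} (I x)" for x
    unfolding I_def[abs_def]
    by (intro borel_integrable_atLeastAtMost' continuous_on_diff flat_derivative_mixture(2)[OF flat \<mu>1 \<mu>0] \<mu>1 \<mu>0)
  have I_diff: "\<bar>I (x + u) t - I x t\<bar> \<le> L * norm u * w" if t: "t \<in> {0..1}" for x u t
  proof -
    let ?m = "mixture t \<mu>1 \<mu>0"
    note m = mixture_in_Pp[OF \<mu>1 \<mu>0 t]
    have i: "integrable \<mu>1 (\<lambda>y. d2H ?m x y)" "integrable \<mu>0 (\<lambda>y. d2H ?m x y)" for x
      by (intro flat_derivative_mixture(1)[OF flat \<mu>1 \<mu>0] \<mu>1 \<mu>0 t)+
    have "I (x + u) t - I x t = (\<integral>y. d2H ?m (x + u) y - d2H ?m x y \<partial>\<mu>1) - (\<integral>y. d2H ?m (x + u) y - d2H ?m x y \<partial>\<mu>0)"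
      using i by (simp add: I_def)
    also have "\<bar>\<dots>\<bar> \<le> L * norm u * w"
    proof (rule w)
      fix y y'
      have "\<bar>(d2H ?m (x + u) y - d2H ?m x y) - (d2H ?m (x + u) y' - d2H ?m x y')\<bar> \<le> L * norm ((x + u) - x) * norm (y - y')"
        by (rule mixed_difference_le[OF C2(2)[OF m] L[OF m, unfolded intrinsic_deriv2_def]])
      then show "\<bar>(d2H ?m (x + u) y - d2H ?m x y) - (d2H ?m (x + u) y' - d2H ?m x y')\<bar> \<le> L * norm u * norm (y - y')"
        by simp
    qed (use L0 in auto)
    finally show ?thesis .
  qed
  have \<Psi>: "\<bar>(dH \<mu>1 (x + u) - dH \<mu>0 (x + u)) - (dH \<mu>1 x - dH \<mu>0 x)\<bar> \<le> L * w * norm u" for u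
  proof -
    have "(dH \<mu>1 (x + u) - dH \<mu>0 (x + u)) - (dH \<mu>1 x - dH \<mu>0 x) = (LINT t:{0..1}|lborel. I (x + u) t - I x t)"
      unfolding I using I_int by (simp add: set_integral_diff)
    also have "\<bar>\<dots>\<bar> \<le> (LINT t:{0..1::real}|lborel. \<bar>I (x + u) t - I x t\<bar>)"
      using set_integral_norm_bound[OF set_integral_diff(1)[OF I_int I_int]] by simp
    also have "\<dots> \<le> (LINT t:{0..1::real}|lborel. L * norm u * w)"
      using I_diff set_integrable_abs[OF set_integral_diff(1)[OF I_int I_int]]
      by (intro set_integral_mono) (auto simp: set_integrable_def)
    also have "\<dots> = L * norm u * w" by (simp add: set_lebesgue_integral_def)
    finally show ?thesis by (simp add: mult_ac)
  qed
  \<comment> \<open>Moving in the direction of the difference makes the derivative of \<open>\<psi>\<close> equal to its squared norm.\<close>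
  define a where "a = intrinsic_deriv dH \<mu>1 x - intrinsic_deriv dH \<mu>0 x"
  define \<psi> where "\<psi> r = dH \<mu>1 (x + r *\<^sub>R a) - dH \<mu>0 (x + r *\<^sub>R a)" for r
  have "((\<lambda>r. (\<psi> (0 + r) - \<psi> 0) / r) \<longlongrightarrow> a \<bullet> a) (at 0)"
  proof -
    have 0: "((\<lambda>r. x + r *\<^sub>R a) has_derivative (\<lambda>r. r *\<^sub>R a)) (at 0)"
      by (auto intro!: derivative_eq_intros)
    have "((\<lambda>r. dH \<mu> (x + r *\<^sub>R a)) has_derivative (\<lambda>r. gradient (dH \<mu>) (x + 0 *\<^sub>R a) \<bullet> (r *\<^sub>R a))) (at 0)"
      if "\<mu> \<in> Pp p" for \<mu>
      by (rule has_derivative_compose[OF 0 C2_has_derivative_gradient[OF C2(1)[OF that]]])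
    from has_derivative_diff[OF this[OF \<mu>1] this[OF \<mu>0]]
    have "(\<psi> has_derivative (\<lambda>r. r * (a \<bullet> a))) (at 0)"
      by (simp add: \<psi>_def[abs_def] a_def intrinsic_deriv_def algebra_simps)
    moreover have "(\<lambda>r. r * (a \<bullet> a)) = (*) (a \<bullet> a)" by (simp add: fun_eq_iff)
    ultimately have "(\<psi> has_field_derivative (a \<bullet> a)) (at 0)"
      by (simp add: has_field_derivative_def)
    then show ?thesis by (simp add: DERIV_def)
  qed
  moreover have "\<forall>\<^sub>F r in at 0. (\<psi> (0 + r) - \<psi> 0) / r \<le> L * w * norm a"
  proof (rule eventually_at_topological[THEN iffD2], intro exI[of _ UNIV] conjI ballI impI)
    fix r :: real assume "r \<noteq> 0"
    have "\<bar>\<psi> r - \<psi> 0\<bar> \<le> L * w * norm (r *\<^sub>R a)" using \<Psi>[of "r *\<^sub>R a"] by (simp add: \<psi>_def)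
    then have "\<bar>\<psi> r - \<psi> 0\<bar> / \<bar>r\<bar> \<le> L * w * norm a" using \<open>r \<noteq> 0\<close> by (simp add: divide_le_eq mult_ac)
    then show "(\<psi> (0 + r) - \<psi> 0) / r \<le> L * w * norm a" by (simp flip: abs_divide)
  qed auto
  ultimately have "a \<bullet> a \<le> L * w * norm a"
    by (rule tendsto_upperbound) simp
  then have "norm a * norm a \<le> (L * w) * norm a" by (simp add: dot_square_norm power2_eq_square)
  then have "norm a \<le> L * w" using L0 w0 by (cases "norm a = 0") auto
  then show ?thesis by (simp add: a_def L_def)
qed

section \<open>Empirical measures tested against Lipschitz functions\<close>

text \<open>Fluctuations of the empirical mean of \<open>n\<close> independent samples of a law with finite second moment.\<close>

locale iid_sample = prob_space M for M :: "'w measure" +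
  fixes Y :: "nat \<Rightarrow> 'w \<Rightarrow> real ^ 'd" and n :: nat and \<mu> :: "(real ^ 'd) measure"
  assumes indep: "indep_vars (\<lambda>_. borel) Y {1..n}"
    and law: "\<And>i. i \<in> {1..n} \<Longrightarrow> distr M borel (Y i) = \<mu>"
    and n_pos: "n \<ge> 1"
    and int2: "integrable \<mu> (\<lambda>x. (norm x)\<^sup>2)"
begin

definition dev :: "(real ^ 'd \<Rightarrow> real) \<Rightarrow> 'w \<Rightarrow> real" where
  "dev g \<omega> = (\<Sum>i=1..n. g (Y i \<omega>)) / real n - (\<integral>x. g x \<partial>\<mu>)"

lemma Y_measurable [measurable]: "i \<in> {1..n} \<Longrightarrow> Y i \<in> borel_measurable M"
  using indep by (auto simp: indep_vars_def)

lemma sets_\<mu> [measurable_cong, simp]: "sets \<mu> = sets borel"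
  using law[of 1] n_pos by (metis atLeastAtMost_iff le_refl sets_distr)

lemma space_\<mu> [simp]: "space \<mu> = UNIV"
  using sets_eq_imp_space_eq[OF sets_\<mu>] by simp

sublocale mu: prob_space \<mu>
proof -
  have "prob_space (distr M borel (Y 1))"
    using n_pos by (intro prob_space_distr) auto
  then show "prob_space \<mu>" using law[of 1] n_pos by simp
qed

lemma integral_law:
  fixes g :: "real ^ 'd \<Rightarrow> real"
  assumes "i \<in> {1..n}" "g \<in> borel_measurable borel"
  shows "(\<integral>\<omega>. g (Y i \<omega>) \<partial>M) = (\<integral>x. g x \<partial>\<mu>)"
    and "integrable M (\<lambda>\<omega>. g (Y i \<omega>)) \<longleftrightarrow> integrable \<mu> g"
proof -
  have "(\<integral>x. g x \<partial>distr M borel (Y i)) = (\<integral>\<omega>. g (Y i \<omega>) \<partial>M)"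
    using assms by (intro integral_distr) auto
  then show "(\<integral>\<omega>. g (Y i \<omega>) \<partial>M) = (\<integral>x. g x \<partial>\<mu>)" using law[OF assms(1)] by simp
  have "integrable (distr M borel (Y i)) g \<longleftrightarrow> integrable M (\<lambda>\<omega>. g (Y i \<omega>))"
    using assms by (intro integrable_distr_eq) auto
  then show "integrable M (\<lambda>\<omega>. g (Y i \<omega>)) \<longleftrightarrow> integrable \<mu> g" using law[OF assms(1)] by simp
qed

lemma dev_measurable [measurable]: "g \<in> borel_measurable borel \<Longrightarrow> dev g \<in> borel_measurable M"
  unfolding dev_def[abs_def]
  by (intro borel_measurable_diff borel_measurable_divide borel_measurable_sum borel_measurable_const
      measurable_compose[OF Y_measurable])

lemma dev_add: "integrable \<mu> f \<Longrightarrow> integrable \<mu> g \<Longrightarrow> dev (\<lambda>x. f x + g x) \<omega> = dev f \<omega> + dev g \<omega>"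
  by (simp add: dev_def sum.distrib add_divide_distrib)

lemma dev_sum:
  "(\<And>a. a \<in> I \<Longrightarrow> integrable \<mu> (f a)) \<Longrightarrow> dev (\<lambda>x. \<Sum>a\<in>I. f a x) \<omega> = (\<Sum>a\<in>I. dev (f a) \<omega>)"
  by (simp add: dev_def sum.swap[of _ I] sum_divide_distrib sum_subtractf)

lemma dev_cmult: "dev (\<lambda>x. c * f x) \<omega> = c * dev f \<omega>"
  by (simp add: dev_def sum_distrib_left[symmetric] right_diff_distrib)

lemma dev_const [simp]: "dev (\<lambda>x. c) \<omega> = 0"
  using n_pos by (simp add: dev_def mu.prob_space[simplified])

lemma dev_square:
  assumes g[measurable]: "g \<in> borel_measurable borel" and g2: "integrable \<mu> (\<lambda>x. (g x)\<^sup>2)"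
  shows "integrable M (\<lambda>\<omega>. (dev g \<omega>)\<^sup>2)"
    and "(\<integral>\<omega>. (dev g \<omega>)\<^sup>2 \<partial>M) \<le> (\<integral>x. (g x)\<^sup>2 \<partial>\<mu>) / real n"
proof -
  define c where "c = (\<integral>x. g x \<partial>\<mu>)"
  define G where "G i \<omega> = g (Y i \<omega>) - c" for i \<omega>
  have gi: "integrable \<mu> g"
    by (rule mu.square_integrable_imp_integrable[OF _ g2]) simp
  have G2': "integrable \<mu> (\<lambda>x. (g x - c)\<^sup>2)"
    using g2 gi by (simp add: power2_diff)
  have Gm[measurable]: "i \<in> {1..n} \<Longrightarrow> G i \<in> borel_measurable M" for i
    unfolding G_def by measurable
  have Gi: "integrable M (G i)" "(\<integral>\<omega>. G i \<omega> \<partial>M) = 0" if "i \<in> {1..n}" for i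
    using integral_law[OF that g] gi that by (simp_all add: G_def[abs_def] prob_space c_def)
  have G2: "integrable M (\<lambda>\<omega>. (G i \<omega>)\<^sup>2)" "(\<integral>\<omega>. (G i \<omega>)\<^sup>2 \<partial>M) \<le> (\<integral>x. (g x)\<^sup>2 \<partial>\<mu>)" if "i \<in> {1..n}" for i
  proof -
    show "integrable M (\<lambda>\<omega>. (G i \<omega>)\<^sup>2)"
      using integral_law(2)[OF that, of "\<lambda>x. (g x - c)\<^sup>2"] G2' by (simp add: G_def)
    have "(\<integral>\<omega>. (G i \<omega>)\<^sup>2 \<partial>M) = (\<integral>x. (g x - c)\<^sup>2 \<partial>\<mu>)"
      using integral_law(1)[OF that, of "\<lambda>x. (g x - c)\<^sup>2"] by (simp add: G_def)
    also have "\<dots> = (\<integral>x. (g x)\<^sup>2 \<partial>\<mu>) - c\<^sup>2"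
      using mu.variance_eq[OF gi g2] by (simp add: c_def)
    finally show "(\<integral>\<omega>. (G i \<omega>)\<^sup>2 \<partial>M) \<le> (\<integral>x. (g x)\<^sup>2 \<partial>\<mu>)" by simp
  qed
  have prod: "integrable M (\<lambda>\<omega>. G i \<omega> * G j \<omega>) \<and>
      (\<integral>\<omega>. G i \<omega> * G j \<omega> \<partial>M) \<le> (if i = j then (\<integral>x. (g x)\<^sup>2 \<partial>\<mu>) else 0)"
    if ij: "i \<in> {1..n}" "j \<in> {1..n}" for i j
  proof (cases "i = j")
    case True
    then show ?thesis using G2[OF ij(1)] by (simp add: power2_eq_square)
  next
    case False
    have "indep_vars (\<lambda>_. borel) G {1..n}"
      unfolding G_def[abs_def] by (rule indep_vars_compose2[OF indep]) measurable
    then have 1: "indep_vars (\<lambda>_. borel) G {i, j}"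
      by (rule indep_vars_subset) (use ij in auto)
    have "(\<integral>\<omega>. (\<Prod>k\<in>{i,j}. G k \<omega>) \<partial>M) = (\<Prod>k\<in>{i,j}. \<integral>\<omega>. G k \<omega> \<partial>M)"
      by (rule indep_vars_lebesgue_integral[OF _ 1]) (use ij Gi in auto)
    moreover have "integrable M (\<lambda>\<omega>. (\<Prod>k\<in>{i,j}. G k \<omega>))"
      by (rule indep_vars_integrable[OF _ 1]) (use ij Gi in auto)
    ultimately show ?thesis using False Gi ij by simp
  qed
  have eq: "(dev g \<omega>)\<^sup>2 = (\<Sum>i=1..n. \<Sum>j=1..n. G i \<omega> * G j \<omega>) / (real n)\<^sup>2" for \<omega>
  proof -
    have "dev g \<omega> = (\<Sum>i=1..n. G i \<omega>) / real n"
      using n_pos by (simp add: dev_def G_def sum_subtractf c_def diff_divide_distrib)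
    then have "(dev g \<omega>)\<^sup>2 = (\<Sum>i=1..n. G i \<omega>)\<^sup>2 / (real n)\<^sup>2" by (simp add: power_divide)
    then show ?thesis by (simp add: power2_eq_square sum_product)
  qed
  show "integrable M (\<lambda>\<omega>. (dev g \<omega>)\<^sup>2)"
    unfolding eq using prod by (intro integrable_divide Bochner_Integration.integrable_sum) auto
  have "(\<integral>\<omega>. (dev g \<omega>)\<^sup>2 \<partial>M) = (\<Sum>i=1..n. \<Sum>j=1..n. \<integral>\<omega>. G i \<omega> * G j \<omega> \<partial>M) / (real n)\<^sup>2"
  proof -
    have "(\<integral>\<omega>. (\<Sum>i=1..n. \<Sum>j=1..n. G i \<omega> * G j \<omega>) \<partial>M) = (\<Sum>i=1..n. \<integral>\<omega>. (\<Sum>j=1..n. G i \<omega> * G j \<omega>) \<partial>M)"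
      using prod by (intro Bochner_Integration.integral_sum Bochner_Integration.integrable_sum) blast
    also have "\<dots> = (\<Sum>i=1..n. \<Sum>j=1..n. \<integral>\<omega>. G i \<omega> * G j \<omega> \<partial>M)"
      using prod by (intro sum.cong Bochner_Integration.integral_sum refl) blast
    finally show ?thesis by (simp add: eq)
  qed
  also have "\<dots> \<le> (\<Sum>i=1..n. \<Sum>j=1..n. if i = j then (\<integral>x. (g x)\<^sup>2 \<partial>\<mu>) else 0) / (real n)\<^sup>2"
    using prod by (intro divide_right_mono sum_mono) auto
  also have "\<dots> = (\<integral>x. (g x)\<^sup>2 \<partial>\<mu>) / real n"
    using n_pos by (simp add: power2_eq_square)
  finally show "(\<integral>\<omega>. (dev g \<omega>)\<^sup>2 \<partial>M) \<le> (\<integral>x. (g x)\<^sup>2 \<partial>\<mu>) / real n" .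
qed

text \<open>With the weights \<open>\<sigma>\<close> chosen as bounds for the standard deviations, this form of the Cauchy-Schwarz
inequality replaces Minkowski's inequality for the square norm of a sum of random variables.\<close>

lemma weighted_square_sum:
  fixes a \<sigma> :: "'i \<Rightarrow> real"
  assumes "finite I" "\<And>i. i \<in> I \<Longrightarrow> \<sigma> i > 0"
  shows "(\<Sum>i\<in>I. a i)\<^sup>2 \<le> (\<Sum>i\<in>I. \<sigma> i) * (\<Sum>i\<in>I. (a i)\<^sup>2 / \<sigma> i)"
proof -
  have "(\<Sum>i\<in>I. a i) = (\<Sum>i\<in>I. sqrt (\<sigma> i) * (a i / sqrt (\<sigma> i)))"
    using assms by (intro sum.cong) (auto simp: less_imp_neq[symmetric])
  then have "(\<Sum>i\<in>I. a i)\<^sup>2 \<le> (\<Sum>i\<in>I. (sqrt (\<sigma> i))\<^sup>2) * (\<Sum>i\<in>I. (a i / sqrt (\<sigma> i))\<^sup>2)"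
    using Cauchy_Schwarz_ineq_sum by metis
  also have "\<dots> = (\<Sum>i\<in>I. \<sigma> i) * (\<Sum>i\<in>I. (a i)\<^sup>2 / \<sigma> i)"
    using assms by (intro arg_cong2[where f="(*)"] sum.cong) (auto simp: power_divide less_imp_le)
  finally show ?thesis .
qed

lemma expectation_square_sum:
  fixes a :: "'i \<Rightarrow> 'w \<Rightarrow> real"
  assumes I: "finite I" and \<sigma>: "\<And>i. i \<in> I \<Longrightarrow> \<sigma> i > 0"
    and meas: "\<And>i. i \<in> I \<Longrightarrow> a i \<in> borel_measurable M"
    and int: "\<And>i. i \<in> I \<Longrightarrow> integrable M (\<lambda>\<omega>. (a i \<omega>)\<^sup>2)"
    and le: "\<And>i. i \<in> I \<Longrightarrow> (\<integral>\<omega>. (a i \<omega>)\<^sup>2 \<partial>M) \<le> (\<sigma> i)\<^sup>2"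
  shows "integrable M (\<lambda>\<omega>. (\<Sum>i\<in>I. a i \<omega>)\<^sup>2)"
    and "(\<integral>\<omega>. (\<Sum>i\<in>I. a i \<omega>)\<^sup>2 \<partial>M) \<le> (\<Sum>i\<in>I. \<sigma> i)\<^sup>2"
proof -
  have b: "(\<Sum>i\<in>I. a i \<omega>)\<^sup>2 \<le> (\<Sum>i\<in>I. \<sigma> i) * (\<Sum>i\<in>I. (a i \<omega>)\<^sup>2 / \<sigma> i)" for \<omega>
    by (rule weighted_square_sum[OF I \<sigma>])
  have i: "integrable M (\<lambda>\<omega>. (\<Sum>i\<in>I. \<sigma> i) * (\<Sum>i\<in>I. (a i \<omega>)\<^sup>2 / \<sigma> i))"
    using int by (intro integrable_mult_right Bochner_Integration.integrable_sum integrable_divide) auto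
  have m: "(\<lambda>\<omega>. \<Sum>i\<in>I. a i \<omega>) \<in> borel_measurable M"
    using meas by (intro borel_measurable_sum) auto
  show 1: "integrable M (\<lambda>\<omega>. (\<Sum>i\<in>I. a i \<omega>)\<^sup>2)"
    using m b by (intro Bochner_Integration.integrable_bound[OF i]) (auto intro!: AE_I2 order_trans[OF b])
  have "(\<integral>\<omega>. (\<Sum>i\<in>I. a i \<omega>)\<^sup>2 \<partial>M) \<le> (\<integral>\<omega>. (\<Sum>i\<in>I. \<sigma> i) * (\<Sum>i\<in>I. (a i \<omega>)\<^sup>2 / \<sigma> i) \<partial>M)"
    using b by (intro integral_mono[OF 1 i])
  also have "\<dots> = (\<Sum>i\<in>I. \<sigma> i) * (\<Sum>i\<in>I. (\<integral>\<omega>. (a i \<omega>)\<^sup>2 \<partial>M) / \<sigma> i)"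
    using int by simp
  also have "\<dots> \<le> (\<Sum>i\<in>I. \<sigma> i) * (\<Sum>i\<in>I. \<sigma> i)"
  proof (intro mult_left_mono sum_mono)
    fix i assume "i \<in> I"
    with le[of i] \<sigma>[of i] show "(\<integral>\<omega>. (a i \<omega>)\<^sup>2 \<partial>M) / \<sigma> i \<le> \<sigma> i"
      by (simp add: divide_le_eq power2_eq_square)
  qed (use \<sigma> in \<open>auto intro!: sum_nonneg intro: less_imp_le\<close>)
  finally show "(\<integral>\<omega>. (\<Sum>i\<in>I. a i \<omega>)\<^sup>2 \<partial>M) \<le> (\<Sum>i\<in>I. \<sigma> i)\<^sup>2"
    by (simp add: power2_eq_square)
qed

definition cell_index :: "real \<Rightarrow> real ^ 'd \<Rightarrow> 'd \<Rightarrow> int" where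
  "cell_index s x = (\<lambda>k. \<lfloor>x $ k / s\<rfloor>)"

definition indices :: "nat \<Rightarrow> ('d \<Rightarrow> int) set" where
  "indices m = {v. \<forall>k. v k \<in> {- int m..int m}}"

definition cell :: "(real ^ 'd) set \<Rightarrow> real \<Rightarrow> ('d \<Rightarrow> int) \<Rightarrow> (real ^ 'd) set" where
  "cell S s v = {x \<in> S. cell_index s x = v}"

text \<open>The total deviation of the empirical frequencies of the parts in \<open>S\<close> of the cells with side \<open>s\<close>. Up to a
factor it bounds the deviation of every function that is constant on these cells.\<close>

definition discrepancy :: "(real ^ 'd) set \<Rightarrow> real \<Rightarrow> nat \<Rightarrow> 'w \<Rightarrow> real" where
  "discrepancy S s m \<omega> = (\<Sum>v\<in>indices m. \<bar>dev (indicat_real (cell S s v)) \<omega>\<bar>)"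

lemma finite_indices: "finite (indices m)" and card_indices: "card (indices m) = (2 * m + 1) ^ CARD('d)"
proof -
  have eq: "indices m = PiE UNIV (\<lambda>_::'d. {- int m..int m})"
    by (auto simp: indices_def PiE_def Pi_def)
  show "finite (indices m)" unfolding eq by (intro finite_PiE) auto
  have "nat (int m + 1 + int m) = 2 * m + 1" by simp
  then show "card (indices m) = (2 * m + 1) ^ CARD('d)" unfolding eq by (subst card_PiE) auto
qed

lemma cell_measurable [measurable]:
  assumes [measurable]: "S \<in> sets borel"
  shows "cell S s v \<in> sets borel"
proof -
  have "cell S s v = S \<inter> (\<Inter>k. {x \<in> space borel. \<lfloor>x $ k / s\<rfloor> = v k})"
    by (auto simp: cell_def cell_index_def)
  also have "\<dots> \<in> sets borel"
    by (intro sets.Int sets.finite_INT) measurable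
  finally show ?thesis .
qed

lemma cell_index_in_indices:
  assumes "s > 0" "norm x \<le> real m * s"
  shows "cell_index s x \<in> indices m"
proof -
  have "- int m \<le> \<lfloor>x $ k / s\<rfloor> \<and> \<lfloor>x $ k / s\<rfloor> \<le> int m" for k
  proof -
    have "\<bar>x $ k\<bar> \<le> real m * s" using component_le_norm_cart[of x k] assms(2) by linarith
    then have "- real m \<le> x $ k / s" "x $ k / s \<le> real m"
      using assms(1) by (auto simp: field_simps)
    then show ?thesis by (simp add: le_floor_iff floor_le_iff)
  qed
  then show ?thesis by (auto simp: indices_def cell_index_def)
qed

lemma discrepancy_measurable [measurable]:
  "S \<in> sets borel \<Longrightarrow> discrepancy S s m \<in> borel_measurable M"
  unfolding discrepancy_def[abs_def]
  by (intro borel_measurable_sum borel_measurable_abs dev_measurable borel_measurable_indicator cell_measurable)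

lemma indicator_square: "(indicat_real A x)\<^sup>2 = indicat_real A x"
  by (auto simp: indicator_def)

text \<open>By the Cauchy-Schwarz inequality, the expected square is at most the number of cells times the sum of the
variances of the frequencies, and the latter are at most the masses of the cells divided by \<open>n\<close>.\<close>

lemma discrepancy_square:
  assumes S[measurable]: "S \<in> sets borel"
  shows "integrable M (\<lambda>\<omega>. (discrepancy S s m \<omega>)\<^sup>2)"
    and "(\<integral>\<omega>. (discrepancy S s m \<omega>)\<^sup>2 \<partial>M) \<le> real ((2 * m + 1) ^ CARD('d)) * measure \<mu> S / real n"
proof -
  let ?N = "real (card (indices m))"
  let ?d = "\<lambda>v \<omega>. dev (indicat_real (cell S s v)) \<omega>"
  have b: "(discrepancy S s m \<omega>)\<^sup>2 \<le> ?N * (\<Sum>v\<in>indices m. (?d v \<omega>)\<^sup>2)" for \<omega>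
  proof -
    have "(discrepancy S s m \<omega>)\<^sup>2 \<le> (\<Sum>v\<in>indices m. 1\<^sup>2) * (\<Sum>v\<in>indices m. \<bar>?d v \<omega>\<bar>\<^sup>2)"
      using Cauchy_Schwarz_ineq_sum[of "\<lambda>_. 1" "\<lambda>v. \<bar>?d v \<omega>\<bar>" "indices m"]
      by (simp add: discrepancy_def)
    then show ?thesis by simp
  qed
  have int: "integrable \<mu> (\<lambda>x. (indicat_real (cell S s v) x)\<^sup>2)" for v
    by (simp add: indicator_square mu.emeasure_finite less_top[symmetric])
  have sq: "integrable M (\<lambda>\<omega>. (?d v \<omega>)\<^sup>2)" "(\<integral>\<omega>. (?d v \<omega>)\<^sup>2 \<partial>M) \<le> measure \<mu> (cell S s v) / real n" for v
    using dev_square[OF _ int[of v]] by (simp_all add: indicator_square)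
  have i: "integrable M (\<lambda>\<omega>. ?N * (\<Sum>v\<in>indices m. (?d v \<omega>)\<^sup>2))"
    using sq by (intro integrable_mult_right Bochner_Integration.integrable_sum) auto
  show 1: "integrable M (\<lambda>\<omega>. (discrepancy S s m \<omega>)\<^sup>2)"
    using b by (intro Bochner_Integration.integrable_bound[OF i]) (auto intro!: AE_I2 order_trans[OF b])
  have "(\<integral>\<omega>. (discrepancy S s m \<omega>)\<^sup>2 \<partial>M) \<le> (\<integral>\<omega>. ?N * (\<Sum>v\<in>indices m. (?d v \<omega>)\<^sup>2) \<partial>M)"
    using b by (intro integral_mono[OF 1 i])
  also have "\<dots> = ?N * (\<Sum>v\<in>indices m. \<integral>\<omega>. (?d v \<omega>)\<^sup>2 \<partial>M)"
    using sq by simp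
  also have "\<dots> \<le> ?N * (\<Sum>v\<in>indices m. measure \<mu> (cell S s v) / real n)"
    using sq by (intro mult_left_mono sum_mono) auto
  also have "\<dots> = ?N * (measure \<mu> (\<Union>v\<in>indices m. cell S s v) / real n)"
  proof -
    have "cell S s ` indices m \<subseteq> sets \<mu>" using cell_measurable[OF S] by auto
    moreover have "disjoint_family_on (cell S s) (indices m)" by (auto simp: disjoint_family_on_def cell_def)
    ultimately show ?thesis by (simp add: mu.finite_measure_finite_Union[OF finite_indices] sum_divide_distrib)
  qed
  also have "\<dots> \<le> ?N * (measure \<mu> S / real n)"
    by (intro mult_left_mono divide_right_mono mu.finite_measure_mono) (auto simp: cell_def)
  finally show "(\<integral>\<omega>. (discrepancy S s m \<omega>)\<^sup>2 \<partial>M) \<le> real ((2 * m + 1) ^ CARD('d)) * measure \<mu> S / real n"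
    by (simp add: card_indices)
qed

lemma dev_le_discrepancy:
  fixes G :: "('d \<Rightarrow> int) \<Rightarrow> real"
  assumes S[measurable]: "S \<in> sets borel" and s: "s > 0" and Sm: "\<And>x. x \<in> S \<Longrightarrow> norm x \<le> real m * s"
    and G: "\<And>x. x \<in> S \<Longrightarrow> \<bar>G (cell_index s x)\<bar> \<le> K" and K: "0 \<le> K"
  shows "\<bar>dev (\<lambda>x. indicat_real S x * G (cell_index s x)) \<omega>\<bar> \<le> K * discrepancy S s m \<omega>"
    and "integrable \<mu> (\<lambda>x. indicat_real S x * G (cell_index s x))"
proof -
  have eq: "indicat_real S x * G (cell_index s x) = (\<Sum>v\<in>indices m. G v * indicat_real (cell S s v) x)" for x
  proof (cases "x \<in> S")
    case True
    then have "cell_index s x \<in> indices m" using cell_index_in_indices[OF s Sm] by simp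
    then have "(\<Sum>v\<in>indices m. G v * indicat_real (cell S s v) x) = (\<Sum>v\<in>indices m. if v = cell_index s x then G v else 0)"
      using True by (intro sum.cong) (auto simp: cell_def)
    then show ?thesis using True \<open>cell_index s x \<in> indices m\<close> finite_indices by simp
  qed (auto simp: cell_def)
  have int: "integrable \<mu> (\<lambda>x. G v * indicat_real (cell S s v) x)" for v
    by (intro integrable_mult_right) (simp add: mu.emeasure_finite less_top[symmetric])
  show "integrable \<mu> (\<lambda>x. indicat_real S x * G (cell_index s x))"
    unfolding eq using int by simp
  have "dev (\<lambda>x. indicat_real S x * G (cell_index s x)) \<omega>
      = (\<Sum>v\<in>indices m. G v * dev (indicat_real (cell S s v)) \<omega>)"
    unfolding eq using int by (simp add: dev_sum dev_cmult)
  also have "\<bar>\<dots>\<bar> \<le> (\<Sum>v\<in>indices m. \<bar>G v * dev (indicat_real (cell S s v)) \<omega>\<bar>)"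
    by (rule sum_abs)
  also have "\<dots> \<le> (\<Sum>v\<in>indices m. K * \<bar>dev (indicat_real (cell S s v)) \<omega>\<bar>)"
  proof (intro sum_mono)
    fix v
    show "\<bar>G v * dev (indicat_real (cell S s v)) \<omega>\<bar> \<le> K * \<bar>dev (indicat_real (cell S s v)) \<omega>\<bar>"
    proof (cases "cell S s v = {}")
      case True
      then have "indicat_real (cell S s v) = (\<lambda>x. 0)" by auto
      then show ?thesis by simp
    next
      case False
      then obtain x where "x \<in> S" "cell_index s x = v" by (auto simp: cell_def)
      then have "\<bar>G v\<bar> \<le> K" using G by auto
      then show ?thesis by (simp add: abs_mult mult_right_mono)
    qed
  qed
  finally show "\<bar>dev (\<lambda>x. indicat_real S x * G (cell_index s x)) \<omega>\<bar> \<le> K * discrepancy S s m \<omega>"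
    by (simp add: discrepancy_def sum_distrib_left)
qed


definition grid_point :: "real \<Rightarrow> ('d \<Rightarrow> int) \<Rightarrow> real ^ 'd" where
  "grid_point s v = (\<chi> k. s * of_int (v k))"

lemma norm_grid_point_diff:
  assumes "s > 0"
  shows "norm (grid_point s (cell_index s x) - x) \<le> real CARD('d) * s"
proof -
  have "\<bar>(grid_point s (cell_index s x) - x) $ k\<bar> \<le> s" for k
  proof -
    have "x $ k = s * (x $ k / s)" using assms by simp
    then have "(grid_point s (cell_index s x) - x) $ k = - (s * (x $ k / s - of_int \<lfloor>x $ k / s\<rfloor>))"
      by (simp add: grid_point_def cell_index_def right_diff_distrib)
    moreover have "0 \<le> x $ k / s - of_int \<lfloor>x $ k / s\<rfloor>" "x $ k / s - of_int \<lfloor>x $ k / s\<rfloor> \<le> 1" by linarith+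
    ultimately show ?thesis using assms by (simp add: abs_mult mult_left_le)
  qed
  then have "(\<Sum>k\<in>UNIV. \<bar>(grid_point s (cell_index s x) - x) $ k\<bar>) \<le> (\<Sum>k\<in>(UNIV::'d set). s)"
    by (rule sum_mono)
  then show ?thesis using norm_le_l1_cart[of "grid_point s (cell_index s x) - x"] by simp
qed

lemma cell_index_coarser: "cell_index (2 * s) x k = cell_index s x k div 2"
  using floor_divide_real_eq_div[of 2 "x $ k / s"] by (simp add: cell_index_def mult.commute)

text \<open>The shell \<open>j\<close> will be refined \<open>q - j\<close> times. As the radii grow by the factor 4, every shell then
has exactly one level less than the previous one, and the side \<open>8\<^sup>j r / 2\<^sup>q\<close> of its finest cells still
grows more slowly than its mass decays.\<close>

fun shell :: "real \<Rightarrow> nat \<Rightarrow> (real ^ 'd) set" where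
  "shell r 0 = {x. norm x \<le> r}"
| "shell r (Suc j) = {x. 4 ^ j * r < norm x \<and> norm x \<le> 4 ^ Suc j * r}"

lemma shell_measurable [measurable]: "shell r j \<in> sets borel"
  by (cases j) auto

lemma shell_le: "x \<in> shell r j \<Longrightarrow> norm x \<le> 4 ^ j * r"
  by (cases j) auto

lemma shell_partition:
  assumes "r > 0"
  shows "(\<Sum>j\<le>q. indicat_real (shell r j) x) = (if norm x \<le> 4 ^ q * r then 1 else 0)"
proof (induction q)
  case (Suc q)
  have "norm x \<le> 4 ^ q * r \<Longrightarrow> norm x \<le> 4 ^ Suc q * r"
    using assms by (rule_tac order_trans[of _ "4 ^ q * r"]) auto
  then show ?case by (subst sum.atMost_Suc, subst Suc) (auto simp: indicator_def simp del: power_Suc)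
qed (simp add: indicator_def)

lemma measure_shell_le:
  assumes r: "r > 0" and M2: "(\<integral>x. (norm x)\<^sup>2 \<partial>\<mu>) \<le> r\<^sup>2"
  shows "measure \<mu> (shell r j) \<le> 16 / 16 ^ j"
proof (cases j)
  case 0
  then show ?thesis using order_trans[OF mu.prob_le_1[of "shell r j"], of 16] by simp
next
  case (Suc i)
  have pos: "(4 ^ i * r)\<^sup>2 > 0" using r by simp
  have "measure \<mu> (shell r j) \<le> measure \<mu> {x \<in> space \<mu>. (norm x)\<^sup>2 \<ge> (4 ^ i * r)\<^sup>2}"
    using r by (intro mu.finite_measure_mono) (auto simp: Suc intro!: power_mono)
  also have "\<dots> \<le> (\<integral>x. (norm x)\<^sup>2 \<partial>\<mu>) / (4 ^ i * r)\<^sup>2"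
    by (rule integral_Markov_inequality_measure[OF int2 _ _ pos, of "{}"]) auto
  also have "\<dots> \<le> r\<^sup>2 / (4 ^ i * r)\<^sup>2"
    using M2 by (intro divide_right_mono) auto
  also have "(4 ^ i * r)\<^sup>2 = 16 ^ i * r\<^sup>2" by (simp add: power_mult_distrib power2_eq_square flip: power_mult_distrib)
  finally show ?thesis using r Suc by simp
qed

definition side :: "real \<Rightarrow> nat \<Rightarrow> nat \<Rightarrow> real" where
  "side r j l = 4 ^ j * r / 2 ^ l"

text \<open>The telescoping steps along the corners of the nested cells. The corner of the coarser cell is a
function of the index of the finer cell, so the increment is constant on the finer cells.\<close>

fun increment :: "(real ^ 'd \<Rightarrow> real) \<Rightarrow> real \<Rightarrow> nat \<Rightarrow> nat \<Rightarrow> ('d \<Rightarrow> int) \<Rightarrow> real" where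
  "increment f r j 0 v = f (grid_point (side r j 0) v) - f 0"
| "increment f r j (Suc l) v =
    f (grid_point (side r j (Suc l)) v) - f (grid_point (side r j l) (\<lambda>k. v k div 2))"

lemma sum_increment:
  "(\<Sum>l\<le>m. increment f r j l (cell_index (side r j l) x))
    = f (grid_point (side r j m) (cell_index (side r j m) x)) - f 0"
proof (induction m)
  case (Suc m)
  have "side r j m = 2 * side r j (Suc m)" by (simp add: side_def)
  then have "(\<lambda>k. cell_index (side r j (Suc m)) x k div 2) = cell_index (side r j m) x"
    by (simp add: cell_index_coarser fun_eq_iff)
  then show ?case using Suc by simp
qed simp

lemma increment_le:
  assumes r: "r > 0" and x: "x \<in> shell r j" and lip: "\<And>x y. \<bar>f x - f y\<bar> \<le> norm (x - y)"
  shows "\<bar>increment f r j l (cell_index (side r j l) x)\<bar> \<le> 3 * real CARD('d) * side r j l"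
proof (cases l)
  case 0
  let ?g = "grid_point (side r j 0) (cell_index (side r j 0) x)"
  have "\<bar>f ?g - f 0\<bar> \<le> norm (?g - x + x)" using lip[of ?g 0] by simp
  also have "\<dots> \<le> norm (?g - x) + norm x" by (rule norm_triangle_ineq)
  also have "\<dots> \<le> real CARD('d) * side r j 0 + side r j 0"
    using r shell_le[OF x] norm_grid_point_diff[of "side r j 0" x]
    by (intro add_mono) (auto simp: side_def)
  also have "\<dots> \<le> 3 * real CARD('d) * side r j 0"
  proof -
    have "(1::real) \<le> real CARD('d)" by (simp add: Suc_leI)
    then have "1 * side r j 0 \<le> real CARD('d) * side r j 0" using r by (intro mult_right_mono) (auto simp: side_def)
    moreover have "0 \<le> real CARD('d) * side r j 0" using r by (simp add: side_def)
    ultimately show ?thesis by simp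
  qed
  finally show ?thesis using 0 by simp
next
  case (Suc m)
  have eq: "side r j m = 2 * side r j (Suc m)" by (simp add: side_def)
  then have c: "(\<lambda>k. cell_index (side r j (Suc m)) x k div 2) = cell_index (side r j m) x"
    by (simp add: cell_index_coarser fun_eq_iff)
  let ?g = "grid_point (side r j (Suc m)) (cell_index (side r j (Suc m)) x)"
  let ?h = "grid_point (side r j m) (cell_index (side r j m) x)"
  have "\<bar>f ?g - f ?h\<bar> \<le> norm ((?g - x) - (?h - x))" using lip[of ?g ?h] by simp
  also have "\<dots> \<le> norm (?g - x) + norm (?h - x)" by (rule norm_triangle_ineq4)
  also have "\<dots> \<le> real CARD('d) * side r j (Suc m) + real CARD('d) * side r j m"
    using r by (intro add_mono norm_grid_point_diff) (auto simp: side_def)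
  finally show ?thesis using Suc c eq by simp
qed

text \<open>What is left of a Lipschitz function after the telescoping: on the shell \<open>j \<le> q\<close> the diameter of the
cells of the last level \<open>q - j\<close>, and beyond the last shell the norm itself.\<close>

definition residual :: "real \<Rightarrow> nat \<Rightarrow> real ^ 'd \<Rightarrow> real" where
  "residual r q x = (\<Sum>j\<le>q. indicat_real (shell r j) x * (real CARD('d) * side r j (q - j)))
     + indicat_real {x. norm x > 4 ^ q * r} x * norm x"

lemma residual_measurable [measurable]: "residual r q \<in> borel_measurable borel"
proof -
  have [measurable]: "{x :: real ^ 'd. norm x > 4 ^ q * r} \<in> sets borel" by measurable
  show ?thesis unfolding residual_def[abs_def] by measurable
qed

text \<open>This bound for the deviations of all Lipschitz functions is a finite sum of measurable functions, unlike
the supremum of the deviations themselves.\<close>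

definition lip_dev_bound :: "real \<Rightarrow> nat \<Rightarrow> 'w \<Rightarrow> real" where
  "lip_dev_bound r q \<omega> =
    (\<Sum>(j, l)\<in>(SIGMA j:{..q}. {..q - j}). 3 * real CARD('d) * side r j l * discrepancy (shell r j) (side r j l) (2 ^ l) \<omega>)
     + ((\<Sum>i=1..n. residual r q (Y i \<omega>)) / real n + (\<integral>x. residual r q x \<partial>\<mu>))"

lemma residual_nonneg: "r > 0 \<Longrightarrow> 0 \<le> residual r q x"
  unfolding residual_def by (intro add_nonneg_nonneg sum_nonneg mult_nonneg_nonneg) (auto simp: side_def)

lemma residual_le:
  assumes r: "r > 0"
  shows "residual r q x \<le> real CARD('d) * (4 * norm x + r)"
proof -
  have d: "(1::real) \<le> real CARD('d)" by (simp add: Suc_leI)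
  have s: "indicat_real (shell r j) x * (real CARD('d) * side r j (q - j))
     \<le> indicat_real (shell r j) x * (real CARD('d) * (4 * norm x + r))" for j
  proof (cases "x \<in> shell r j")
    case True
    have "side r j (q - j) \<le> 4 ^ j * r"
      using r mult_left_mono[of 1 "2 ^ (q - j)" "4 ^ j * r"] by (simp add: side_def divide_le_eq)
    also have "\<dots> \<le> 4 * norm x + r" using True r by (cases j) auto
    finally show ?thesis using True by simp
  qed simp
  have "residual r q x \<le> (\<Sum>j\<le>q. indicat_real (shell r j) x) * (real CARD('d) * (4 * norm x + r))
     + indicat_real {x. norm x > 4 ^ q * r} x * (real CARD('d) * (4 * norm x + r))"
    unfolding residual_def sum_distrib_right
  proof (intro add_mono sum_mono s mult_left_mono)
    have "1 * norm x \<le> real CARD('d) * (4 * norm x + r)"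
      using d r by (intro mult_mono) auto
    then show "norm x \<le> real CARD('d) * (4 * norm x + r)" by simp
  qed auto
  also have "\<dots> = real CARD('d) * (4 * norm x + r)"
    unfolding shell_partition[OF r] by (auto simp: indicator_def)
  finally show ?thesis .
qed

lemma norm_integrable: "integrable \<mu> norm"
  by (rule mu.square_integrable_imp_integrable[OF _ int2]) simp

lemma lipschitz_measurable:
  assumes lip: "\<And>x y. \<bar>f x - f y\<bar> \<le> norm (x - y)"
  shows "(f :: real ^ 'd \<Rightarrow> real) \<in> borel_measurable borel"
proof -
  have "continuous_on UNIV f"
    using lip by (intro lipschitz_on_continuous_on[of 1]) (auto simp: lipschitz_on_def dist_norm)
  then show ?thesis by (rule borel_measurable_continuous_onI)
qed

lemma lipschitz_integrable:
  assumes lip: "\<And>x y. \<bar>f x - f y\<bar> \<le> norm (x - y)"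
  shows "integrable \<mu> f"
proof (rule Bochner_Integration.integrable_bound)
  show "integrable \<mu> (\<lambda>x. \<bar>f 0\<bar> + norm x)" using norm_integrable by simp
  show "f \<in> borel_measurable \<mu>" using lipschitz_measurable[OF lip] by simp
  have "norm (f x) \<le> norm (\<bar>f 0\<bar> + norm x)" for x using lip[of x 0] by simp
  then show "AE x in \<mu>. norm (f x) \<le> norm (\<bar>f 0\<bar> + norm x)" by simp
qed

text \<open>A Lipschitz function is the sum of a constant, of its increments on the shells and levels, and of a
remainder below \<open>residual\<close>. The increments are controlled by the discrepancies, the remainder by its
integrals against both measures.\<close>

lemma dev_le_lip_dev_bound:
  assumes r: "r > 0" and lip: "\<And>x y. \<bar>f x - f y\<bar> \<le> norm (x - y)"
  shows "\<bar>dev f \<omega>\<bar> \<le> lip_dev_bound r q \<omega>"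
proof -
  let ?I = "SIGMA j:{..q}. {..q - j}"
  let ?inc = "\<lambda>j l x. indicat_real (shell r j) x * increment f r j l (cell_index (side r j l) x)"
  define S where "S x = (\<Sum>(j, l)\<in>?I. ?inc j l x)" for x
  define g where "g x = f x - f 0 - S x" for x
  have side_pos: "side r j l > 0" for j l using r by (simp add: side_def)
  have shell_side: "norm x \<le> real (2 ^ l) * side r j l" if "x \<in> shell r j" for x j l
    using shell_le[OF that] by (simp add: side_def)
  have inc: "\<bar>dev (?inc j l) \<omega>\<bar> \<le> 3 * real CARD('d) * side r j l * discrepancy (shell r j) (side r j l) (2 ^ l) \<omega>"
    "integrable \<mu> (?inc j l)" for j l
  proof -
    note D = dev_le_discrepancy[where S = "shell r j" and s = "side r j l" and m = "2 ^ l"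
        and K = "3 * real CARD('d) * side r j l" and G = "increment f r j l",
        OF shell_measurable side_pos shell_side increment_le[OF r _ lip]]
    show "\<bar>dev (?inc j l) \<omega>\<bar> \<le> 3 * real CARD('d) * side r j l * discrepancy (shell r j) (side r j l) (2 ^ l) \<omega>"
      "integrable \<mu> (?inc j l)"
      using side_pos[of j l] by (auto intro!: D)
  qed
  have S_eq: "S x = (\<Sum>j\<le>q. indicat_real (shell r j) x * (f (grid_point (side r j (q - j)) (cell_index (side r j (q - j)) x)) - f 0))" for x
    unfolding S_def by (subst sum.Sigma[symmetric]) (auto simp: sum_distrib_left[symmetric] sum_increment)
  have g_le: "\<bar>g x\<bar> \<le> residual r q x" for x
  proof (cases "norm x \<le> 4 ^ q * r")
    case True
    let ?h = "\<lambda>j. grid_point (side r j (q - j)) (cell_index (side r j (q - j)) x)"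
    have "f x - f 0 = (\<Sum>j\<le>q. indicat_real (shell r j) x * (f x - f 0))"
      using True shell_partition[OF r, where q = q and x = x] by (simp flip: sum_distrib_right)
    then have "g x = (\<Sum>j\<le>q. indicat_real (shell r j) x * (f x - f (?h j)))"
      unfolding g_def S_eq by (simp add: sum_subtractf[symmetric] right_diff_distrib)
    then have "\<bar>g x\<bar> \<le> (\<Sum>j\<le>q. \<bar>indicat_real (shell r j) x * (f x - f (?h j))\<bar>)" by (simp only: sum_abs)
    also have "\<dots> \<le> (\<Sum>j\<le>q. indicat_real (shell r j) x * (real CARD('d) * side r j (q - j)))"
    proof (intro sum_mono)
      fix j
      have "\<bar>f x - f (?h j)\<bar> \<le> real CARD('d) * side r j (q - j)"
        using lip[of x "?h j"] norm_grid_point_diff[OF side_pos[of j "q - j"], of x] by (simp add: norm_minus_commute)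
      then show "\<bar>indicat_real (shell r j) x * (f x - f (?h j))\<bar>
          \<le> indicat_real (shell r j) x * (real CARD('d) * side r j (q - j))"
        by (simp add: abs_mult mult_left_mono)
    qed
    finally show ?thesis using True by (simp add: residual_def)
  next
    case False
    have z: "indicat_real (shell r j) x = 0" if "j \<le> q" for j
    proof -
      have "(4::real) ^ j * r \<le> 4 ^ q * r" using that r by (simp add: power_increasing)
      then show ?thesis using shell_le[of x r j] False by (auto simp: indicator_def)
    qed
    then have "S x = 0" "residual r q x = norm x"
      unfolding S_eq residual_def using False by (auto intro!: sum.neutral)
    then show ?thesis using lip[of x 0] by (simp add: g_def)
  qed
  have Si: "integrable \<mu> S"
    unfolding S_def[abs_def] using inc(2) by (intro Bochner_Integration.integrable_sum) auto
  have fi: "integrable \<mu> f" by (rule lipschitz_integrable[OF lip])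
  have gi: "integrable \<mu> g" unfolding g_def[abs_def] using Si fi by simp
  have ri: "integrable \<mu> (residual r q)"
  proof (rule Bochner_Integration.integrable_bound)
    show "integrable \<mu> (\<lambda>x. real CARD('d) * (4 * norm x + r))" using norm_integrable by simp
    show "AE x in \<mu>. norm (residual r q x) \<le> norm (real CARD('d) * (4 * norm x + r))"
      using residual_le[OF r] residual_nonneg[OF r] by (auto intro!: AE_I2 order_trans[OF residual_le[OF r]])
  qed simp
  have "dev f \<omega> = dev (\<lambda>x. f 0 + (S x + g x)) \<omega>" by (simp add: g_def)
  also have "\<dots> = dev S \<omega> + dev g \<omega>"
    using Si gi by (subst dev_add dev_const)+ (auto simp: dev_add)
  also have "dev S \<omega> = (\<Sum>(j, l)\<in>?I. dev (?inc j l) \<omega>)"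
    unfolding S_def[abs_def] using inc(2) by (subst dev_sum) (auto simp: split_def)
  finally have "\<bar>dev f \<omega>\<bar> \<le> (\<Sum>(j, l)\<in>?I. \<bar>dev (?inc j l) \<omega>\<bar>) + \<bar>dev g \<omega>\<bar>"
    using sum_abs[of "\<lambda>(j, l). dev (?inc j l) \<omega>" ?I]
      abs_triangle_ineq[of "\<Sum>(j, l)\<in>?I. dev (?inc j l) \<omega>" "dev g \<omega>"]
    unfolding split_def by linarith
  also have "\<dots> \<le> (\<Sum>(j, l)\<in>?I. 3 * real CARD('d) * side r j l * discrepancy (shell r j) (side r j l) (2 ^ l) \<omega>)
     + ((\<Sum>i=1..n. residual r q (Y i \<omega>)) / real n + (\<integral>x. residual r q x \<partial>\<mu>))"
  proof (intro add_mono)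
    show "(\<Sum>(j, l)\<in>?I. \<bar>dev (?inc j l) \<omega>\<bar>)
      \<le> (\<Sum>(j, l)\<in>?I. 3 * real CARD('d) * side r j l * discrepancy (shell r j) (side r j l) (2 ^ l) \<omega>)"
      using inc(1) by (intro sum_mono) (auto simp: split_def)
    have "\<bar>\<Sum>i=1..n. g (Y i \<omega>)\<bar> \<le> (\<Sum>i=1..n. residual r q (Y i \<omega>))"
      using g_le by (intro order_trans[OF sum_abs] sum_mono) auto
    then have 1: "\<bar>(\<Sum>i=1..n. g (Y i \<omega>)) / real n\<bar> \<le> (\<Sum>i=1..n. residual r q (Y i \<omega>)) / real n"
      by (simp add: divide_right_mono)
    have 2: "\<bar>\<integral>x. g x \<partial>\<mu>\<bar> \<le> (\<integral>x. residual r q x \<partial>\<mu>)"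
    proof -
      have "\<bar>\<integral>x. g x \<partial>\<mu>\<bar> \<le> (\<integral>x. \<bar>g x\<bar> \<partial>\<mu>)" by (rule integral_abs_bound)
      also have "\<dots> \<le> (\<integral>x. residual r q x \<partial>\<mu>)" using gi ri g_le by (intro integral_mono) auto
      finally show ?thesis .
    qed
    show "\<bar>dev g \<omega>\<bar> \<le> (\<Sum>i=1..n. residual r q (Y i \<omega>)) / real n + (\<integral>x. residual r q x \<partial>\<mu>)"
      unfolding dev_def using 1 2 by linarith
  qed
  finally show ?thesis by (simp add: lip_dev_bound_def)
qed


text \<open>By Chebyshev's inequality the shell \<open>j\<close> has mass at most \<open>16 / 16\<^sup>j\<close>, while the cells of its last level
have side \<open>8\<^sup>j r / 2\<^sup>q\<close>: the products are summable in \<open>j\<close> and of order \<open>r / 2\<^sup>q\<close>.\<close>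

lemma residual_mean_le:
  assumes r: "r > 0" and M2: "(\<integral>x. (norm x)\<^sup>2 \<partial>\<mu>) \<le> r\<^sup>2"
  shows "(\<integral>x. residual r q x \<partial>\<mu>) \<le> 33 * real CARD('d) * r / 2 ^ q"
proof -
  let ?T = "{x :: real ^ 'd. norm x > 4 ^ q * r}"
  have T[measurable]: "?T \<in> sets borel" by measurable
  have ind: "integrable \<mu> (indicat_real (shell r j))" for j
    by (simp add: mu.emeasure_finite less_top[symmetric])
  have tail_int: "integrable \<mu> (\<lambda>x. indicat_real ?T x * norm x)"
  proof (rule Bochner_Integration.integrable_bound[OF norm_integrable])
    show "AE x in \<mu>. norm (indicat_real ?T x * norm x) \<le> norm (norm x)" by (auto simp: indicator_def)
  qed simp
  have "(\<integral>x. residual r q x \<partial>\<mu>) = (\<Sum>j\<le>q. measure \<mu> (shell r j) * (real CARD('d) * side r j (q - j)))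
      + (\<integral>x. indicat_real ?T x * norm x \<partial>\<mu>)"
  proof -
    have i: "integrable \<mu> (\<lambda>x. indicat_real (shell r j) x * (real CARD('d) * side r j (q - j)))" for j
      using ind by (rule integrable_mult_left)
    have "(\<integral>x. residual r q x \<partial>\<mu>) = (\<Sum>j\<le>q. \<integral>x. indicat_real (shell r j) x * (real CARD('d) * side r j (q - j)) \<partial>\<mu>)
        + (\<integral>x. indicat_real ?T x * norm x \<partial>\<mu>)"
      unfolding residual_def
      by (subst Bochner_Integration.integral_add Bochner_Integration.integral_sum,
          intro Bochner_Integration.integrable_sum i, rule tail_int,
          subst Bochner_Integration.integral_sum, rule i, rule refl)
    then show ?thesis by simp
  qed
  also have "(\<integral>x. indicat_real ?T x * norm x \<partial>\<mu>) \<le> (\<integral>x. (norm x)\<^sup>2 / (4 ^ q * r) \<partial>\<mu>)"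
  proof (rule integral_mono[OF tail_int])
    show "integrable \<mu> (\<lambda>x. (norm x)\<^sup>2 / (4 ^ q * r))" using int2 by simp
    fix x :: "real ^ 'd"
    show "indicat_real ?T x * norm x \<le> (norm x)\<^sup>2 / (4 ^ q * r)"
      using r by (auto simp: indicator_def power2_eq_square le_divide_eq intro!: mult_left_mono)
  qed
  also have "\<dots> \<le> r\<^sup>2 / (4 ^ q * r)" using M2 r by (simp add: divide_right_mono)
  also have "\<dots> \<le> real CARD('d) * r / 2 ^ q"
  proof -
    have d: "(1::real) \<le> real CARD('d)" by (simp add: Suc_leI)
    have "r\<^sup>2 / (4 ^ q * r) = r / 4 ^ q" using r by (simp add: power2_eq_square)
    also have "\<dots> \<le> r / 2 ^ q" using r by (intro divide_left_mono power_mono) auto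
    also have "\<dots> \<le> real CARD('d) * r / 2 ^ q"
      using d r by (intro divide_right_mono) auto
    finally show ?thesis .
  qed
  also have "(\<Sum>j\<le>q. measure \<mu> (shell r j) * (real CARD('d) * side r j (q - j)))
     \<le> (\<Sum>j\<le>q. (16 * real CARD('d) * r / 2 ^ q) * (1 / 2) ^ j)"
  proof (intro sum_mono)
    fix j assume "j \<in> {..q}"
    then have q: "(2::real) ^ q = 2 ^ j * 2 ^ (q - j)" by (simp flip: power_add)
    have "measure \<mu> (shell r j) * (real CARD('d) * side r j (q - j)) \<le> 16 / 16 ^ j * (real CARD('d) * side r j (q - j))"
      using measure_shell_le[OF r M2] r by (intro mult_right_mono) (auto simp: side_def)
    also have "\<dots> = (16 * real CARD('d) * r / 2 ^ q) * (1 / 2) ^ j"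
    proof -
      have "(16::real) ^ j = 4 ^ j * 2 ^ j * 2 ^ j" by (simp flip: power_mult_distrib)
      then show ?thesis unfolding q side_def by (simp add: power_divide mult_ac)
    qed
    finally show "measure \<mu> (shell r j) * (real CARD('d) * side r j (q - j)) \<le> (16 * real CARD('d) * r / 2 ^ q) * (1 / 2) ^ j" .
  qed
  also have "\<dots> = (16 * real CARD('d) * r / 2 ^ q) * (\<Sum>j\<le>q. (1 / 2) ^ j)"
    by (simp add: sum_distrib_left)
  also have "\<dots> \<le> (16 * real CARD('d) * r / 2 ^ q) * 2"
    using r by (intro mult_left_mono, subst sum_gp0) (auto simp: field_simps)
  finally show ?thesis by (simp add: mult_ac)
qed

text \<open>The square of the residual is of order \<open>r\<^sup>2\<close> only, but for the variance of an empirical mean it is divided by \<open>n\<close>.\<close>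

lemma residual_square_mean_le:
  assumes r: "r > 0" and M2: "(\<integral>x. (norm x)\<^sup>2 \<partial>\<mu>) \<le> r\<^sup>2"
  shows "integrable \<mu> (\<lambda>x. (residual r q x)\<^sup>2)"
    and "(\<integral>x. (residual r q x)\<^sup>2 \<partial>\<mu>) \<le> 34 * (real CARD('d))\<^sup>2 * r\<^sup>2"
proof -
  let ?d = "real CARD('d)"
  have le: "(residual r q x)\<^sup>2 \<le> ?d\<^sup>2 * (32 * (norm x)\<^sup>2 + 2 * r\<^sup>2)" for x
  proof -
    have "(residual r q x)\<^sup>2 \<le> (?d * (4 * norm x + r))\<^sup>2"
      using residual_le[OF r] residual_nonneg[OF r] by (intro power_mono)
    also have "\<dots> = ?d\<^sup>2 * (4 * norm x + r)\<^sup>2" by (simp add: power_mult_distrib)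
    also have "\<dots> \<le> ?d\<^sup>2 * (32 * (norm x)\<^sup>2 + 2 * r\<^sup>2)"
    proof (intro mult_left_mono)
      have "0 \<le> (4 * norm x - r)\<^sup>2" by simp
      then show "(4 * norm x + r)\<^sup>2 \<le> 32 * (norm x)\<^sup>2 + 2 * r\<^sup>2"
        by (simp add: power2_eq_square algebra_simps)
    qed simp
    finally show ?thesis .
  qed
  have i: "integrable \<mu> (\<lambda>x. ?d\<^sup>2 * (32 * (norm x)\<^sup>2 + 2 * r\<^sup>2))" using int2 by simp
  show 1: "integrable \<mu> (\<lambda>x. (residual r q x)\<^sup>2)"
    using le by (intro Bochner_Integration.integrable_bound[OF i]) (auto intro!: AE_I2 order_trans[OF le])
  have "(\<integral>x. (residual r q x)\<^sup>2 \<partial>\<mu>) \<le> (\<integral>x. ?d\<^sup>2 * (32 * (norm x)\<^sup>2 + 2 * r\<^sup>2) \<partial>\<mu>)"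
    using le by (intro integral_mono[OF 1 i])
  also have "\<dots> = ?d\<^sup>2 * (32 * (\<integral>x. (norm x)\<^sup>2 \<partial>\<mu>) + 2 * r\<^sup>2)"
    using int2 by (simp add: mu.prob_space[simplified])
  also have "\<dots> \<le> ?d\<^sup>2 * (32 * r\<^sup>2 + 2 * r\<^sup>2)" using M2 by (intro mult_left_mono) auto
  finally show "(\<integral>x. (residual r q x)\<^sup>2 \<partial>\<mu>) \<le> 34 * ?d\<^sup>2 * r\<^sup>2" by simp
qed

lemma lip_dev_bound_measurable [measurable]: "lip_dev_bound r q \<in> borel_measurable M"
proof -
  have [measurable]: "(\<lambda>\<omega>. \<Sum>i=1..n. residual r q (Y i \<omega>)) \<in> borel_measurable M"
    by (intro borel_measurable_sum measurable_compose[OF Y_measurable residual_measurable])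
  show ?thesis unfolding lip_dev_bound_def[abs_def] by (simp add: split_def)
qed

lemma sum_double_geometric: "(\<Sum>(j, l)\<in>(SIGMA j:{..q}. {..q - j}). (1 / 2 :: real) ^ (q - l)) \<le> 4"
proof -
  have "(\<Sum>(j, l)\<in>(SIGMA j:{..q}. {..q - j}). (1 / 2 :: real) ^ (q - l)) = (\<Sum>j\<le>q. \<Sum>l\<le>q - j. (1 / 2) ^ (q - l))"
    by (subst sum.Sigma) auto
  also have "\<dots> \<le> (\<Sum>j\<le>q. 2 * (1 / 2) ^ j)"
  proof (intro sum_mono)
    fix j assume j: "j \<in> {..q}"
    have "(\<Sum>l\<le>q - j. (1 / 2 :: real) ^ (q - l)) = (\<Sum>l\<le>q - j. (1 / 2) ^ j * (1 / 2) ^ (q - j - l))"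
    proof (intro sum.cong refl)
      fix l assume "l \<in> {..q - j}"
      then have "q - l = j + (q - j - l)" using j by auto
      then show "(1 / 2 :: real) ^ (q - l) = (1 / 2) ^ j * (1 / 2) ^ (q - j - l)" by (metis power_add)
    qed
    also have "\<dots> = (1 / 2) ^ j * (\<Sum>l\<le>q - j. (1 / 2) ^ (q - j - l))" by (simp add: sum_distrib_left)
    also have "(\<Sum>l\<le>q - j. (1 / 2 :: real) ^ (q - j - l)) = (\<Sum>l\<le>q - j. (1 / 2) ^ l)"
      using sum.nat_diff_reindex[of "\<lambda>l. (1 / 2 :: real) ^ l" "Suc (q - j)"] by (simp add: lessThan_Suc_atMost)
    also have "\<dots> \<le> 2" by (subst sum_gp0) (simp add: field_simps)
    finally show "(\<Sum>l\<le>q - j. (1 / 2 :: real) ^ (q - l)) \<le> 2 * (1 / 2) ^ j" by (simp add: mult_ac)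
  qed
  also have "\<dots> = 2 * (\<Sum>j\<le>q. (1 / 2) ^ j)" by (simp add: sum_distrib_left)
  also have "\<dots> \<le> 4" by (subst sum_gp0) (simp add: field_simps)
  finally show ?thesis .
qed

text \<open>On the shell \<open>j\<close> and the level \<open>l\<close> there are of order \<open>2^(dl)\<close> cells with side \<open>4\<^sup>j r / 2\<^sup>l\<close> and total mass at
most \<open>16 / 16\<^sup>j\<close>. The powers of the shell radius cancel, and with \<open>n \<ge> 2^(Dq)\<close> the standard deviation of
the corresponding term is of order \<open>r 2^(-q) 2^(-(q - l))\<close>. This uses \<open>D \<ge> 4\<close>: the levels would not sum up
geometrically for \<open>D = 2\<close>, and the shells for a given level are only counted, \<open>q - l + 1\<close> in number.\<close>

lemma lip_dev_bound_square:
  fixes D :: nat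
  assumes r: "r > 0" and M2: "(\<integral>x. (norm x)\<^sup>2 \<partial>\<mu>) \<le> r\<^sup>2"
    and D: "D \<ge> 4" "D \<ge> CARD('d)" and q: "2 ^ (D * q) \<le> n"
  shows "integrable M (\<lambda>\<omega>. (lip_dev_bound r q \<omega>)\<^sup>2)"
    and "(\<integral>\<omega>. (lip_dev_bound r q \<omega>)\<^sup>2 \<partial>M) \<le> (22500 * (real CARD('d) * 3 ^ CARD('d))\<^sup>2) * r\<^sup>2 / 4 ^ q"
proof -
  let ?d = "real CARD('d)" and ?I = "SIGMA j:{..q}. {..q - j}"
  define a where "a = (\<lambda>(j, l) \<omega>. 3 * ?d * side r j l * discrepancy (shell r j) (side r j l) (2 ^ l) \<omega>)"
  \<comment> \<open>12 is the square root of 144: 9 from the factor 3 in \<open>increment_le\<close>, and 16 from the masses of the shells.\<close>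
  define c where "c = 12 * ?d * 3 ^ CARD('d) * r / 2 ^ q"
  define \<sigma> where "\<sigma> = (\<lambda>(j::nat, l). c * (1 / 2) ^ (q - l))"
  have d1: "1 \<le> ?d" by (simp add: Suc_leI)
  have c: "c > 0" using r by (simp add: c_def)
  have nq: "(2::real) ^ (D * q) \<le> real n" using q by (metis of_nat_le_iff of_nat_numeral of_nat_power)
  have a_sq: "integrable M (\<lambda>\<omega>. (a i \<omega>)\<^sup>2)" and a_le: "(\<integral>\<omega>. (a i \<omega>)\<^sup>2 \<partial>M) \<le> (\<sigma> i)\<^sup>2" if i: "i \<in> ?I" for i
  proof -
    obtain j l where jl: "i = (j, l)" "j \<le> q" "l \<le> q - j" using i by auto
    note disc = discrepancy_square[OF shell_measurable, of r j "side r j l" "2 ^ l"]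
    have eq: "(a i \<omega>)\<^sup>2 = (3 * ?d * side r j l)\<^sup>2 * (discrepancy (shell r j) (side r j l) (2 ^ l) \<omega>)\<^sup>2" for \<omega>
      by (simp add: a_def jl power_mult_distrib)
    show "integrable M (\<lambda>\<omega>. (a i \<omega>)\<^sup>2)" unfolding eq using disc(1) by simp
    have "(\<integral>\<omega>. (a i \<omega>)\<^sup>2 \<partial>M) = (3 * ?d * side r j l)\<^sup>2 * (\<integral>\<omega>. (discrepancy (shell r j) (side r j l) (2 ^ l) \<omega>)\<^sup>2 \<partial>M)"
      unfolding eq by simp
    also have "\<dots> \<le> (3 * ?d * side r j l)\<^sup>2 * ((3 ^ CARD('d) * 2 ^ (D * l)) * (16 / 16 ^ j) / real n)"
    proof (intro mult_left_mono order_trans[OF disc(2)] divide_right_mono mult_mono)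
      show "real ((2 * 2 ^ l + 1) ^ CARD('d)) \<le> 3 ^ CARD('d) * 2 ^ (D * l)"
      proof -
        have "real ((2 * 2 ^ l + 1) ^ CARD('d)) \<le> (3 * 2 ^ l) ^ CARD('d)"
          unfolding of_nat_power by (intro power_mono) auto
        also have "\<dots> = 3 ^ CARD('d) * 2 ^ (CARD('d) * l)" by (simp add: power_mult_distrib power_mult[symmetric] mult.commute)
        also have "\<dots> \<le> 3 ^ CARD('d) * 2 ^ (D * l)" using D by (intro mult_left_mono power_increasing) auto
        finally show ?thesis .
      qed
    qed (use measure_shell_le[OF r M2] in auto)
    also have "\<dots> \<le> (3 * ?d * side r j l)\<^sup>2 * ((3 ^ CARD('d) * 2 ^ (D * l)) * (16 / 16 ^ j) / 2 ^ (D * q))"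
      using nq n_pos by (intro mult_left_mono divide_left_mono) auto
    also have "\<dots> = 144 * ?d\<^sup>2 * 3 ^ CARD('d) * r\<^sup>2 * (2 ^ (D * l) / (4 ^ l * 2 ^ (D * q)))"
    proof -
      have "(16::real) ^ j = (4 ^ j)\<^sup>2" "(4::real) ^ l = (2 ^ l)\<^sup>2" by (simp_all add: power2_eq_square flip: power_mult_distrib)
      then show ?thesis by (simp add: side_def power_mult_distrib power_divide)
    qed
    also have "\<dots> \<le> 144 * ?d\<^sup>2 * (3 ^ CARD('d))\<^sup>2 * r\<^sup>2 * ((1 / 4) ^ (q - l) / 4 ^ q)"
    proof (intro mult_mono)
      have lq: "q = l + (q - l)" using jl by simp
      have "(2::real) ^ (D * q) = 2 ^ (D * l) * (2 ^ D) ^ (q - l)"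
        by (subst lq, simp only: distrib_left power_add power_mult)
      then have "(2::real) ^ (D * l) / (4 ^ l * 2 ^ (D * q)) = 1 / (4 ^ l * (2 ^ D) ^ (q - l))" by simp
      also have "\<dots> \<le> 1 / (4 ^ l * 16 ^ (q - l))"
      proof (intro divide_left_mono mult_left_mono power_mono)
        show "(16::real) \<le> 2 ^ D" using power_increasing[OF D(1), of "2::real"] by simp
      qed auto
      also have "\<dots> = (1 / 4) ^ (q - l) / 4 ^ q"
      proof -
        have "(4::real) ^ q = 4 ^ l * 4 ^ (q - l)" by (subst lq, simp only: power_add)
        moreover have "(16::real) ^ (q - l) = 4 ^ (q - l) * 4 ^ (q - l)" by (simp flip: power_mult_distrib)
        ultimately show ?thesis by (simp add: power_divide)
      qed
      finally show "(2::real) ^ (D * l) / (4 ^ l * 2 ^ (D * q)) \<le> (1 / 4) ^ (q - l) / 4 ^ q" .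
      show "(3::real) ^ CARD('d) \<le> (3 ^ CARD('d))\<^sup>2" by (simp add: power2_eq_square)
    qed auto
    also have "\<dots> = (\<sigma> i)\<^sup>2"
    proof -
      have "(1 / 4 :: real) ^ (q - l) = ((1 / 2) ^ (q - l))\<^sup>2" "(4::real) ^ q = (2 ^ q)\<^sup>2"
        by (simp_all add: power2_eq_square flip: power_mult_distrib)
      then show ?thesis by (simp add: \<sigma>_def jl c_def power_mult_distrib power_divide)
    qed
    finally show "(\<integral>\<omega>. (a i \<omega>)\<^sup>2 \<partial>M) \<le> (\<sigma> i)\<^sup>2" .
  qed
  have a_meas: "a i \<in> borel_measurable M" for i by (cases i) (simp add: a_def)
  have \<sigma>_pos: "\<sigma> i > 0" for i using c by (cases i) (simp add: \<sigma>_def)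
  have fin: "finite ?I" by auto
  note chain = expectation_square_sum[where a = a and \<sigma> = \<sigma> and I = ?I, OF fin \<sigma>_pos a_meas a_sq a_le]
  have "(\<Sum>i\<in>?I. \<sigma> i) = c * (\<Sum>(j, l)\<in>?I. (1 / 2) ^ (q - l))"
    by (simp add: \<sigma>_def sum_distrib_left split_def)
  also have "\<dots> \<le> c * 4" using c sum_double_geometric[of q] by (intro mult_left_mono) auto
  finally have \<sigma>_sum: "(\<Sum>i\<in>?I. \<sigma> i) \<le> 4 * c" by simp
  have \<sigma>_sum0: "0 \<le> (\<Sum>i\<in>?I. \<sigma> i)" using \<sigma>_pos by (intro sum_nonneg) (auto intro: less_imp_le)
  define m where "m = (\<integral>x. residual r q x \<partial>\<mu>)"
  define R where "R \<omega> = dev (residual r q) \<omega>" for \<omega>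
  have m0: "0 \<le> m" unfolding m_def using residual_nonneg[OF r] by (intro Bochner_Integration.integral_nonneg) auto
  have m_le: "m \<le> 33 * ?d * r / 2 ^ q" unfolding m_def by (rule residual_mean_le[OF r M2])
  note R = dev_square[OF residual_measurable residual_square_mean_le(1)[OF r M2], of q, folded R_def]
  have bound_eq: "lip_dev_bound r q \<omega> = (\<Sum>i\<in>?I. a i \<omega>) + (R \<omega> + 2 * m)" for \<omega>
    by (simp add: lip_dev_bound_def a_def R_def dev_def m_def split_def)
  have sq: "(lip_dev_bound r q \<omega>)\<^sup>2 \<le> 2 * (\<Sum>i\<in>?I. a i \<omega>)\<^sup>2 + 4 * (R \<omega>)\<^sup>2 + 16 * m\<^sup>2" for \<omega>
  proof -
    have two: "(x + y)\<^sup>2 \<le> 2 * x\<^sup>2 + 2 * y\<^sup>2" for x y :: real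
      using zero_le_power2[of "x - y"] by (simp add: power2_eq_square algebra_simps)
    show ?thesis
      unfolding bound_eq using two[of "\<Sum>i\<in>?I. a i \<omega>" "R \<omega> + 2 * m"] two[of "R \<omega>" "2 * m"] by (simp add: power_mult_distrib)
  qed
  have i: "integrable M (\<lambda>\<omega>. 2 * (\<Sum>i\<in>?I. a i \<omega>)\<^sup>2 + 4 * (R \<omega>)\<^sup>2 + 16 * m\<^sup>2)"
    using chain(1) R(1) by simp
  show 1: "integrable M (\<lambda>\<omega>. (lip_dev_bound r q \<omega>)\<^sup>2)"
    using sq by (intro Bochner_Integration.integrable_bound[OF i]) (auto intro!: AE_I2 order_trans[OF sq])
  have "(\<integral>\<omega>. (lip_dev_bound r q \<omega>)\<^sup>2 \<partial>M) \<le> (\<integral>\<omega>. 2 * (\<Sum>i\<in>?I. a i \<omega>)\<^sup>2 + 4 * (R \<omega>)\<^sup>2 + 16 * m\<^sup>2 \<partial>M)"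
    using sq by (intro integral_mono[OF 1 i])
  also have "\<dots> = 2 * (\<integral>\<omega>. (\<Sum>i\<in>?I. a i \<omega>)\<^sup>2 \<partial>M) + 4 * (\<integral>\<omega>. (R \<omega>)\<^sup>2 \<partial>M) + 16 * m\<^sup>2"
    using chain(1) R(1) by (simp add: prob_space)
  also have "\<dots> \<le> 2 * (4 * c)\<^sup>2 + 4 * (34 * ?d\<^sup>2 * r\<^sup>2 / 4 ^ q) + 16 * (33 * ?d * r / 2 ^ q)\<^sup>2"
  proof (intro add_mono mult_left_mono)
    show "(\<integral>\<omega>. (\<Sum>i\<in>?I. a i \<omega>)\<^sup>2 \<partial>M) \<le> (4 * c)\<^sup>2"
      using chain(2) power_mono[OF \<sigma>_sum \<sigma>_sum0, of 2] by linarith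
    have "(4::real) ^ q \<le> 2 ^ (D * q)"
    proof -
      have "(4::real) ^ q = 2 ^ (2 * q)" by (simp add: power_mult)
      also have "\<dots> \<le> 2 ^ (D * q)" using D by (intro power_increasing mult_right_mono) auto
      finally show ?thesis .
    qed
    then have "(4::real) ^ q \<le> real n" using nq by linarith
    then show "(\<integral>\<omega>. (R \<omega>)\<^sup>2 \<partial>M) \<le> 34 * ?d\<^sup>2 * r\<^sup>2 / 4 ^ q"
      using residual_square_mean_le(2)[OF r M2, of q] n_pos
      by (intro order_trans[OF R(2)] frac_le) auto
    show "m\<^sup>2 \<le> (33 * ?d * r / 2 ^ q)\<^sup>2" using m0 m_le by (intro power_mono)
  qed auto
  also have "\<dots> = (4608 * (?d * 3 ^ CARD('d))\<^sup>2 + 17560 * ?d\<^sup>2) * r\<^sup>2 / 4 ^ q"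
  proof -
    have "(4::real) ^ q = (2 ^ q)\<^sup>2" by (simp add: power2_eq_square flip: power_mult_distrib)
    then show ?thesis by (simp add: c_def power_mult_distrib power_divide add_divide_distrib[symmetric] algebra_simps)
  qed
  also have "\<dots> \<le> (22500 * (?d * 3 ^ CARD('d))\<^sup>2) * r\<^sup>2 / 4 ^ q"
  proof (intro divide_right_mono mult_right_mono)
    have "?d * 1 \<le> ?d * 3 ^ CARD('d)" by (intro mult_left_mono) auto
    then have "?d\<^sup>2 \<le> (?d * 3 ^ CARD('d))\<^sup>2" by (intro power_mono) auto
    moreover have "0 \<le> (?d * 3 ^ CARD('d))\<^sup>2" by simp
    ultimately show "4608 * (?d * 3 ^ CARD('d))\<^sup>2 + 17560 * ?d\<^sup>2 \<le> 22500 * (?d * 3 ^ CARD('d))\<^sup>2"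
      by linarith
  qed auto
  finally show "(\<integral>\<omega>. (lip_dev_bound r q \<omega>)\<^sup>2 \<partial>M) \<le> (22500 * (?d * 3 ^ CARD('d))\<^sup>2) * r\<^sup>2 / 4 ^ q" .
qed

end

lemma rate_pos:
  assumes "n \<ge> 1"
  shows "rate d n > 0"
  using assms by (auto simp: rate_def)

text \<open>The depth \<open>q\<close> is the largest one with \<open>2^(Dq) \<le> n\<close>, where \<open>D = max d 4\<close>. By maximality \<open>4^(-q)\<close> is at most
\<open>4 n^(-2/D)\<close>, and the remaining factor 2 compares this with the rate for \<open>d = 4\<close>, whose logarithm may
be as small as \<open>ln 2\<close>.\<close>

lemma dyadic_rate:
  assumes n: "n \<ge> 1"
  shows "\<exists>q. 2 ^ (max d 4 * q) \<le> n \<and> 1 / 4 ^ q \<le> 8 * rate d n"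
proof -
  define D where "D = max d 4"
  have D: "D \<ge> 4" by (simp add: D_def)
  have ex: "\<exists>q. n < 2 ^ (D * q)"
  proof
    have "n < 2 ^ n" by simp
    also have "\<dots> \<le> 2 ^ (D * n)" using D by (intro power_increasing) auto
    finally show "n < 2 ^ (D * n)" .
  qed
  define k where "k = (LEAST q. n < 2 ^ (D * q))"
  have k: "n < 2 ^ (D * k)" unfolding k_def by (rule LeastI_ex[OF ex])
  then have "k \<noteq> 0" using n by (intro notI) auto
  then obtain q where q: "k = Suc q" by (cases k) auto
  have "2 ^ (D * q) \<le> n"
    using not_less_Least[of q "\<lambda>q. n < 2 ^ (D * q)"] q k_def by auto
  moreover have "1 / 4 ^ q \<le> 8 * rate d n"
  proof -
    have "real n \<le> 2 ^ (D * Suc q)"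
      using k q by (metis less_imp_le of_nat_le_iff of_nat_numeral of_nat_power)
    also have "\<dots> = (2 ^ Suc q) powr real D"
      by (subst powr_realpow) (auto simp only: power_mult mult.commute[of D] zero_less_power zero_less_numeral)
    finally have "real n powr (2 / real D) \<le> ((2 ^ Suc q) powr real D) powr (2 / real D)"
      using n by (intro powr_mono2) auto
    also have "\<dots> = 4 * 4 ^ q"
    proof -
      have "((2 ^ Suc q :: real) powr real D) powr (2 / real D) = (2 ^ Suc q :: real) powr (real D * (2 / real D))"
        by (simp only: powr_powr)
      also have "\<dots> = (2 ^ Suc q) powr 2" using D by (simp del: power_Suc)
      also have "\<dots> = (2 ^ Suc q)\<^sup>2" by (simp add: powr_numeral)
      also have "\<dots> = 4 * 4 ^ q"
      proof -
        have "(4::real) ^ q = (2 ^ q)\<^sup>2" by (simp add: power2_eq_square flip: power_mult_distrib)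
        then show ?thesis by (simp add: power_mult_distrib)
      qed
      finally show ?thesis .
    qed
    finally have "real n powr (2 / real D) \<le> 4 * 4 ^ q" .
    then have "1 / 4 ^ q \<le> 4 / real n powr (2 / real D)" using n by (simp add: field_simps)
    also have "\<dots> = 4 * real n powr (- (2 / real D))" by (simp add: powr_minus_divide)
    also have "real n powr (- (2 / real D)) \<le> 2 * rate d n"
    proof (cases "d = 4")
      case True
      have "ln 2 \<le> ln (real n + 1)" using n by simp
      then have "1 \<le> 2 * ln (real n + 1)" using ln2_ge_two_thirds by linarith
      then have "real n powr (- (1 / 2)) * 1 \<le> real n powr (- (1 / 2)) * (2 * ln (real n + 1))"
        by (intro mult_left_mono) auto
      then show ?thesis using True by (simp add: D_def rate_def)
    qed (auto simp: D_def rate_def max_def)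
    finally show ?thesis by simp
  qed
  ultimately show ?thesis unfolding D_def by blast
qed

text \<open>Eight times the factor in \<open>lip_dev_bound_square\<close>; the eight comes from \<open>dyadic_rate\<close>.\<close>

definition chaos_const :: "'d::finite itself \<Rightarrow> real" where
  "chaos_const _ = 180000 * (real CARD('d) * 3 ^ CARD('d))\<^sup>2"

lemma (in iid_sample) empirical_lipschitz_deviation:
  assumes r: "r > 0" and M2: "(\<integral>x. (norm x)\<^sup>2 \<partial>\<mu>) \<le> r\<^sup>2"
  shows "\<exists>D \<in> borel_measurable M. integrable M (\<lambda>\<omega>. (D \<omega>)\<^sup>2) \<and>
     (\<integral>\<omega>. (D \<omega>)\<^sup>2 \<partial>M) \<le> chaos_const TYPE('d) * r\<^sup>2 * rate CARD('d) n \<and>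
     (\<forall>f \<omega>. (\<forall>x y. \<bar>f x - f y\<bar> \<le> norm (x - y)) \<longrightarrow>
        \<bar>(\<Sum>i=1..n. f (Y i \<omega>)) / real n - (\<integral>x. f x \<partial>\<mu>)\<bar> \<le> D \<omega>)"
proof -
  \<comment> \<open>A larger dimension parameter only weakens the counting bound, so \<open>d < 4\<close> is treated like \<open>d = 4\<close>.\<close>
  obtain q where q: "2 ^ (max CARD('d) 4 * q) \<le> n" "1 / 4 ^ q \<le> 8 * rate CARD('d) n"
    using dyadic_rate[OF n_pos] by blast
  have "(22500 * (real CARD('d) * 3 ^ CARD('d))\<^sup>2) * r\<^sup>2 * (1 / 4 ^ q)
      \<le> (22500 * (real CARD('d) * 3 ^ CARD('d))\<^sup>2) * r\<^sup>2 * (8 * rate CARD('d) n)"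
    using q(2) by (intro mult_left_mono) auto
  also have "\<dots> = chaos_const TYPE('d) * r\<^sup>2 * rate CARD('d) n" by (simp add: chaos_const_def)
  finally have c: "(22500 * (real CARD('d) * 3 ^ CARD('d))\<^sup>2) * r\<^sup>2 / 4 ^ q
      \<le> chaos_const TYPE('d) * r\<^sup>2 * rate CARD('d) n" by simp
  show ?thesis
    using lip_dev_bound_square[OF r M2 _ _ q(1)] c dev_le_lip_dev_bound[OF r, of _ _ q, unfolded dev_def]
    by (intro bexI[of _ "lip_dev_bound r q"]) (auto intro: order_trans)
qed

section \<open>Gaussian increments\<close>

text \<open>Fubini's theorem for products of functions of single coordinates, with the coordinates indexed by
the index type of the vectors instead of the standard basis.\<close>

lemma nn_integral_lborel_vec_prod:
  fixes f :: "'d::finite \<Rightarrow> real \<Rightarrow> ennreal"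
  assumes f: "\<And>i. f i \<in> borel_measurable borel"
  shows "(\<integral>\<^sup>+x. (\<Prod>i\<in>UNIV. f i (x $ i)) \<partial>(lborel :: (real ^ 'd) measure)) = (\<Prod>i\<in>UNIV. \<integral>\<^sup>+x. f i x \<partial>lborel)"
proof -
  let ?e = "\<lambda>i. axis i 1 :: real ^ 'd"
  have inj: "inj ?e" by (auto simp: inj_def axis_eq_axis)
  have B: "(Basis :: (real ^ 'd) set) = range ?e" by (auto simp: Basis_vec_def)
  define g where "g b = f (inv ?e b)" for b
  have g: "g (?e i) = f i" for i by (simp add: g_def inv_f_f[OF inj])
  have "(\<integral>\<^sup>+x. (\<Prod>b\<in>Basis. g b (x \<bullet> b)) \<partial>(lborel :: (real ^ 'd) measure)) = (\<Prod>b\<in>Basis. \<integral>\<^sup>+x. g b x \<partial>lborel)"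
    using f by (intro nn_integral_lborel_prod) (auto simp: g_def)
  then show ?thesis
    unfolding B prod.reindex[OF inj] by (simp add: g inner_axis)
qed

lemma vec_nth_measurable: "(\<lambda>x :: real ^ 'd. x $ k) \<in> borel_measurable borel"
  by simp

context
  fixes M :: "'w measure" and \<F> :: "real \<Rightarrow> 'w measure" and W :: "real \<Rightarrow> 'w \<Rightarrow> real ^ 'd"
  assumes filtered: "filtered_prob_space M \<F>" and W: "brownian_motion M \<F> W"
begin

interpretation prob_space M
  using filtered by (simp add: filtered_prob_space_def)

lemma filtration_measurable:
  assumes "Z \<in> borel_measurable (\<F> s)"
  shows "Z \<in> borel_measurable M"
    and "s \<le> t \<Longrightarrow> Z \<in> borel_measurable (\<F> t)"
proof -
  show "Z \<in> borel_measurable M"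
    using assms filtered measurable_from_subalg unfolding filtered_prob_space_def by blast
  assume "s \<le> t"
  then have "subalgebra (\<F> t) (\<F> s)"
    using filtered unfolding filtered_prob_space_def filtration_def subalgebra_def by simp
  then show "Z \<in> borel_measurable (\<F> t)" using assms measurable_from_subalg by blast
qed

lemma brownian_measurable: "0 \<le> t \<Longrightarrow> W t \<in> borel_measurable (\<F> t)"
  using W by (simp add: brownian_motion_def adapted_continuous_def)

lemma increment_component_distributed:
  assumes st: "0 \<le> s" "s < t"
  shows "distributed M lborel (\<lambda>\<omega>. (W t \<omega> - W s \<omega>) $ k) (normal_density 0 (sqrt (t - s)))"
proof -
  let ?n = "normal_density 0 (sqrt (t - s))"
  let ?D = "\<lambda>\<omega>. W t \<omega> - W s \<omega>"
  have D: "distributed M lborel ?D (\<lambda>x. ennreal (\<Prod>k\<in>UNIV. ?n (x $ k)))"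
    using W st unfolding brownian_motion_def by blast
  have Dm[measurable]: "?D \<in> borel_measurable M" using distributed_measurable[OF D] by simp
  show ?thesis
    unfolding distributed_def
  proof (intro conjI measure_eqI)
    fix A assume "A \<in> sets (distr M lborel (\<lambda>\<omega>. ?D \<omega> $ k))"
    then have A[measurable]: "A \<in> sets borel" by simp
    let ?A' = "{x :: real ^ 'd. x $ k \<in> A}"
    have A'[measurable]: "?A' \<in> sets borel" by measurable
    have "emeasure (distr M lborel (\<lambda>\<omega>. ?D \<omega> $ k)) A = emeasure (distr M lborel ?D) ?A'"
    proof -
      have "(\<lambda>\<omega>. ?D \<omega> $ k) \<in> measurable M lborel"
        unfolding measurable_lborel1 by (rule measurable_compose[OF Dm vec_nth_measurable])
      moreover have "?D \<in> measurable M lborel" unfolding measurable_lborel1 by (rule Dm)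
      ultimately show ?thesis
        using A A' by (simp only: emeasure_distr sets_lborel vimage_Collect_eq vimage_def mem_Collect_eq)
    qed
    also have "\<dots> = (\<integral>\<^sup>+x. ennreal (\<Prod>k\<in>UNIV. ?n (x $ k)) * indicator ?A' x \<partial>lborel)"
      unfolding distributed_distr_eq_density[OF D]
      by (rule emeasure_density) (auto intro: distributed_borel_measurable[OF D])
    also have "\<dots> = (\<integral>\<^sup>+x. (\<Prod>i\<in>UNIV. ennreal (?n (x $ i)) * (if i = k then indicator A (x $ i) else 1)) \<partial>(lborel :: (real ^ 'd) measure))"
      by (intro nn_integral_cong) (simp add: prod.distrib prod_ennreal indicator_def)
    also have "\<dots> = (\<Prod>i\<in>UNIV. \<integral>\<^sup>+x. ennreal (?n x) * (if i = k then indicator A x else 1) \<partial>lborel)"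
      by (rule nn_integral_lborel_vec_prod[of "\<lambda>i x. ennreal (?n x) * (if i = k then indicator A x else 1)"]) auto
    also have "\<dots> = (\<Prod>i\<in>UNIV. if i = k then emeasure (density lborel ?n) A else 1)"
    proof (intro prod.cong refl)
      fix i :: 'd
      have "(\<integral>\<^sup>+x. ennreal (?n x) \<partial>lborel) = 1"
        using st by (subst nn_integral_eq_integral) (auto simp: integrable_normal_density integral_normal_density)
      then show "(\<integral>\<^sup>+x. ennreal (?n x) * (if i = k then indicator A x else 1) \<partial>lborel)
          = (if i = k then emeasure (density lborel ?n) A else 1)"
        by (auto simp: emeasure_density)
    qed
    finally show "emeasure (distr M lborel (\<lambda>\<omega>. ?D \<omega> $ k)) A = emeasure (density lborel ?n) A" by simp
  next
    have "(\<lambda>\<omega>. ?D \<omega> $ k) \<in> borel_measurable M" by (rule measurable_compose[OF Dm vec_nth_measurable])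
    then show "(\<lambda>\<omega>. ?D \<omega> $ k) \<in> measurable M lborel" by (simp only: measurable_lborel1)
  qed auto
qed

lemma increment_component_moments:
  assumes st: "0 \<le> s" "s < t"
  shows "integrable M (\<lambda>\<omega>. (W t \<omega> - W s \<omega>) $ k)"
    and "integrable M (\<lambda>\<omega>. ((W t \<omega> - W s \<omega>) $ k)\<^sup>2)"
    and "(\<integral>\<omega>. (W t \<omega> - W s \<omega>) $ k \<partial>M) = 0"
    and "(\<integral>\<omega>. ((W t \<omega> - W s \<omega>) $ k)\<^sup>2 \<partial>M) = t - s"
proof -
  have \<sigma>: "0 < sqrt (t - s)" using st by simp
  note D = increment_component_distributed[OF st, of k]
  show m: "(\<integral>\<omega>. (W t \<omega> - W s \<omega>) $ k \<partial>M) = 0"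
    by (rule normal_distributed_expectation[OF \<sigma> D])
  show "(\<integral>\<omega>. ((W t \<omega> - W s \<omega>) $ k)\<^sup>2 \<partial>M) = t - s"
    using normal_distributed_variance[OF \<sigma> D] st unfolding m by simp
  show "integrable M (\<lambda>\<omega>. (W t \<omega> - W s \<omega>) $ k)"
    using distributed_integrable[OF D, of "\<lambda>x. x"] integrable_normal_moment_nz_1[OF \<sigma>, of 0] by simp
  show "integrable M (\<lambda>\<omega>. ((W t \<omega> - W s \<omega>) $ k)\<^sup>2)"
    using distributed_integrable[OF D, of "\<lambda>x. x\<^sup>2"] integrable_normal_moment[OF \<sigma>, of 0 2] by simp
qed

lemma increment_orthogonal:
  fixes Z :: "'w \<Rightarrow> real"
  assumes st: "0 \<le> s" "s < t" and Z: "Z \<in> borel_measurable (\<F> s)" "integrable M Z"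
  shows "integrable M (\<lambda>\<omega>. Z \<omega> * (W t \<omega> - W s \<omega>) $ k)"
    and "(\<integral>\<omega>. Z \<omega> * (W t \<omega> - W s \<omega>) $ k \<partial>M) = 0"
proof -
  let ?D = "\<lambda>\<omega>. W t \<omega> - W s \<omega>"
  note mom = increment_component_moments[OF st, of k]
  have ind: "indep_set (sets (\<F> s)) (sets (vimage_algebra (space M) ?D borel))"
    using W st unfolding brownian_motion_def by blast
  have sp: "space (\<F> s) = space M"
    using filtered unfolding filtered_prob_space_def subalgebra_def by blast
  have "indep_var borel Z borel (\<lambda>\<omega>. ?D \<omega> $ k)"
    unfolding indep_var_eq
  proof (intro conjI)
    show "random_variable borel Z" using filtration_measurable(1)[OF Z(1)] .
    show "random_variable borel (\<lambda>\<omega>. ?D \<omega> $ k)" using mom(1) by auto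
    have 1: "sigma_sets (space M) {Z -` A \<inter> space M |A. A \<in> sets borel} \<subseteq> sets (\<F> s)"
      unfolding sp[symmetric] using measurable_sets[OF Z(1)] by (intro sets.sigma_sets_subset) auto
    have 2: "sigma_sets (space M) {(\<lambda>\<omega>. ?D \<omega> $ k) -` A \<inter> space M |A. A \<in> sets borel}
        \<subseteq> sets (vimage_algebra (space M) ?D borel)"
    proof -
      have "(\<lambda>\<omega>. ?D \<omega> $ k) \<in> borel_measurable (vimage_algebra (space M) ?D borel)"
        by (rule measurable_compose[OF measurable_vimage_algebra1]) auto
      from measurable_sets[OF this]
      have "{(\<lambda>\<omega>. ?D \<omega> $ k) -` A \<inter> space M |A. A \<in> sets borel} \<subseteq> sets (vimage_algebra (space M) ?D borel)"
        by auto
      from sets.sigma_sets_subset[OF this] show ?thesis by simp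
    qed
    show "indep_set (sigma_sets (space M) {Z -` A \<inter> space M |A. A \<in> sets borel})
      (sigma_sets (space M) {(\<lambda>\<omega>. ?D \<omega> $ k) -` A \<inter> space M |A. A \<in> sets borel})"
      using ind unfolding indep_set_def
      by (rule indep_sets_mono_sets) (use 1 2 in \<open>auto split: bool.split\<close>)
  qed
  from indep_var_integrable[OF this Z(2) mom(1)] indep_var_lebesgue_integral[OF this Z(2) mom(1)] mom(3)
  show "integrable M (\<lambda>\<omega>. Z \<omega> * ?D \<omega> $ k)" "(\<integral>\<omega>. Z \<omega> * ?D \<omega> $ k \<partial>M) = 0" by simp_all
qed

lemma norm_square_vec: "(norm (x :: real ^ 'd))\<^sup>2 = (\<Sum>k\<in>UNIV. (x $ k)\<^sup>2)"
  unfolding power2_norm_eq_inner inner_vec_def by (simp add: power2_eq_square)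

text \<open>The increment is centred and independent of the past, so the cross term vanishes; this is the only
place where the martingale property of Brownian motion enters the moment estimate.\<close>

lemma increment_energy:
  fixes Z :: "'w \<Rightarrow> real ^ 'd"
  assumes st: "0 \<le> s" "s < t" and Z: "Z \<in> borel_measurable (\<F> s)" "integrable M (\<lambda>\<omega>. (norm (Z \<omega>))\<^sup>2)"
  shows "integrable M (\<lambda>\<omega>. (norm (Z \<omega> + sqrt 2 *\<^sub>R (W t \<omega> - W s \<omega>)))\<^sup>2)"
    and "(\<integral>\<omega>. (norm (Z \<omega> + sqrt 2 *\<^sub>R (W t \<omega> - W s \<omega>)))\<^sup>2 \<partial>M)
      = (\<integral>\<omega>. (norm (Z \<omega>))\<^sup>2 \<partial>M) + 2 * real CARD('d) * (t - s)"
proof -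
  let ?D = "\<lambda>\<omega>. W t \<omega> - W s \<omega>"
  have Zk: "(\<lambda>\<omega>. Z \<omega> $ k) \<in> borel_measurable (\<F> s)" for k
    using measurable_compose[OF Z(1) vec_nth_measurable] .
  have Zk2: "integrable M (\<lambda>\<omega>. (Z \<omega> $ k)\<^sup>2)" for k
  proof (rule Bochner_Integration.integrable_bound[OF Z(2)])
    show "(\<lambda>\<omega>. (Z \<omega> $ k)\<^sup>2) \<in> borel_measurable M"
      using filtration_measurable(1)[OF Zk] by simp
    show "AE \<omega> in M. norm ((Z \<omega> $ k)\<^sup>2) \<le> norm ((norm (Z \<omega>))\<^sup>2)"
      by (auto simp: abs_le_square_iff[symmetric] component_le_norm_cart)
  qed
  have Zk1: "integrable M (\<lambda>\<omega>. Z \<omega> $ k)" for k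
    by (rule square_integrable_imp_integrable[OF filtration_measurable(1)[OF Zk] Zk2])
  note orth = increment_orthogonal[OF st Zk Zk1]
  note mom = increment_component_moments[OF st]
  have eq: "(norm (Z \<omega> + sqrt 2 *\<^sub>R ?D \<omega>))\<^sup>2
      = (\<Sum>k\<in>UNIV. (Z \<omega> $ k)\<^sup>2 + (2 * sqrt 2) * (Z \<omega> $ k * ?D \<omega> $ k) + 2 * (?D \<omega> $ k)\<^sup>2)" for \<omega>
    unfolding norm_square_vec by (intro sum.cong refl) (simp add: power2_sum power_mult_distrib)
  have int: "integrable M (\<lambda>\<omega>. (Z \<omega> $ k)\<^sup>2 + (2 * sqrt 2) * (Z \<omega> $ k * ?D \<omega> $ k) + 2 * (?D \<omega> $ k)\<^sup>2)" for k
    using Zk2 orth(1) mom(2) by (intro Bochner_Integration.integrable_add integrable_mult_right)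
  show "integrable M (\<lambda>\<omega>. (norm (Z \<omega> + sqrt 2 *\<^sub>R ?D \<omega>))\<^sup>2)"
    unfolding eq using int by (rule Bochner_Integration.integrable_sum)
  have val: "(\<integral>\<omega>. (Z \<omega> $ k)\<^sup>2 + (2 * sqrt 2) * (Z \<omega> $ k * ?D \<omega> $ k) + 2 * (?D \<omega> $ k)\<^sup>2 \<partial>M)
      = (\<integral>\<omega>. (Z \<omega> $ k)\<^sup>2 \<partial>M) + 2 * (t - s)" for k
  proof -
    have "(\<integral>\<omega>. (Z \<omega> $ k)\<^sup>2 + (2 * sqrt 2) * (Z \<omega> $ k * ?D \<omega> $ k) + 2 * (?D \<omega> $ k)\<^sup>2 \<partial>M)
      = (\<integral>\<omega>. (Z \<omega> $ k)\<^sup>2 \<partial>M) + (2 * sqrt 2) * (\<integral>\<omega>. Z \<omega> $ k * ?D \<omega> $ k \<partial>M) + 2 * (\<integral>\<omega>. (?D \<omega> $ k)\<^sup>2 \<partial>M)"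
      using Zk2[of k] orth(1)[of k k] mom(2)[of k]
      by (simp del: vector_minus_component)
    then show ?thesis unfolding orth(2) mom(4) by simp
  qed
  have "(\<integral>\<omega>. (norm (Z \<omega> + sqrt 2 *\<^sub>R ?D \<omega>))\<^sup>2 \<partial>M) = (\<Sum>k\<in>UNIV. (\<integral>\<omega>. (Z \<omega> $ k)\<^sup>2 \<partial>M) + 2 * (t - s))"
    unfolding eq by (subst Bochner_Integration.integral_sum[OF int]) (simp only: val)
  also have "\<dots> = (\<integral>\<omega>. (norm (Z \<omega>))\<^sup>2 \<partial>M) + 2 * real CARD('d) * (t - s)"
    unfolding norm_square_vec using Zk2 by (simp add: sum.distrib Bochner_Integration.integral_sum)
  finally show "(\<integral>\<omega>. (norm (Z \<omega> + sqrt 2 *\<^sub>R ?D \<omega>))\<^sup>2 \<partial>M)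
      = (\<integral>\<omega>. (norm (Z \<omega>))\<^sup>2 \<partial>M) + 2 * real CARD('d) * (t - s)" .
qed

end

section \<open>Resolvents of convex gradients\<close>

text \<open>A backward Euler step of \<open>y' = - b y\<close> with step size \<open>h\<close>, starting from \<open>z\<close>.\<close>

definition resolvent :: "real \<Rightarrow> ('a::real_vector \<Rightarrow> 'a) \<Rightarrow> 'a \<Rightarrow> 'a" where
  "resolvent h b z = (SOME y. y + h *\<^sub>R b y = z)"

text \<open>The step exists because the equation says that \<open>y\<close> is a critical point of
\<open>|y - z|\<^sup>2 / 2 + h f y\<close>, and this function has a minimum: by the tangent inequality at \<open>z\<close> it exceeds its
value at \<open>z\<close> outside a ball around \<open>z\<close>.\<close>

lemma resolvent_eq:
  fixes f :: "'a::euclidean_space \<Rightarrow> real"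
  assumes f: "\<And>x. (f has_derivative (\<lambda>h. b x \<bullet> h)) (at x)"
    and mono: "\<And>x y. (b x - b y) \<bullet> (x - y) \<ge> 0" and h: "h \<ge> 0"
  shows "resolvent h b z + h *\<^sub>R b (resolvent h b z) = z"
proof -
  define g where "g y = (y - z) \<bullet> (y - z) / 2 + h * f y" for y
  have g: "(g has_derivative (\<lambda>v. (y - z + h *\<^sub>R b y) \<bullet> v)) (at y)" for y
    unfolding g_def[abs_def]
    by (auto intro!: derivative_eq_intros f simp: inner_commute algebra_simps diff_divide_distrib)
  \<comment> \<open>Outside this ball the quadratic term dominates the linear lower bound of \<open>h f\<close>.\<close>
  let ?R = "2 * (h * norm (b z))"
  have cont: "continuous_on (cball z ?R) g"
    using g by (intro continuous_at_imp_continuous_on) (auto intro: has_derivative_continuous)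
  have "cball z ?R \<noteq> {}" using h by (simp add: not_less)
  then obtain y where y: "y \<in> cball z ?R" "\<And>x. x \<in> cball z ?R \<Longrightarrow> g y \<le> g x"
    using continuous_attains_inf[OF compact_cball _ cont] by blast
  have min: "g y \<le> g x" for x
  proof (cases "x \<in> cball z ?R")
    case False
    have "b z \<bullet> (x - z) \<le> f x - f z"
      using monotone_gradient_subgradient[OF f mono, of z "x - z"] by simp
    then have "h * (f x - f z) \<ge> h * (b z \<bullet> (x - z))" using h by (intro mult_left_mono)
    moreover have "h * (b z \<bullet> (x - z)) \<ge> - (h * (norm (b z) * norm (x - z)))"
    proof -
      have "- (norm (b z) * norm (x - z)) \<le> b z \<bullet> (x - z)"
        using Cauchy_Schwarz_ineq2[of "b z" "x - z"] by linarith
      from mult_left_mono[OF this h] show ?thesis by simp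
    qed
    moreover have "norm (x - z) * (norm (x - z) - ?R) \<ge> 0"
      using False by (intro mult_nonneg_nonneg) (auto simp: dist_norm norm_minus_commute)
    ultimately have "g x \<ge> g z"
      unfolding g_def by (simp add: algebra_simps power2_norm_eq_inner[symmetric] power2_eq_square)
    moreover have "g y \<le> g z" using h by (intro y(2)) simp
    ultimately show ?thesis by simp
  qed (rule y(2))
  have "(\<lambda>v. (y - z + h *\<^sub>R b y) \<bullet> v) = (\<lambda>v. 0)"
    using min by (intro differential_zero_maxmin[OF UNIV_I open_UNIV g]) auto
  then have "(y - z + h *\<^sub>R b y) \<bullet> (y - z + h *\<^sub>R b y) = 0" by metis
  then have "y - z + h *\<^sub>R b y = 0" by (simp only: inner_eq_zero_iff)
  then have "y + h *\<^sub>R b y = z" by (simp add: algebra_simps)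
  then show ?thesis unfolding resolvent_def by (rule someI)
qed

lemma monotone_step_nonexpansive:
  fixes x y :: "'a::real_inner"
  assumes mono: "(b x - b y) \<bullet> (x - y) \<ge> 0" and h: "h \<ge> 0"
  shows "norm (x - y) \<le> norm ((x + h *\<^sub>R b x) - (y + h *\<^sub>R b y))"
proof -
  have "(norm ((x + h *\<^sub>R b x) - (y + h *\<^sub>R b y)))\<^sup>2 = (norm ((x - y) + h *\<^sub>R (b x - b y)))\<^sup>2"
    by (simp add: algebra_simps)
  also have "\<dots> = (norm (x - y))\<^sup>2 + 2 * (h * ((b x - b y) \<bullet> (x - y))) + (norm (h *\<^sub>R (b x - b y)))\<^sup>2"
    unfolding power2_norm_eq_inner by (simp add: inner_add_left inner_add_right inner_commute algebra_simps)
  finally have "(norm (x - y))\<^sup>2 \<le> (norm ((x + h *\<^sub>R b x) - (y + h *\<^sub>R b y)))\<^sup>2"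
    using mult_nonneg_nonneg[OF h mono] by simp
  then show ?thesis by (rule power2_le_imp_le) simp
qed

lemma resolvent_continuous:
  fixes f :: "'a::euclidean_space \<Rightarrow> real"
  assumes f: "\<And>x. (f has_derivative (\<lambda>h. b x \<bullet> h)) (at x)"
    and mono: "\<And>x y. (b x - b y) \<bullet> (x - y) \<ge> 0" and h: "h \<ge> 0"
  shows "continuous_on UNIV (resolvent h b)"
proof (rule lipschitz_on_continuous_on[of 1], rule lipschitz_onI)
  fix z z'
  have "norm (resolvent h b z - resolvent h b z') \<le> norm (z - z')"
    using monotone_step_nonexpansive[OF mono h, where x = "resolvent h b z" and y = "resolvent h b z'"]
    by (simp add: resolvent_eq[OF f mono h])
  then show "dist (resolvent h b z) (resolvent h b z') \<le> 1 * dist z z'" by (simp add: dist_norm)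
qed simp

section \<open>Second moments of a Langevin process\<close>

text \<open>The scheme for \<open>dX = \<surd>2 dW - b(t, X) dt\<close>. Unlike the explicit scheme it is stable for monotone drifts of
arbitrary growth.\<close>

primrec implicit_euler ::
  "real \<Rightarrow> (real \<Rightarrow> 'a::real_vector \<Rightarrow> 'a) \<Rightarrow> (real \<Rightarrow> 'w \<Rightarrow> 'a) \<Rightarrow> ('w \<Rightarrow> 'a) \<Rightarrow> nat \<Rightarrow> 'w \<Rightarrow> 'a" where
  "implicit_euler h b W X0 0 = X0"
| "implicit_euler h b W X0 (Suc i) = (\<lambda>\<omega>. resolvent h (b (real (Suc i) * h))
      (implicit_euler h b W X0 i \<omega> + sqrt 2 *\<^sub>R (W (real (Suc i) * h) \<omega> - W (real i * h) \<omega>)))"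

lemma integral_increment_le:
  fixes c :: "real \<Rightarrow> 'a::euclidean_space"
  assumes "a \<le> b" and c: "continuous_on {a..b} c" and le: "\<And>s. s \<in> {a..b} \<Longrightarrow> norm (c s - v) \<le> e"
  shows "norm (integral {a..b} c - (b - a) *\<^sub>R v) \<le> (b - a) * e"
proof -
  have "integral {a..b} c - (b - a) *\<^sub>R v = integral {a..b} (\<lambda>s. c s - v)"
    using assms by (subst integral_diff) (auto intro: integrable_continuous_real)
  also have "norm \<dots> \<le> e * (b - a)"
    using assms by (intro integral_bound) (auto intro!: continuous_intros)
  finally show ?thesis by (simp add: mult.commute)
qed

lemma langevin_solution_integral_form:
  assumes sol: "langevin_solution M \<F> W (\<lambda>s \<omega>. d s \<omega>) X"
    and cont: "AE \<omega> in M. continuous_on {0..} (\<lambda>s. d s \<omega>)"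
  shows "AE \<omega> in M. continuous_on {0..} (\<lambda>s. d s \<omega>) \<and>
     (\<forall>t\<ge>0. X t \<omega> = X 0 \<omega> + sqrt 2 *\<^sub>R W t \<omega> - integral {0..t} (\<lambda>s. d s \<omega>))"
proof -
  have "AE \<omega> in M. \<forall>t\<ge>0. set_integrable lborel {0..t} (\<lambda>s. d s \<omega>) \<and>
      X t \<omega> = X 0 \<omega> + sqrt 2 *\<^sub>R W t \<omega> - (LINT s:{0..t}|lborel. d s \<omega>)"
    using sol by (simp add: langevin_solution_def)
  with cont show ?thesis
  proof eventually_elim
    case (elim \<omega>)
    have "X t \<omega> = X 0 \<omega> + sqrt 2 *\<^sub>R W t \<omega> - integral {0..t} (\<lambda>s. d s \<omega>)" if "t \<ge> 0" for t
      using elim(2) that by (metis set_borel_integral_eq_integral(2))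
    with elim(1) show ?case by blast
  qed
qed

text \<open>The exact solution satisfies the equation of the scheme up to an error \<open>h e\<close> in every step, and the
steps do not expand distances, so that the errors only add up.\<close>

lemma implicit_euler_error:
  fixes X W :: "real \<Rightarrow> 'w \<Rightarrow> 'a::euclidean_space"
  assumes f: "\<And>s x. 0 \<le> s \<Longrightarrow> (\<phi> s has_derivative (\<lambda>h. b s x \<bullet> h)) (at x)"
    and mono: "\<And>s x y. 0 \<le> s \<Longrightarrow> (b s x - b s y) \<bullet> (x - y) \<ge> 0" and h: "h \<ge> 0"
    and c: "continuous_on {0..real k * h} (\<lambda>s. b s (X s \<omega>))"
    and X: "\<And>t. t \<in> {0..real k * h} \<Longrightarrow> X t \<omega> = X 0 \<omega> + sqrt 2 *\<^sub>R W t \<omega> - integral {0..t} (\<lambda>s. b s (X s \<omega>))"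
    and e: "\<And>s s'. s \<in> {0..real k * h} \<Longrightarrow> s' \<in> {0..real k * h} \<Longrightarrow> \<bar>s - s'\<bar> \<le> h \<Longrightarrow>
       norm (b s (X s \<omega>) - b s' (X s' \<omega>)) \<le> e"
    and W0: "W 0 \<omega> = 0"
  shows "i \<le> k \<Longrightarrow> norm (X (real i * h) \<omega> - implicit_euler h b W (X 0) i \<omega>) \<le> real i * h * e"
proof (induction i)
  case (Suc i)
  let ?s = "real i * h" and ?t = "real (Suc i) * h"
  let ?c = "\<lambda>s. b s (X s \<omega>)" and ?Y = "implicit_euler h b W (X 0)"
  have st: "0 \<le> ?s" "?s \<le> ?t" "?t \<le> real k * h" "?t - ?s = h"
    using Suc(2) h mult_right_mono[of "real (Suc i)" "real k" h]
    by (auto simp: algebra_simps)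
  have cs: "continuous_on {0..?t} ?c" "continuous_on {?s..?t} ?c"
    by (rule continuous_on_subset[OF c], unfold atLeastatMost_subset_iff, use st(1,3) in blast)+
  have "integral {0..?s} ?c + integral {?s..?t} ?c = integral {0..?t} ?c"
    by (rule Henstock_Kurzweil_Integration.integral_combine[OF st(1,2) integrable_continuous_real[OF cs(1)]])
  then have Xt: "X ?t \<omega> = X 0 \<omega> + sqrt 2 *\<^sub>R W ?t \<omega> - (integral {0..?s} ?c + integral {?s..?t} ?c)"
    using X[of ?t] st by simp
  have Xs: "X ?s \<omega> = X 0 \<omega> + sqrt 2 *\<^sub>R W ?s \<omega> - integral {0..?s} ?c"
    using st by (intro X) simp
  have inc: "X ?t \<omega> = X ?s \<omega> + sqrt 2 *\<^sub>R (W ?t \<omega> - W ?s \<omega>) - integral {?s..?t} ?c"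
    unfolding Xt by (subst Xs) (simp add: scaleR_diff_right)
  \<comment> \<open>The consistency error of the exact solution in the backward Euler step.\<close>
  define \<rho> where "\<rho> = h *\<^sub>R ?c ?t - integral {?s..?t} ?c"
  have \<rho>: "norm \<rho> \<le> h * e"
  proof -
    have "norm (integral {?s..?t} ?c - (?t - ?s) *\<^sub>R ?c ?t) \<le> (?t - ?s) * e"
    proof (rule integral_increment_le[OF st(2) cs(2)])
      fix u assume "u \<in> {?s..?t}"
      then have u: "?s \<le> u" "u \<le> ?t" by simp_all
      have "0 \<le> u" "u \<le> real k * h" "0 \<le> ?t" "\<bar>u - ?t\<bar> \<le> h"
        unfolding abs_le_iff using u st by linarith+
      then show "norm (?c u - ?c ?t) \<le> e"
        using st(3) by (intro e) (simp_all only: atLeastAtMost_iff simp_thms)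
    qed
    then show ?thesis unfolding \<rho>_def st(4) by (simp add: norm_minus_commute)
  qed
  have res: "?Y (Suc i) \<omega> + h *\<^sub>R b ?t (?Y (Suc i) \<omega>) = ?Y i \<omega> + sqrt 2 *\<^sub>R (W ?t \<omega> - W ?s \<omega>)"
    unfolding implicit_euler.simps using st by (intro resolvent_eq[OF f mono h]) auto
  have "norm (X ?t \<omega> - ?Y (Suc i) \<omega>)
      \<le> norm ((X ?t \<omega> + h *\<^sub>R b ?t (X ?t \<omega>)) - (?Y (Suc i) \<omega> + h *\<^sub>R b ?t (?Y (Suc i) \<omega>)))"
    using st by (intro monotone_step_nonexpansive mono h) auto
  also have "\<dots> = norm ((X ?s \<omega> - ?Y i \<omega>) + \<rho>)"
    unfolding res by (subst inc) (simp add: \<rho>_def algebra_simps)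
  also have "\<dots> \<le> norm (X ?s \<omega> - ?Y i \<omega>) + norm \<rho>" by (rule norm_triangle_ineq)
  also have "\<dots> \<le> real i * h * e + h * e" using Suc \<rho> by (intro add_mono) auto
  also have "\<dots> = real (Suc i) * h * e" by (simp add: algebra_simps)
  finally show ?case .
qed simp

lemma implicit_euler_converges:
  fixes X W :: "real \<Rightarrow> 'w \<Rightarrow> 'a::euclidean_space"
  assumes f: "\<And>s x. 0 \<le> s \<Longrightarrow> (\<phi> s has_derivative (\<lambda>h. b s x \<bullet> h)) (at x)"
    and mono: "\<And>s x y. 0 \<le> s \<Longrightarrow> (b s x - b s y) \<bullet> (x - y) \<ge> 0" and t: "t > 0"
    and c: "continuous_on {0..} (\<lambda>s. b s (X s \<omega>))"
    and X: "\<And>t. t \<ge> 0 \<Longrightarrow> X t \<omega> = X 0 \<omega> + sqrt 2 *\<^sub>R W t \<omega> - integral {0..t} (\<lambda>s. b s (X s \<omega>))"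
    and W0: "W 0 \<omega> = 0"
  shows "(\<lambda>k. implicit_euler (t / real k) b W (X 0) k \<omega>) \<longlonglongrightarrow> X t \<omega>"
proof (rule tendstoI)
  fix e :: real assume e: "e > 0"
  have ct: "continuous_on {0..t} (\<lambda>s. b s (X s \<omega>))" using c by (rule continuous_on_subset) auto
  have "uniformly_continuous_on {0..t} (\<lambda>s. b s (X s \<omega>))"
    using ct by (intro compact_uniformly_continuous) auto
  then obtain \<delta> where \<delta>: "\<delta> > 0" "\<And>s s'. s \<in> {0..t} \<Longrightarrow> s' \<in> {0..t} \<Longrightarrow> \<bar>s - s'\<bar> < \<delta> \<Longrightarrow>
      norm (b s (X s \<omega>) - b s' (X s' \<omega>)) < e / (2 * t)"
    unfolding uniformly_continuous_on_def dist_norm real_norm_def using e t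
    by (metis abs_minus_commute divide_pos_pos mult_pos_pos zero_less_numeral norm_minus_commute)
  have "(\<lambda>k. t / real k) \<longlonglongrightarrow> 0" by real_asymp
  then have "\<forall>\<^sub>F k in sequentially. t / real k < \<delta>" using \<delta>(1) by (rule order_tendstoD)
  then show "\<forall>\<^sub>F k in sequentially. dist (implicit_euler (t / real k) b W (X 0) k \<omega>) (X t \<omega>) < e"
    using eventually_gt_at_top[of "0::nat"]
  proof eventually_elim
    case (elim k)
    have kh: "real k * (t / real k) = t" using elim by simp
    have "norm (X (real k * (t / real k)) \<omega> - implicit_euler (t / real k) b W (X 0) k \<omega>)
        \<le> real k * (t / real k) * (e / (2 * t))"
    proof (rule implicit_euler_error[where X = X and \<omega> = \<omega> and b = b and k = k and i = k and W = W and h = "t / real k" and e = "e / (2 * t)", OF f mono])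
      show "continuous_on {0..real k * (t / real k)} (\<lambda>s. b s (X s \<omega>))" unfolding kh by (rule ct)
      show "X u \<omega> = X 0 \<omega> + sqrt 2 *\<^sub>R W u \<omega> - integral {0..u} (\<lambda>s. b s (X s \<omega>))"
        if "u \<in> {0..real k * (t / real k)}" for u using that by (intro X) auto
      show "norm (b s (X s \<omega>) - b s' (X s' \<omega>)) \<le> e / (2 * t)"
        if "s \<in> {0..real k * (t / real k)}" "s' \<in> {0..real k * (t / real k)}" "\<bar>s - s'\<bar> \<le> t / real k" for s s'
        using \<delta>(2)[of s s'] that elim unfolding kh by auto
    qed (use t W0 in auto)
    then have "norm (X t \<omega> - implicit_euler (t / real k) b W (X 0) k \<omega>) \<le> e / 2"
      unfolding kh using t by simp
    then show ?case using e by (simp add: dist_norm norm_minus_commute)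
  qed
qed

text \<open>Strong monotonicity makes a backward step contract the energy, up to the drift at the origin; the
latter is absorbed by the crude inequality \<open>|v| \<le> 1 + |v|\<^sup>2\<close>, which is where the form of \<open>\<alpha>\<close> and \<open>\<beta>\<close>
comes from.\<close>

lemma implicit_step_energy:
  fixes v z :: "'a::real_inner"
  assumes step: "v + h *\<^sub>R b v = z" and mono: "(b v - b 0) \<bullet> v \<ge> lam * (norm v)\<^sup>2"
    and b0: "norm (b 0) \<le> S" and h: "h \<ge> 0"
  shows "(1 + 2 * h * (lam - S)) * (norm v)\<^sup>2 \<le> (norm z)\<^sup>2 + 2 * h * S"
proof -
  have "(norm z)\<^sup>2 = (norm (v + h *\<^sub>R b v))\<^sup>2" using step by simp
  also have "\<dots> = (norm v)\<^sup>2 + 2 * h * (b v \<bullet> v) + (norm (h *\<^sub>R b v))\<^sup>2"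
    unfolding power2_norm_eq_inner by (simp add: inner_add_left inner_add_right inner_commute)
  finally have 1: "(norm z)\<^sup>2 \<ge> (norm v)\<^sup>2 + 2 * h * (b v \<bullet> v)" by simp
  have "norm v \<le> 1 + (norm v)\<^sup>2"
    using zero_le_power2[of "norm v - 1 / 2"] by (simp add: power2_eq_square algebra_simps)
  then have "norm (b 0) * norm v \<le> S * (1 + (norm v)\<^sup>2)"
    using b0 order_trans[OF norm_ge_zero b0] by (intro mult_mono) auto
  then have "b v \<bullet> v \<ge> lam * (norm v)\<^sup>2 - S * (1 + (norm v)\<^sup>2)"
    using mono Cauchy_Schwarz_ineq2[of "b 0" v] unfolding inner_diff_left by linarith
  then have "2 * h * (b v \<bullet> v) \<ge> 2 * h * (lam * (norm v)\<^sup>2 - S * (1 + (norm v)\<^sup>2))"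
    using h by (intro mult_left_mono) auto
  with 1 show ?thesis by (simp add: algebra_simps)
qed

text \<open>The solution of the discrete recursion \<open>a' = (a + h \<alpha>) / (1 - h \<beta>)\<close> with \<open>r = 1 / (1 - h \<beta>)\<close>.\<close>

lemma gronwall_bound_step:
  fixes r h \<alpha> \<beta> m :: real
  assumes r: "r * (1 - h * \<beta>) = 1" and \<beta>: "\<beta> \<noteq> 0"
  shows "(r ^ i * m + \<alpha> / \<beta> * (r ^ i - 1) + h * \<alpha>) * r = r ^ Suc i * m + \<alpha> / \<beta> * (r ^ Suc i - 1)"
proof -
  have "h * \<alpha> * r = \<alpha> / \<beta> * (r * (h * \<beta>))" using \<beta> by (simp add: field_simps)
  also have "r * (h * \<beta>) = r - 1" using r by (simp add: algebra_simps)
  finally show ?thesis by (simp add: algebra_simps diff_divide_distrib)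
qed

text \<open>Fatou's lemma for a limit that is only known to be the limit of minorants \<open>h\<close> of measurable functions \<open>g\<close>.
The minorants depend on the sample point and need not be measurable.\<close>

lemma nn_integral_fatou_le:
  fixes g :: "nat \<Rightarrow> 'w \<Rightarrow> real"
  assumes g: "\<forall>\<^sub>F k in sequentially. g k \<in> borel_measurable M \<and> (\<integral>\<^sup>+\<omega>. ennreal (g k \<omega>) \<partial>M) \<le> ennreal (u k)"
    and f: "AE \<omega> in M. \<exists>h. h \<longlonglongrightarrow> f \<omega> \<and> (\<forall>k. h k \<le> g k \<omega>)"
    and u: "u \<longlonglongrightarrow> U"
  shows "(\<integral>\<^sup>+\<omega>. ennreal (f \<omega>) \<partial>M) \<le> ennreal U"
proof -
  obtain N where N: "\<And>k. k \<ge> N \<Longrightarrow> g k \<in> borel_measurable M" "\<And>k. k \<ge> N \<Longrightarrow> (\<integral>\<^sup>+\<omega>. ennreal (g k \<omega>) \<partial>M) \<le> ennreal (u k)"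
    using g unfolding eventually_sequentially by blast
  have "(\<integral>\<^sup>+\<omega>. ennreal (f \<omega>) \<partial>M) \<le> (\<integral>\<^sup>+\<omega>. liminf (\<lambda>k. ennreal (g (k + N) \<omega>)) \<partial>M)"
  proof (rule nn_integral_mono_AE)
    show "AE \<omega> in M. ennreal (f \<omega>) \<le> liminf (\<lambda>k. ennreal (g (k + N) \<omega>))"
      using f
    proof eventually_elim
      case (elim \<omega>)
      then obtain h where h: "h \<longlonglongrightarrow> f \<omega>" "\<And>k. h k \<le> g k \<omega>" by blast
      have "(\<lambda>k. ennreal (h (k + N))) \<longlonglongrightarrow> ennreal (f \<omega>)"
        by (intro tendsto_ennrealI LIMSEQ_ignore_initial_segment h)
      then have "ennreal (f \<omega>) = liminf (\<lambda>k. ennreal (h (k + N)))" by (intro lim_imp_Liminf[symmetric]) auto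
      also have "\<dots> \<le> liminf (\<lambda>k. ennreal (g (k + N) \<omega>))"
        using h(2) by (intro Liminf_mono always_eventually allI ennreal_leI)
      finally show ?case .
    qed
  qed
  also have "\<dots> \<le> liminf (\<lambda>k. \<integral>\<^sup>+\<omega>. ennreal (g (k + N) \<omega>) \<partial>M)"
    using N(1)[OF le_add2] by (intro nn_integral_liminf measurable_compose[OF _ measurable_ennreal])
  also have "\<dots> \<le> liminf (\<lambda>k. ennreal (u (k + N)))"
    using N(2)[OF le_add2] by (intro Liminf_mono always_eventually allI)
  also have "\<dots> = ennreal U"
    using LIMSEQ_ignore_initial_segment[OF u, of N]
    by (intro lim_imp_Liminf tendsto_ennrealI) auto
  finally show ?thesis .
qed

text \<open>The second moments of the implicit Euler scheme at the final time are bounded by the solutions of the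
discrete recursion, and these converge to the Gronwall bound as the number of steps grows. The scheme
converges almost surely to the process, and Fatou's lemma combines the two limits. That the process
has finite second moments at later times is part of the conclusion.\<close>

lemma langevin_second_moment:
  fixes X W :: "real \<Rightarrow> 'w \<Rightarrow> real ^ 'd" and b :: "real \<Rightarrow> real ^ 'd \<Rightarrow> real ^ 'd"
  assumes filtered: "filtered_prob_space M \<F>" and W: "brownian_motion M \<F> W"
    and sol: "langevin_solution M \<F> W (\<lambda>s \<omega>. b s (X s \<omega>)) X"
    and cont: "continuous_on ({0..} \<times> UNIV) (\<lambda>(s, x). b s x)"
    and f: "\<And>s x. 0 \<le> s \<Longrightarrow> (\<phi> s has_derivative (\<lambda>h. b s x \<bullet> h)) (at x)"
    and mono: "\<And>s x y. 0 \<le> s \<Longrightarrow> (b s x - b s y) \<bullet> (x - y) \<ge> lam * (norm (x - y))\<^sup>2" and lam: "lam > 0"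
    and b0: "\<And>s. 0 \<le> s \<Longrightarrow> norm (b s 0) \<le> S"
    and X0: "integrable M (\<lambda>\<omega>. (norm (X 0 \<omega>))\<^sup>2)" and t: "t \<ge> 0"
  shows "integrable M (\<lambda>\<omega>. (norm (X t \<omega>))\<^sup>2) \<and>
    (\<integral>\<omega>. (norm (X t \<omega>))\<^sup>2 \<partial>M)
      \<le> gronwall_bound (2 * real CARD('d) + 2 * S) (- 2 * (lam - S)) (\<integral>\<omega>. (norm (X 0 \<omega>))\<^sup>2 \<partial>M) t"
proof (cases "t = 0")
  case True
  then show ?thesis using X0 by (simp add: gronwall_bound_def)
next
  case False
  then have t: "t > 0" using t by simp
  define \<alpha> \<beta> where "\<alpha> = 2 * real CARD('d) + 2 * S" and "\<beta> = - 2 * (lam - S)"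
  define m0 where "m0 = (\<integral>\<omega>. (norm (X 0 \<omega>))\<^sup>2 \<partial>M)"
  interpret prob_space M using filtered by (simp add: filtered_prob_space_def)
  have S0: "0 \<le> S" using b0[of 0] norm_ge_zero order_trans by blast
  have mono0: "(b s x - b s y) \<bullet> (x - y) \<ge> 0" if "0 \<le> s" for s x y
  proof -
    have "0 \<le> lam * (norm (x - y))\<^sup>2" using lam by simp
    then show ?thesis using mono[OF that, of x y] by linarith
  qed
  have Xm: "X s \<in> borel_measurable (\<F> s)" if "0 \<le> s" for s
    using sol that by (simp add: langevin_solution_def adapted_continuous_def)
  have Wm: "W s \<in> borel_measurable (\<F> s)" if "0 \<le> s" for s
    by (rule brownian_measurable[OF filtered W that])
  note up = filtration_measurable(2)[OF filtered W]
  have "AE \<omega> in M. continuous_on {0..} (\<lambda>s. X s \<omega>)"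
    using sol by (simp add: langevin_solution_def adapted_continuous_def)
  then have cb: "AE \<omega> in M. continuous_on {0..} (\<lambda>s. b s (X s \<omega>))"
  proof eventually_elim
    case (elim \<omega>)
    then have "continuous_on {0..} (\<lambda>s. (s, X s \<omega>))" by (intro continuous_intros)
    from continuous_on_compose2[OF cont this image_subsetI] show ?case by simp
  qed
  have W0: "AE \<omega> in M. W 0 \<omega> = 0" using W by (simp add: brownian_motion_def)
  let ?Y = "\<lambda>k. implicit_euler (t / real k) b W (X 0)"
  have conv: "AE \<omega> in M. (\<lambda>k. ?Y k k \<omega>) \<longlonglongrightarrow> X t \<omega>"
    using langevin_solution_integral_form[OF sol cb] W0
    by eventually_elim (rule implicit_euler_converges[OF f mono0 t], blast+)
  have step: "?Y k i \<in> borel_measurable (\<F> (real i * (t / real k))) \<and> integrable M (\<lambda>\<omega>. (norm (?Y k i \<omega>))\<^sup>2) \<and>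
      (\<integral>\<omega>. (norm (?Y k i \<omega>))\<^sup>2 \<partial>M)
        \<le> (if \<beta> = 0 then m0 + \<alpha> * (real i * (t / real k))
           else (1 / (1 - t / real k * \<beta>)) ^ i * m0 + \<alpha> / \<beta> * ((1 / (1 - t / real k * \<beta>)) ^ i - 1))"
    if k: "k > 0" "t / real k * \<beta> < 1" for k i
  proof (induction i)
    case 0
    then show ?case using X0 Xm[of 0] by (simp add: m0_def)
  next
    case (Suc i)
    define h where "h = t / real k"
    have h: "h > 0" "h * \<beta> < 1" using k t by (auto simp: h_def)
    let ?s = "real i * h" and ?t = "real (Suc i) * h"
    have st: "0 \<le> ?s" "?s < ?t" "?t - ?s = h" using h by (auto simp: algebra_simps)
    note IH = Suc[folded h_def]
    let ?V = "implicit_euler h b W (X 0)"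
    define Z where "Z \<omega> = ?V i \<omega> + sqrt 2 *\<^sub>R (W ?t \<omega> - W ?s \<omega>)" for \<omega>
    have Z: "integrable M (\<lambda>\<omega>. (norm (Z \<omega>))\<^sup>2)"
      "(\<integral>\<omega>. (norm (Z \<omega>))\<^sup>2 \<partial>M) = (\<integral>\<omega>. (norm (?V i \<omega>))\<^sup>2 \<partial>M) + 2 * real CARD('d) * h"
      unfolding Z_def using increment_energy[OF filtered W st(1,2)] IH st(3) by auto
    have t0: "0 \<le> ?t" using st by linarith
    have "?V i \<in> borel_measurable (\<F> ?t)" using IH by (intro up[OF _ less_imp_le[OF st(2)]]) blast
    moreover have "W ?s \<in> borel_measurable (\<F> ?t)" by (rule up[OF Wm[OF st(1)] less_imp_le[OF st(2)]])
    ultimately have "(\<lambda>\<omega>. ?V i \<omega> + sqrt 2 *\<^sub>R (W ?t \<omega> - W ?s \<omega>)) \<in> borel_measurable (\<F> ?t)"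
      using Wm[OF t0]
      by (intro borel_measurable_add borel_measurable_scaleR borel_measurable_diff borel_measurable_const)
    then have Zm: "Z \<in> borel_measurable (\<F> ?t)" unfolding Z_def[abs_def] .
    have V_eq: "?V (Suc i) = (\<lambda>\<omega>. resolvent h (b ?t) (Z \<omega>))" by (simp add: Z_def)
    have Vm: "?V (Suc i) \<in> borel_measurable (\<F> ?t)"
      unfolding V_eq using h st
      by (intro measurable_compose[OF Zm borel_measurable_continuous_onI] resolvent_continuous[OF f mono0]) auto
    have VZ: "(1 - h * \<beta>) * (norm (?V (Suc i) \<omega>))\<^sup>2 \<le> (norm (Z \<omega>))\<^sup>2 + 2 * h * S" for \<omega>
    proof -
      have "?V (Suc i) \<omega> + h *\<^sub>R b ?t (?V (Suc i) \<omega>) = Z \<omega>"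
        unfolding V_eq using h t0 by (intro resolvent_eq[OF f mono0]) auto
      moreover have "(b ?t (?V (Suc i) \<omega>) - b ?t 0) \<bullet> ?V (Suc i) \<omega> \<ge> lam * (norm (?V (Suc i) \<omega>))\<^sup>2"
        using mono[OF t0, of "?V (Suc i) \<omega>" 0] by (simp only: diff_zero)
      ultimately have "(1 + 2 * h * (lam - S)) * (norm (?V (Suc i) \<omega>))\<^sup>2 \<le> (norm (Z \<omega>))\<^sup>2 + 2 * h * S"
        using b0[OF t0] h by (intro implicit_step_energy[where b = "b ?t"]) auto
      moreover have "1 + 2 * h * (lam - S) = 1 - h * \<beta>" by (simp add: \<beta>_def algebra_simps)
      ultimately show ?thesis by (simp only:)
    qed
    define r where "r = 1 / (1 - h * \<beta>)"
    have r: "r > 0" "r * (1 - h * \<beta>) = 1" using h by (auto simp: r_def)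
    have VZ': "(norm (?V (Suc i) \<omega>))\<^sup>2 \<le> r * ((norm (Z \<omega>))\<^sup>2 + 2 * h * S)" for \<omega>
    proof -
      have "r * ((1 - h * \<beta>) * (norm (?V (Suc i) \<omega>))\<^sup>2) \<le> r * ((norm (Z \<omega>))\<^sup>2 + 2 * h * S)"
        by (rule mult_left_mono[OF VZ less_imp_le[OF r(1)]])
      then show ?thesis by (simp only: mult.assoc[symmetric] r(2) mult_1)
    qed
    have Zi: "integrable M (\<lambda>\<omega>. r * ((norm (Z \<omega>))\<^sup>2 + 2 * h * S))" using Z(1) by simp
    have Vi: "integrable M (\<lambda>\<omega>. (norm (?V (Suc i) \<omega>))\<^sup>2)"
    proof (rule Bochner_Integration.integrable_bound[OF Zi])
      show "(\<lambda>\<omega>. (norm (?V (Suc i) \<omega>))\<^sup>2) \<in> borel_measurable M"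
        using filtration_measurable(1)[OF filtered W Vm] by measurable
      show "AE \<omega> in M. norm ((norm (?V (Suc i) \<omega>))\<^sup>2) \<le> norm (r * ((norm (Z \<omega>))\<^sup>2 + 2 * h * S))"
      proof (rule AE_I2)
        fix \<omega>
        show "norm ((norm (?V (Suc i) \<omega>))\<^sup>2) \<le> norm (r * ((norm (Z \<omega>))\<^sup>2 + 2 * h * S))"
          unfolding real_norm_def abs_power2 by (rule order_trans[OF VZ' abs_ge_self])
      qed
    qed
    have "(\<integral>\<omega>. (norm (?V (Suc i) \<omega>))\<^sup>2 \<partial>M) \<le> (\<integral>\<omega>. r * ((norm (Z \<omega>))\<^sup>2 + 2 * h * S) \<partial>M)"
      using VZ' by (intro integral_mono[OF Vi Zi])
    also have "\<dots> = r * ((\<integral>\<omega>. (norm (?V i \<omega>))\<^sup>2 \<partial>M) + h * \<alpha>)"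
      using Z by (simp add: prob_space \<alpha>_def algebra_simps)
    also have "\<dots> \<le> (if \<beta> = 0 then m0 + \<alpha> * ?t else r ^ Suc i * m0 + \<alpha> / \<beta> * (r ^ Suc i - 1))"
    proof (cases "\<beta> = 0")
      case True
      then have "r = 1" by (simp add: r_def)
      then show ?thesis using True IH by (simp add: algebra_simps)
    next
      case False
      have "r * ((\<integral>\<omega>. (norm (?V i \<omega>))\<^sup>2 \<partial>M) + h * \<alpha>) \<le> r * (r ^ i * m0 + \<alpha> / \<beta> * (r ^ i - 1) + h * \<alpha>)"
        using IH False r by (intro mult_left_mono add_right_mono) (auto simp: r_def)
      also have "\<dots> = r ^ Suc i * m0 + \<alpha> / \<beta> * (r ^ Suc i - 1)"
        using gronwall_bound_step[OF r(2) False, of i m0 \<alpha>] by (simp only: mult.commute)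
      finally show ?thesis using False by simp
    qed
    finally have le: "(\<integral>\<omega>. (norm (?V (Suc i) \<omega>))\<^sup>2 \<partial>M)
      \<le> (if \<beta> = 0 then m0 + \<alpha> * ?t else r ^ Suc i * m0 + \<alpha> / \<beta> * (r ^ Suc i - 1))" .
    show ?case unfolding h_def[symmetric] r_def[symmetric] by (intro conjI Vm Vi le)
  qed
  let ?u = "\<lambda>k. if \<beta> = 0 then m0 + \<alpha> * t
     else (1 / (1 - t / real k * \<beta>)) ^ k * m0 + \<alpha> / \<beta> * ((1 / (1 - t / real k * \<beta>)) ^ k - 1)"
  have "(\<lambda>k. t / real k * \<beta>) \<longlonglongrightarrow> 0" by real_asymp
  then have small: "\<forall>\<^sub>F k in sequentially. t / real k * \<beta> < 1" by (rule order_tendstoD) simp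
  then have ev: "\<forall>\<^sub>F k in sequentially. (\<lambda>\<omega>. (norm (?Y k k \<omega>))\<^sup>2) \<in> borel_measurable M \<and>
      (\<integral>\<^sup>+\<omega>. ennreal ((norm (?Y k k \<omega>))\<^sup>2) \<partial>M) \<le> ennreal (?u k)"
    using eventually_gt_at_top[of "0::nat"]
  proof eventually_elim
    case (elim k)
    then have kk: "real k * (t / real k) = t" by simp
    note st = step[OF elim(2,1), of k, unfolded kk]
    have "(\<integral>\<^sup>+\<omega>. ennreal ((norm (?Y k k \<omega>))\<^sup>2) \<partial>M) = ennreal (\<integral>\<omega>. (norm (?Y k k \<omega>))\<^sup>2 \<partial>M)"
      using st by (intro nn_integral_eq_integral) auto
    also have "\<dots> \<le> ennreal (?u k)" using st by (intro ennreal_leI) auto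
    finally have "(\<integral>\<^sup>+\<omega>. ennreal ((norm (?Y k k \<omega>))\<^sup>2) \<partial>M) \<le> ennreal (?u k)" .
    moreover have "?Y k k \<in> borel_measurable M" using st filtration_measurable(1)[OF filtered W] by blast
    ultimately show ?case by (intro conjI borel_measurable_power measurable_compose[OF _ borel_measurable_norm])
  qed
  have ulim: "?u \<longlonglongrightarrow> gronwall_bound \<alpha> \<beta> m0 t"
  proof (cases "\<beta> = 0")
    case False
    have "(\<lambda>k. inverse ((1 + (- (t * \<beta>)) / real k) ^ k)) \<longlonglongrightarrow> inverse (exp (- (t * \<beta>)))"
      by (intro tendsto_inverse tendsto_exp_limit_sequentially) simp
    moreover have "inverse ((1 + (- (t * \<beta>)) / real k) ^ k) = (1 / (1 - t / real k * \<beta>)) ^ k" for k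
      by (simp add: power_one_over inverse_eq_divide)
    moreover have "inverse (exp (- (t * \<beta>))) = exp (\<beta> * t)" by (simp add: exp_minus mult.commute)
    ultimately have E: "(\<lambda>k. (1 / (1 - t / real k * \<beta>)) ^ k) \<longlonglongrightarrow> exp (\<beta> * t)" by simp
    have "(\<lambda>k. (1 / (1 - t / real k * \<beta>)) ^ k * m0 + \<alpha> / \<beta> * ((1 / (1 - t / real k * \<beta>)) ^ k - 1))
        \<longlonglongrightarrow> exp (\<beta> * t) * m0 + \<alpha> / \<beta> * (exp (\<beta> * t) - 1)"
      by (intro tendsto_add tendsto_mult tendsto_diff tendsto_const E)
    then show ?thesis using False by (simp only: gronwall_bound_def if_False not_False_eq_True if_True)
  qed (simp add: gronwall_bound_def)
  have Xt: "X t \<in> borel_measurable M" using filtration_measurable(1)[OF filtered W Xm] t by simp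
  have Xt_le: "(\<integral>\<^sup>+\<omega>. ennreal ((norm (X t \<omega>))\<^sup>2) \<partial>M) \<le> ennreal (gronwall_bound \<alpha> \<beta> m0 t)"
  proof (rule nn_integral_fatou_le[OF ev _ ulim])
    show "AE \<omega> in M. \<exists>h. h \<longlonglongrightarrow> (norm (X t \<omega>))\<^sup>2 \<and> (\<forall>k. h k \<le> (norm (?Y k k \<omega>))\<^sup>2)"
      using conv
    proof eventually_elim
      case (elim \<omega>)
      then have "(\<lambda>k. (norm (?Y k k \<omega>))\<^sup>2) \<longlonglongrightarrow> (norm (X t \<omega>))\<^sup>2" by (intro tendsto_power tendsto_norm)
      then show ?case by (intro exI[of _ "\<lambda>k. (norm (?Y k k \<omega>))\<^sup>2"] conjI allI order_refl)
    qed
  qed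
  have Xint: "integrable M (\<lambda>\<omega>. (norm (X t \<omega>))\<^sup>2)"
  proof (rule integrableI_nonneg)
    show "(\<lambda>\<omega>. (norm (X t \<omega>))\<^sup>2) \<in> borel_measurable M" using Xt by simp
    show "(\<integral>\<^sup>+\<omega>. ennreal ((norm (X t \<omega>))\<^sup>2) \<partial>M) < \<infinity>"
      using order_le_less_trans[OF Xt_le ennreal_less_top] by simp
  qed simp
  moreover have "(\<integral>\<omega>. (norm (X t \<omega>))\<^sup>2 \<partial>M) \<le> gronwall_bound \<alpha> \<beta> m0 t"
  proof -
    have "0 \<le> gronwall_bound \<alpha> \<beta> m0 t"
    proof (rule tendsto_lowerbound[OF ulim _ trivial_limit_sequentially])
      show "\<forall>\<^sub>F k in sequentially. 0 \<le> ?u k"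
        using small eventually_gt_at_top[of "0::nat"]
      proof eventually_elim
        case (elim k)
        then have kk: "real k * (t / real k) = t" by simp
        have "0 \<le> (\<integral>\<omega>. (norm (?Y k k \<omega>))\<^sup>2 \<partial>M)" by simp
        also have "\<dots> \<le> ?u k" using step[OF elim(2,1), of k, unfolded kk] by blast
        finally show ?case .
      qed
    qed
    moreover have "ennreal (\<integral>\<omega>. (norm (X t \<omega>))\<^sup>2 \<partial>M) \<le> ennreal (gronwall_bound \<alpha> \<beta> m0 t)"
      using Xt_le by (subst nn_integral_eq_integral[OF Xint, symmetric]) auto
    ultimately show ?thesis by simp
  qed
  ultimately show ?thesis unfolding \<alpha>_def \<beta>_def m0_def by (rule conjI)
qed

section \<open>Gronwall's inequality in expectation\<close>

lemma left_riemann_sums: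
  fixes c :: "real \<Rightarrow> 'a::euclidean_space"
  assumes t: "t \<ge> 0" and c: "continuous_on {0..t} c"
  shows "(\<lambda>k. \<Sum>i<k. (t / real k) *\<^sub>R c (real i * (t / real k))) \<longlonglongrightarrow> integral {0..t} c"
proof (cases "t = 0")
  case False
  then have t: "t > 0" using t by simp
  show ?thesis
  proof (rule tendstoI)
    fix e :: real assume e: "e > 0"
    have e': "e / (2 * t) > 0" using e t by simp
    have "uniformly_continuous_on {0..t} c" using c by (intro compact_uniformly_continuous) auto
    from this[unfolded uniformly_continuous_on_def, rule_format, OF e']
    obtain \<delta> where \<delta>: "\<delta> > 0" "\<And>s s'. s \<in> {0..t} \<Longrightarrow> s' \<in> {0..t} \<Longrightarrow> dist s' s < \<delta> \<Longrightarrow> dist (c s') (c s) < e / (2 * t)"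
      by blast
    have "(\<lambda>k. t / real k) \<longlonglongrightarrow> 0" by real_asymp
    then have "\<forall>\<^sub>F k in sequentially. t / real k < \<delta>" using \<delta>(1) by (rule order_tendstoD)
    then show "\<forall>\<^sub>F k in sequentially. dist (\<Sum>i<k. (t / real k) *\<^sub>R c (real i * (t / real k))) (integral {0..t} c) < e"
      using eventually_gt_at_top[of "0::nat"]
    proof eventually_elim
      case (elim k)
      define h where "h = t / real k"
      have kh: "real k * h = t" and h: "h > 0" "h < \<delta>" using elim t by (auto simp: h_def)
      have "norm (integral {0..real j * h} c - (\<Sum>i<j. h *\<^sub>R c (real i * h))) \<le> real j * h * (e / (2 * t))" if "j \<le> k" for j
        using that
      proof (induction j)
        case (Suc j)
        let ?s = "real j * h" and ?t = "real (Suc j) * h"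
        have "real (Suc j) \<le> real k" using Suc(2) by (simp only: of_nat_le_iff)
        from mult_right_mono[OF this, of h] have tt: "?t \<le> t" using h kh by simp
        have st: "0 \<le> ?s" "?s \<le> ?t" "?t - ?s = h" using h by (auto simp: algebra_simps)
        have cs: "continuous_on {0..?t} c" "continuous_on {?s..?t} c"
          using tt st(1) by (auto intro!: continuous_on_subset[OF c] simp del: of_nat_Suc)
        have comb: "integral {0..?s} c + integral {?s..?t} c = integral {0..?t} c"
          by (rule Henstock_Kurzweil_Integration.integral_combine[OF st(1,2) integrable_continuous_real[OF cs(1)]])
        have inc: "norm (integral {?s..?t} c - (?t - ?s) *\<^sub>R c ?s) \<le> (?t - ?s) * (e / (2 * t))"
        proof (rule integral_increment_le[OF st(2) cs(2)])
          fix u assume "u \<in> {?s..?t}"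
          then have u: "?s \<le> u" "u \<le> ?t" by simp_all
          have "dist (c u) (c ?s) < e / (2 * t)"
          proof (rule \<delta>(2))
            show "?s \<in> {0..t}" unfolding atLeastAtMost_iff using st tt by linarith
            show "u \<in> {0..t}" unfolding atLeastAtMost_iff using u st tt by linarith
            show "dist u ?s < \<delta>" unfolding dist_real_def using u st(3) h(2) by linarith
          qed
          then show "norm (c u - c ?s) \<le> e / (2 * t)" by (simp add: dist_norm)
        qed
        have "integral {0..?t} c - (\<Sum>i<Suc j. h *\<^sub>R c (real i * h))
            = (integral {0..?s} c - (\<Sum>i<j. h *\<^sub>R c (real i * h))) + (integral {?s..?t} c - h *\<^sub>R c ?s)"
          unfolding comb[symmetric] by simp
        also have "norm \<dots> \<le> real j * h * (e / (2 * t)) + h * (e / (2 * t))"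
          using Suc inc unfolding st(3) by (intro norm_triangle_mono) auto
        also have "real j * h * x + h * x = real (Suc j) * h * x" for x by (simp add: algebra_simps)
        finally show ?case .
      qed simp
      from this[OF order_refl] have "norm (integral {0..t} c - (\<Sum>i<k. h *\<^sub>R c (real i * h))) \<le> t * (e / (2 * t))"
        unfolding kh .
      also have "\<dots> < e" using e t by simp
      finally show ?case unfolding h_def by (simp add: dist_norm norm_minus_commute)
    qed
  qed
qed simp

lemma exp_integrating_factor:
  fixes e e' :: "real \<Rightarrow> real"
  assumes t: "t \<ge> 0" and e: "\<And>s. s \<in> {0..t} \<Longrightarrow> (e has_real_derivative e' s) (at s within {0..t})"
    and e': "continuous_on {0..t} e'" and e0: "e 0 = 0"
  shows "(\<lambda>k. \<Sum>i<k. (t / real k) * (exp (- \<gamma> * (real i * (t / real k))) *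
      (e' (real i * (t / real k)) - \<gamma> * e (real i * (t / real k))))) \<longlonglongrightarrow> exp (- \<gamma> * t) * e t"
proof -
  have D: "((\<lambda>s. exp (- \<gamma> * s) * e s) has_vector_derivative exp (- \<gamma> * s) * (e' s - \<gamma> * e s)) (at s within {0..t})"
    if "s \<in> {0..t}" for s
    unfolding has_real_derivative_iff_has_vector_derivative[symmetric]
    using e[OF that] by (auto intro!: derivative_eq_intros simp: algebra_simps)
  have "integral {0..t} (\<lambda>s. exp (- \<gamma> * s) * (e' s - \<gamma> * e s)) = exp (- \<gamma> * t) * e t"
    using fundamental_theorem_of_calculus[OF t D] e0 by (simp add: integral_unique)
  moreover have "continuous_on {0..t} (\<lambda>s. exp (- \<gamma> * s) * (e' s - \<gamma> * e s))"
    by (intro continuous_intros e' DERIV_continuous_on[OF e])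
  ultimately show ?thesis using left_riemann_sums[OF t] by fastforce
qed

text \<open>After multiplication with the integrating factor, \<open>e t\<close> is the integral of a continuous function of time,
hence the limit of left Riemann sums, and these are bounded by the sums with \<open>G\<close>, whose
expectations are bounded by the sums with \<open>a\<close>. The latter are the Riemann sums of the solution \<open>u\<close> of
the comparison equation. Fatou's lemma then takes the place of Fubini's theorem, so that measurability
at fixed times is enough; the finiteness of the expectation of \<open>e t\<close> is part of the conclusion.\<close>

lemma gronwall_in_expectation:
  fixes e e' G :: "real \<Rightarrow> 'w \<Rightarrow> real"
  assumes t: "t \<ge> 0"
    and path: "AE \<omega> in M. (\<forall>s\<in>{0..t}. ((\<lambda>s. e s \<omega>) has_real_derivative e' s \<omega>) (at s within {0..t}) \<and>
        e' s \<omega> \<le> \<gamma> * e s \<omega> + G s \<omega>) \<and> continuous_on {0..t} (\<lambda>s. e' s \<omega>) \<and> e 0 \<omega> = 0"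
    and G: "\<And>s. s \<in> {0..t} \<Longrightarrow> G s \<in> borel_measurable M" "\<And>s \<omega>. s \<in> {0..t} \<Longrightarrow> 0 \<le> G s \<omega>"
    and Ga: "\<And>s. s \<in> {0..t} \<Longrightarrow> (\<integral>\<^sup>+\<omega>. ennreal (G s \<omega>) \<partial>M) \<le> ennreal (a s)"
    and u: "\<And>s. s \<in> {0..t} \<Longrightarrow> (u has_real_derivative \<gamma> * u s + a s) (at s within {0..t})" "u 0 = 0"
    and a: "continuous_on {0..t} a" "\<And>s. s \<in> {0..t} \<Longrightarrow> 0 \<le> a s"
  shows "(\<integral>\<^sup>+\<omega>. ennreal (e t \<omega>) \<partial>M) \<le> ennreal (u t)"
proof -
  let ?s = "\<lambda>k i. real i * (t / real k)" and ?h = "\<lambda>k. t / real k"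
  have pt: "?s k i \<in> {0..t}" if "i < k" for k i
  proof -
    have "real i \<le> real k" using that by simp
    from mult_right_mono[OF this, of "?h k"] show ?thesis using t that by simp
  qed
  define w where "w k i = exp (\<gamma> * t) * (?h k * exp (- \<gamma> * ?s k i))" for k i
  have w: "0 \<le> w k i" for k i using t by (simp add: w_def)
  let ?g = "\<lambda>k \<omega>. \<Sum>i<k. w k i * G (?s k i) \<omega>"
  let ?v = "\<lambda>k. \<Sum>i<k. w k i * a (?s k i)"
  have factor: "(\<lambda>k. \<Sum>i<k. w k i * (f' (?s k i) - \<gamma> * f (?s k i))) \<longlonglongrightarrow> f t"
    if "\<And>s. s \<in> {0..t} \<Longrightarrow> (f has_real_derivative f' s) (at s within {0..t})"
      "continuous_on {0..t} f'" "f 0 = 0" for f f'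
  proof -
    have "(\<lambda>k. exp (\<gamma> * t) * (\<Sum>i<k. ?h k * (exp (- \<gamma> * ?s k i) * (f' (?s k i) - \<gamma> * f (?s k i)))))
        \<longlonglongrightarrow> exp (\<gamma> * t) * (exp (- \<gamma> * t) * f t)"
      by (intro tendsto_mult tendsto_const exp_integrating_factor t that)
    moreover have "exp (\<gamma> * t) * (exp (- \<gamma> * t) * f t) = f t"
      by (simp add: mult.assoc[symmetric] exp_add[symmetric])
    ultimately show ?thesis by (simp only: sum_distrib_left w_def mult.assoc)
  qed
  show ?thesis
  proof (rule nn_integral_fatou_le[where g = ?g and u = ?v])
    show "\<forall>\<^sub>F k in sequentially. ?g k \<in> borel_measurable M \<and> (\<integral>\<^sup>+\<omega>. ennreal (?g k \<omega>) \<partial>M) \<le> ennreal (?v k)"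
    proof (intro always_eventually allI conjI)
      fix k
      show "?g k \<in> borel_measurable M"
        using G(1)[OF pt] by (intro borel_measurable_sum borel_measurable_times borel_measurable_const) auto
      have "ennreal (?g k \<omega>) = (\<Sum>i<k. ennreal (w k i) * ennreal (G (?s k i) \<omega>))" for \<omega>
      proof -
        have "(\<Sum>i<k. ennreal (w k i * G (?s k i) \<omega>)) = ennreal (?g k \<omega>)"
          using G(2)[OF pt] w by (intro sum_ennreal mult_nonneg_nonneg) auto
        then show ?thesis using w by (simp only: ennreal_mult')
      qed
      then have "(\<integral>\<^sup>+\<omega>. ennreal (?g k \<omega>) \<partial>M) = (\<integral>\<^sup>+\<omega>. (\<Sum>i<k. ennreal (w k i) * ennreal (G (?s k i) \<omega>)) \<partial>M)"
        by simp
      also have "\<dots> = (\<Sum>i<k. \<integral>\<^sup>+\<omega>. ennreal (w k i) * ennreal (G (?s k i) \<omega>) \<partial>M)"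
        using G(1)[OF pt] by (intro nn_integral_sum) simp
      also have "\<dots> = (\<Sum>i<k. ennreal (w k i) * (\<integral>\<^sup>+\<omega>. ennreal (G (?s k i) \<omega>) \<partial>M))"
        using G(1)[OF pt] by (intro sum.cong refl nn_integral_cmult) simp
      also have "\<dots> \<le> (\<Sum>i<k. ennreal (w k i) * ennreal (a (?s k i)))"
        using Ga[OF pt] by (intro sum_mono mult_left_mono) auto
      also have "\<dots> = (\<Sum>i<k. ennreal (w k i * a (?s k i)))" using w by (simp only: ennreal_mult')
      also have "\<dots> = ennreal (?v k)"
        using a(2)[OF pt] w by (intro sum_ennreal mult_nonneg_nonneg) auto
      finally show "(\<integral>\<^sup>+\<omega>. ennreal (?g k \<omega>) \<partial>M) \<le> ennreal (?v k)" .
    qed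
    have "continuous_on {0..t} (\<lambda>s. \<gamma> * u s + a s)"
      by (intro continuous_intros a(1) DERIV_continuous_on[OF u(1)])
    from factor[OF u(1) this u(2)] show "?v \<longlonglongrightarrow> u t" by simp
    show "AE \<omega> in M. \<exists>h. h \<longlonglongrightarrow> e t \<omega> \<and> (\<forall>k. h k \<le> ?g k \<omega>)"
      using path
    proof eventually_elim
      case (elim \<omega>)
      let ?f = "\<lambda>k. \<Sum>i<k. w k i * (e' (?s k i) \<omega> - \<gamma> * e (?s k i) \<omega>)"
      have "?f \<longlonglongrightarrow> e t \<omega>"
        by (rule factor[of "\<lambda>s. e s \<omega>" "\<lambda>s. e' s \<omega>"]) (use elim in auto)
      moreover have "?f k \<le> ?g k \<omega>" for k
      proof (intro sum_mono mult_left_mono w)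
        fix i assume "i \<in> {..<k}"
        then have "?s k i \<in> {0..t}" using pt by simp
        then have "e' (?s k i) \<omega> \<le> \<gamma> * e (?s k i) \<omega> + G (?s k i) \<omega>" using elim by blast
        then show "e' (?s k i) \<omega> - \<gamma> * e (?s k i) \<omega> \<le> G (?s k i) \<omega>" by linarith
      qed
      ultimately show ?case by blast
    qed
  qed
qed

section \<open>Empirical measures and the mean field drift\<close>

lemma empirical_measurable: "(x :: nat \<Rightarrow> real ^ 'd) \<in> measurable (uniform_count_measure {1..n}) borel"
  by (simp add: measurable_def space_uniform_count_measure sets_uniform_count_measure)

lemma integral_empirical_measure:
  fixes f :: "real ^ 'd \<Rightarrow> real"
  assumes "f \<in> borel_measurable borel"
  shows "(\<integral>y. f y \<partial>empirical_measure n x) = (\<Sum>i=1..n. f (x i)) / real n"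
  unfolding empirical_measure_def
  by (subst integral_distr[OF empirical_measurable assms]) (simp add: integral_uniform_count_measure)

lemma empirical_measure_in_Pp:
  fixes x :: "nat \<Rightarrow> real ^ 'd"
  assumes "n \<ge> 1"
  shows "empirical_measure n x \<in> Pp p"
proof -
  have "prob_space (uniform_count_measure {1..n})"
    using assms by (intro prob_space_uniform_count_measure) auto
  then have "prob_space (empirical_measure n x)"
    unfolding empirical_measure_def by (rule prob_space.prob_space_distr) (rule empirical_measurable)
  moreover have "integrable (empirical_measure n x) (\<lambda>y. norm y powr p)"
    unfolding empirical_measure_def
    by (subst integrable_distr_eq[OF empirical_measurable])
      (auto simp: uniform_count_measure_def integrable_point_measure_finite)
  ultimately show ?thesis by (simp add: Pp_def empirical_measure_def)
qed

text \<open>The assumptions on the functional. Below, \<open>L\<close> and \<open>S\<close> denote the suprema of the norms of the second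
intrinsic derivative and of the intrinsic derivative at the origin.\<close>

locale mean_field =
  fixes p :: real and H :: "(real ^ 'd) measure \<Rightarrow> real" and dH d2H and lam :: real
  assumes flat: "flat_derivative p H dH"
    and flat2: "second_flat_derivative p dH d2H"
    and dH_C2: "\<And>\<mu>. \<mu> \<in> Pp p \<Longrightarrow> C2 (dH \<mu>)"
    and d2H_C2: "\<And>\<mu>. \<mu> \<in> Pp p \<Longrightarrow> C2 (\<lambda>(x, y). d2H \<mu> x y)"
    and bdd0: "bdd_above (grad0_norms p dH)"
    and lam: "lam > 0"
    and mono: "\<And>\<mu> x y. \<mu> \<in> Pp p \<Longrightarrow>
      inner (intrinsic_deriv dH \<mu> x - intrinsic_deriv dH \<mu> y) (x - y) \<ge> lam * (norm (x - y))\<^sup>2"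
    and bdd2: "bdd_above (deriv2_opnorms p d2H)"
begin

definition L :: real where "L = Sup (deriv2_opnorms p d2H)"

definition S :: real where "S = Sup (grad0_norms p dH)"

lemma norm_grad0_le: "\<mu> \<in> Pp p \<Longrightarrow> norm (intrinsic_deriv dH \<mu> 0) \<le> S"
  unfolding S_def by (intro cSup_upper[OF _ bdd0]) (simp add: grad0_norms_def)

lemma L_nonneg:
  fixes \<mu> :: "(real ^ 'd) measure"
  assumes "\<mu> \<in> Pp p"
  shows "0 \<le> L"
proof -
  have "0 \<le> onorm ((*v) (intrinsic_deriv2 d2H \<mu> 0 0))"
    by (intro onorm_pos_le matrix_vector_mul_bounded_linear)
  also have "\<dots> \<le> L"
    unfolding L_def using assms by (intro cSup_upper[OF _ bdd2]) (auto simp: deriv2_opnorms_def image_iff)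
  finally show ?thesis .
qed

lemma dH_has_derivative:
  "\<mu> \<in> Pp p \<Longrightarrow> (dH \<mu> has_derivative (\<lambda>h. intrinsic_deriv dH \<mu> x \<bullet> h)) (at x)"
  unfolding intrinsic_deriv_def by (rule C2_has_derivative_gradient[OF dH_C2])

lemma mono_nonneg:
  assumes "\<mu> \<in> Pp p"
  shows "inner (intrinsic_deriv dH \<mu> x - intrinsic_deriv dH \<mu> y) (x - y) \<ge> 0"
  using mono[OF assms, of x y] lam zero_le_power2[of "norm (x - y)"]
  by (meson mult_nonneg_nonneg less_imp_le order_trans)

text \<open>The continuity of the drift along a curve of measures comes from the continuity of the flat derivative
and the convexity in space.\<close>

lemma drift_continuous:
  fixes m :: "'s::topological_space \<Rightarrow> (real ^ 'd) measure"
  assumes m: "\<And>s. s \<in> I \<Longrightarrow> m s \<in> Pp p"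
    and cont: "\<And>f :: (real ^ 'd) \<Rightarrow>\<^sub>C real. continuous_on I (\<lambda>s. \<integral>x. f x \<partial>m s)"
  shows "continuous_on (I \<times> UNIV) (\<lambda>(s, x). intrinsic_deriv dH (m s) x)"
  by (rule convex_gradient_jointly_continuous[OF
        flat_derivative_continuous_on[OF flat continuous_map_weak_topology[OF m cont]]
        dH_has_derivative[OF m] mono_nonneg[OF m]])

lemma drift_lipschitz_in_measure:
  assumes "\<mu>1 \<in> Pp p" "\<mu>0 \<in> Pp p"
    and "\<And>K g. 0 \<le> K \<Longrightarrow> (\<And>y y'. \<bar>g y - g y'\<bar> \<le> K * norm (y - y')) \<Longrightarrow>
      \<bar>(\<integral>y. g y \<partial>\<mu>1) - (\<integral>y. g y \<partial>\<mu>0)\<bar> \<le> K * w"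
  shows "norm (intrinsic_deriv dH \<mu>1 x - intrinsic_deriv dH \<mu>0 x) \<le> L * w"
  unfolding L_def by (rule intrinsic_deriv_lipschitz_in_measure[OF flat2 dH_C2 d2H_C2 bdd2 assms])

end

section \<open>The mean field process\<close>

locale mean_field_process = mean_field p H dH d2H lam
  for p :: real and H :: "(real ^ 'd) measure \<Rightarrow> real" and dH d2H lam +
  fixes M :: "'w measure" and \<F> W X
  assumes filtered: "filtered_prob_space M \<F>"
    and mfl: "mean_field_langevin p dH M \<F> W X"
    and law0: "law M X 0 \<in> Pp 2"
begin

sublocale prob_space M
  using filtered by (simp add: filtered_prob_space_def)

abbreviation "\<mu> \<equiv> law M X"

lemma W: "brownian_motion M \<F> W"
  and law_in_Pp: "0 \<le> t \<Longrightarrow> \<mu> t \<in> Pp p"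
  and X_solution: "langevin_solution M \<F> W (\<lambda>s \<omega>. intrinsic_deriv dH (\<mu> s) (X s \<omega>)) X"
  using mfl by (auto simp: mean_field_langevin_def)

lemma L_ge_0: "0 \<le> L"
  by (rule L_nonneg[OF law_in_Pp[OF order_refl]])

lemma S_ge_0: "0 \<le> S"
  by (rule order_trans[OF norm_ge_zero norm_grad0_le[OF law_in_Pp[OF order_refl]]])

lemma X_measurable: "0 \<le> t \<Longrightarrow> X t \<in> borel_measurable M"
  using X_solution filtration_measurable(1)[OF filtered W]
  unfolding langevin_solution_def adapted_continuous_def by blast

lemma integral_law: "0 \<le> t \<Longrightarrow> f \<in> borel_measurable borel \<Longrightarrow> (\<integral>x. f x \<partial>\<mu> t) = (\<integral>\<omega>. f (X t \<omega>) \<partial>M)"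
  for f :: "real ^ 'd \<Rightarrow> real"
  unfolding law_def by (rule integral_distr[OF X_measurable])

lemma integrable_law: "0 \<le> t \<Longrightarrow> f \<in> borel_measurable borel \<Longrightarrow> integrable (\<mu> t) f \<longleftrightarrow> integrable M (\<lambda>\<omega>. f (X t \<omega>))"
  for f :: "real ^ 'd \<Rightarrow> real"
  unfolding law_def by (rule integrable_distr_eq[OF X_measurable])

lemma law_weakly_continuous:
  fixes f :: "(real ^ 'd) \<Rightarrow>\<^sub>C real"
  shows "continuous_on {0..} (\<lambda>s. \<integral>x. f x \<partial>\<mu> s)"
proof -
  have fm: "apply_bcontfun f \<in> borel_measurable borel"
    by (intro borel_measurable_continuous_onI continuous_on_apply_bcontfun)
  have "continuous_on {0..} (\<lambda>s. \<integral>\<omega>. f (X s \<omega>) \<partial>M)"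
    unfolding continuous_on_sequentially
  proof (intro allI ballI impI)
    fix s and a :: real assume s: "a \<in> {0..}" "(\<forall>n. s n \<in> {0..}) \<and> s \<longlonglongrightarrow> a"
    show "((\<lambda>s. \<integral>\<omega>. f (X s \<omega>) \<partial>M) \<circ> s) \<longlonglongrightarrow> (\<integral>\<omega>. f (X a \<omega>) \<partial>M)"
      unfolding comp_def
    proof (rule integral_dominated_convergence)
      show "integrable M (\<lambda>_. norm f)" by simp
      show "(\<lambda>\<omega>. f (X a \<omega>)) \<in> borel_measurable M"
        using s by (intro measurable_compose[OF X_measurable fm]) auto
      show "(\<lambda>\<omega>. f (X (s n) \<omega>)) \<in> borel_measurable M" for n
        using s by (intro measurable_compose[OF X_measurable fm]) auto
      show "AE \<omega> in M. norm (f (X (s n) \<omega>)) \<le> norm f" for n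
        by (intro AE_I2 norm_bounded)
      have "AE \<omega> in M. continuous_on {0..} (\<lambda>t. X t \<omega>)"
        using X_solution by (simp add: langevin_solution_def adapted_continuous_def)
      then show "AE \<omega> in M. (\<lambda>n. f (X (s n) \<omega>)) \<longlonglongrightarrow> f (X a \<omega>)"
      proof eventually_elim
        case (elim \<omega>)
        then have lim: "(\<lambda>n. X (s n) \<omega>) \<longlonglongrightarrow> X a \<omega>"
          using s unfolding continuous_on_sequentially comp_def by blast
        have "isCont f (X a \<omega>)"
          by (rule continuous_on_interior[OF continuous_on_apply_bcontfun[of UNIV f]]) simp
        from isCont_tendsto_compose[OF this lim] show ?case .
      qed
    qed
  qed
  then show ?thesis by (rule continuous_on_cong[THEN iffD1, rotated 2]) (auto simp: integral_law[OF _ fm])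
qed

lemma mean_drift_continuous: "continuous_on ({0..} \<times> UNIV) (\<lambda>(s, x). intrinsic_deriv dH (\<mu> s) x)"
  by (rule drift_continuous[OF _ law_weakly_continuous]) (simp add: law_in_Pp)

abbreviation "moment_bound \<equiv> gronwall_bound (2 * real CARD('d) + 2 * S) (- 2 * (lam - S)) (second_moment (\<mu> 0))"

lemma powr_two: "norm x powr 2 = (norm x)\<^sup>2"
  by (simp add: powr_numeral)

lemma second_moment_bound:
  assumes t: "0 \<le> t"
  shows "\<mu> t \<in> Pp 2" "integrable (\<mu> t) (\<lambda>x. (norm x)\<^sup>2)" "second_moment (\<mu> t) \<le> moment_bound t"
proof -
  have sq: "(\<lambda>x :: real ^ 'd. (norm x)\<^sup>2) \<in> borel_measurable borel" by simp
  have "integrable M (\<lambda>\<omega>. (norm (X 0 \<omega>))\<^sup>2)"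
    using PpD(3)[OF law0] integrable_law[OF order_refl sq] by (simp add: powr_two)
  note mom = langevin_second_moment[where \<phi> = "\<lambda>s. dH (\<mu> s)" and S = S and lam = lam,
      OF filtered W X_solution mean_drift_continuous dH_has_derivative[OF law_in_Pp] mono[OF law_in_Pp] lam
        norm_grad0_le[OF law_in_Pp] this t]
  show i: "integrable (\<mu> t) (\<lambda>x. (norm x)\<^sup>2)"
    using mom integrable_law[OF t sq] by simp
  show "second_moment (\<mu> t) \<le> moment_bound t"
    using mom unfolding second_moment_def by (simp add: integral_law[OF t sq] integral_law[OF order_refl sq])
  show "\<mu> t \<in> Pp 2"
    using i PpD[OF law_in_Pp[OF t]] by (simp add: Pp_def powr_two)
qed

lemma second_moment_nonneg: "0 \<le> second_moment \<nu>"
  unfolding second_moment_def by (rule Bochner_Integration.integral_nonneg) simp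

lemma moment_bound_bounded: "\<exists>K. \<forall>t\<in>{0..T}. moment_bound t \<le> K"
proof -
  have "continuous_on {0..T} moment_bound"
    unfolding gronwall_bound_def by (cases "- 2 * (lam - S) = 0") (auto intro!: continuous_intros)
  then have "bounded (moment_bound ` {0..T})"
    by (intro compact_imp_bounded compact_continuous_image) auto
  then have "bdd_above (moment_bound ` {0..T})" by (rule bounded_imp_bdd_above)
  then show ?thesis by (auto simp: bdd_above_def)
qed

lemma bdd_moment_bound: "bdd_above (moment_bound ` {0..T})"
  using moment_bound_bounded[of T] by (auto simp: bdd_above_def)

lemma bdd_second_moment: "bdd_above ((\<lambda>t. second_moment (\<mu> t)) ` {0..T})"
proof -
  obtain K where "\<And>t. t \<in> {0..T} \<Longrightarrow> moment_bound t \<le> K" using moment_bound_bounded by blast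
  then have "second_moment (\<mu> t) \<le> K" if "t \<in> {0..T}" for t
    using second_moment_bound(3)[of t] that order_trans by fastforce
  then show ?thesis by (intro bdd_aboveI2[of _ _ K])
qed

lemma second_moment_le_SUP: "t \<in> {0..T} \<Longrightarrow> second_moment (\<mu> t) \<le> (SUP t\<in>{0..T}. second_moment (\<mu> t))"
  by (rule cSUP_upper[OF _ bdd_second_moment])

lemma SUP_second_moment_nonneg: "0 \<le> T \<Longrightarrow> 0 \<le> (SUP t\<in>{0..T}. second_moment (\<mu> t))"
  using second_moment_le_SUP[of 0 T] second_moment_nonneg[of "\<mu> 0"] by auto

text \<open>The law of an increment has a density, hence no atoms.\<close>

lemma brownian_not_constant:
  assumes T: "0 < T" and c: "AE \<omega> in M. W T \<omega> = c"
  shows False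
proof -
  let ?D = "\<lambda>\<omega>. W T \<omega> - W 0 \<omega>"
  define g where "g x = (\<Prod>k\<in>UNIV. normal_density 0 (sqrt (T - 0)) (x $ k))" for x :: "real ^ 'd"
  have g: "distributed M lborel ?D (\<lambda>x. ennreal (g x))"
    using conjunct2[OF conjunct2[OF W[unfolded brownian_motion_def]], rule_format, OF order_refl T]
    unfolding g_def by (rule conjunct2)
  have Dm: "?D \<in> measurable M lborel" using distributed_measurable[OF g] .
  have "AE \<omega> in M. W 0 \<omega> = 0" using W by (simp add: brownian_motion_def)
  with c have "AE \<omega> in M. ?D \<omega> = c" by eventually_elim simp
  then have "AE x in distr M lborel ?D. x = c"
    by (subst AE_distr_iff[OF Dm]) auto
  then have "AE x in density lborel (\<lambda>x. ennreal (g x)). x = c"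
    by (simp only: distributed_distr_eq_density[OF g])
  then have "AE x in lborel. 0 < ennreal (g x) \<longrightarrow> x = c"
    by (subst (asm) AE_density[OF distributed_borel_measurable[OF g]])
  with AE_lborel_singleton[of c] have "AE x in lborel. ennreal (g x) = 0"
    by eventually_elim (auto simp: zero_less_iff_neq_zero)
  then have "(\<integral>\<^sup>+x. ennreal (g x) \<partial>lborel) = 0"
    by (subst nn_integral_0_iff_AE[OF distributed_borel_measurable[OF g]]) simp
  moreover have "emeasure (distr M lborel ?D) UNIV = 1"
    using emeasure_space_1 by (simp add: emeasure_distr[OF Dm])
  then have "(\<integral>\<^sup>+x. ennreal (g x) \<partial>lborel) = 1"
    unfolding distributed_distr_eq_density[OF g]
    by (simp add: emeasure_density[OF distributed_borel_measurable[OF g]])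
  ultimately show False by simp
qed

text \<open>Otherwise the process would vanish at all points of the time grids, so that the integral of the drift, as
a limit of Riemann sums, would be the same for almost all samples, and with it the Brownian motion.\<close>

lemma SUP_second_moment_pos:
  assumes T: "0 < T"
  shows "0 < (SUP t\<in>{0..T}. second_moment (\<mu> t))"
proof (rule ccontr)
  assume "\<not> ?thesis"
  then have z: "second_moment (\<mu> t) = 0" if "t \<in> {0..T}" for t
    using second_moment_le_SUP[OF that] second_moment_nonneg[of "\<mu> t"] by linarith
  have X0: "AE \<omega> in M. X t \<omega> = 0" if t: "t \<in> {0..T}" for t
  proof -
    have t0: "0 \<le> t" using t by simp
    have sq: "(\<lambda>x :: real ^ 'd. (norm x)\<^sup>2) \<in> borel_measurable borel" by simp
    have "(\<integral>\<omega>. (norm (X t \<omega>))\<^sup>2 \<partial>M) = 0"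
      using z[OF t] unfolding second_moment_def integral_law[OF t0 sq] .
    moreover have "integrable M (\<lambda>\<omega>. (norm (X t \<omega>))\<^sup>2)"
      using second_moment_bound(2)[OF t0] integrable_law[OF t0 sq] by simp
    ultimately have "AE \<omega> in M. (norm (X t \<omega>))\<^sup>2 = 0"
      by (subst (asm) integral_nonneg_eq_0_iff_AE) auto
    then show ?thesis by simp
  qed
  let ?b = "\<lambda>s x. intrinsic_deriv dH (\<mu> s) x"
  have "AE \<omega> in M. continuous_on {0..} (\<lambda>s. X s \<omega>)"
    using X_solution by (simp add: langevin_solution_def adapted_continuous_def)
  then have "AE \<omega> in M. continuous_on {0..} (\<lambda>s. ?b s (X s \<omega>))"
  proof eventually_elim
    case (elim \<omega>)
    then have "continuous_on {0..} (\<lambda>s. (s, X s \<omega>))" by (intro continuous_intros)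
    from continuous_on_compose2[OF mean_drift_continuous this image_subsetI] show ?case by simp
  qed
  note form = langevin_solution_integral_form[OF X_solution this]
  let ?r = "\<lambda>k. \<Sum>i<k. (T / real k) *\<^sub>R ?b (real i * (T / real k)) 0"
  have pt: "real i * (T / real k) \<in> {0..T}" if "i < k" for i k
  proof -
    have "real i \<le> real k" using that by simp
    from mult_right_mono[OF this, of "T / real k"] show ?thesis using T that by simp
  qed
  have "AE \<omega> in M. \<forall>k. \<forall>i\<in>{..<k}. X (real i * (T / real k)) \<omega> = 0"
    by (intro AE_all_countable[THEN iffD2] allI AE_ball_countable[THEN iffD2] ballI X0 pt) auto
  moreover have "AE \<omega> in M. X 0 \<omega> = 0" "AE \<omega> in M. X T \<omega> = 0" using T by (auto intro!: X0)
  ultimately have "AE \<omega> in M. W T \<omega> = (1 / sqrt 2) *\<^sub>R lim ?r"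
    using form
  proof eventually_elim
    case (elim \<omega>)
    have "continuous_on {0..T} (\<lambda>s. ?b s (X s \<omega>))"
      by (rule continuous_on_subset[OF conjunct1[OF elim(4)]]) auto
    from left_riemann_sums[OF less_imp_le[OF T] this]
    have "?r \<longlonglongrightarrow> integral {0..T} (\<lambda>s. ?b s (X s \<omega>))"
      using elim(1) by simp
    then have "lim ?r = integral {0..T} (\<lambda>s. ?b s (X s \<omega>))" by (rule limI)
    moreover have "X T \<omega> = X 0 \<omega> + sqrt 2 *\<^sub>R W T \<omega> - integral {0..T} (\<lambda>s. ?b s (X s \<omega>))"
      using elim(4) T less_imp_le by blast
    ultimately have "sqrt 2 *\<^sub>R W T \<omega> = lim ?r" using elim(2,3) by simp
    then have "(1 / sqrt 2) *\<^sub>R lim ?r = ((1 / sqrt 2) * sqrt 2) *\<^sub>R W T \<omega>" by (metis scaleR_scaleR)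
    then show ?case by simp
  qed
  then show False by (rule brownian_not_constant[OF T])
qed

end

section \<open>Bounds that are uniform in time\<close>

text \<open>The solution of \<open>u' = \<beta> u + \<alpha>\<close> with \<open>u 0 = 0\<close>. Both the chaos bound and the inhomogeneous part of the
Gronwall bound are of this form.\<close>

definition growth :: "real \<Rightarrow> real \<Rightarrow> real \<Rightarrow> real" where
  "growth \<beta> \<alpha> t = (if \<beta> \<noteq> 0 then \<alpha> / \<beta> * (exp (\<beta> * t) - 1) else \<alpha> * t)"

lemma chaos_bound_growth: "chaos_bound \<beta> L C m d n T t = growth \<beta> (alpha1 L C m d n T) t"
  by (simp add: chaos_bound_def growth_def)

lemma gronwall_bound_growth: "gronwall_bound \<alpha> \<beta> m t = exp (\<beta> * t) * m + growth \<beta> \<alpha> t"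
  by (simp add: gronwall_bound_def growth_def)

lemma growth_0 [simp]: "growth \<beta> \<alpha> 0 = 0"
  by (simp add: growth_def)

lemma growth_ode: "(growth \<beta> \<alpha> has_real_derivative \<beta> * growth \<beta> \<alpha> t + \<alpha>) (at t within A)"
proof (cases "\<beta> = 0")
  case True
  then have "growth \<beta> \<alpha> = (\<lambda>t. \<alpha> * t)" by (simp add: growth_def fun_eq_iff)
  then show ?thesis using True by (auto intro!: derivative_eq_intros)
next
  case False
  then have "growth \<beta> \<alpha> = (\<lambda>t. \<alpha> / \<beta> * (exp (\<beta> * t) - 1))" by (simp add: growth_def fun_eq_iff)
  then show ?thesis using False by (auto intro!: derivative_eq_intros simp: field_simps)
qed

lemma growth_cmult: "growth \<beta> \<alpha> t = \<alpha> * growth \<beta> 1 t"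
  by (simp add: growth_def)

lemma growth_unit_ge:
  assumes "\<beta> \<ge> 0" "t \<ge> 0"
  shows "t \<le> growth \<beta> 1 t"
proof (cases "\<beta> = 0")
  case False
  have "1 + \<beta> * t \<le> exp (\<beta> * t)" by (rule exp_ge_add_one_self)
  then have "\<beta> * t \<le> exp (\<beta> * t) - 1" by linarith
  then show ?thesis using False assms by (simp add: growth_def le_divide_eq mult.commute)
qed (simp add: growth_def)

lemma growth_unit_nonneg:
  assumes "t \<ge> 0"
  shows "0 \<le> growth \<beta> 1 t"
proof (cases "\<beta> \<ge> 0")
  case True
  then show ?thesis using growth_unit_ge[of \<beta> t] assms by linarith
next
  case False
  then have "exp (\<beta> * t) \<le> 1" using assms by (simp add: mult_nonpos_nonneg)
  then show ?thesis using False by (simp add: growth_def divide_nonpos_neg)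
qed

lemma growth_nonneg: "t \<ge> 0 \<Longrightarrow> \<alpha> \<ge> 0 \<Longrightarrow> 0 \<le> growth \<beta> \<alpha> t"
  unfolding growth_cmult[of \<beta> \<alpha>] by (intro mult_nonneg_nonneg growth_unit_nonneg)

lemma growth_le:
  assumes "\<beta> < 0" "0 \<le> \<alpha>"
  shows "growth \<beta> \<alpha> t \<le> \<alpha> / (- \<beta>)"
proof -
  have "growth \<beta> \<alpha> t = \<alpha> / (- \<beta>) * (1 - exp (\<beta> * t))" using assms by (simp add: growth_def field_simps)
  also have "\<dots> \<le> \<alpha> / (- \<beta>) * 1" using assms by (intro mult_left_mono) (auto simp: divide_nonneg_neg)
  finally show ?thesis by simp
qed

text \<open>For \<open>\<beta> \<ge> 0\<close> the function grows at least linearly, at a rate that is bounded from below.\<close>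

lemma uniform_in_time_growth_neg:
  assumes unif: "uniform_in_time (\<lambda>T. growth \<beta> (a T))"
    and \<kappa>: "\<kappa> > 0" "\<And>T. T \<ge> 1 \<Longrightarrow> \<kappa> \<le> a T"
  shows "\<beta> < 0"
proof (rule ccontr)
  assume "\<not> \<beta> < 0"
  obtain K where K: "\<And>T t. 0 \<le> T \<Longrightarrow> t \<in> {0..T} \<Longrightarrow> growth \<beta> (a T) t \<le> K"
    using unif unfolding uniform_in_time_def by blast
  define T where "T = max 1 (\<bar>K\<bar> / \<kappa> + 1)"
  have T: "T \<ge> 1" "T > \<bar>K\<bar> / \<kappa>" by (auto simp: T_def)
  have "K < \<kappa> * T" using T(2) \<kappa>(1) by (simp add: divide_less_eq mult.commute)
  also have "\<dots> \<le> a T * growth \<beta> 1 T"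
    using T(1) \<kappa>(1) \<kappa>(2)[OF T(1)] growth_unit_ge[of \<beta> T] \<open>\<not> \<beta> < 0\<close> by (intro mult_mono) linarith+
  also have "\<dots> = growth \<beta> (a T) T" by (simp only: growth_cmult[of \<beta> "a T"])
  also have "\<dots> \<le> K" using T(1) by (intro K) auto
  finally show False by simp
qed

text \<open>Evaluated at the fixed time 1, the bound is a positive multiple of \<open>a T\<close> for all \<open>T \<ge> 1\<close>.\<close>

lemma uniform_in_time_growth_bounded:
  assumes unif: "uniform_in_time (\<lambda>T. growth \<beta> (a T))"
    and \<beta>: "\<beta> < 0" and a: "\<And>T. T \<ge> 1 \<Longrightarrow> 0 \<le> a T"
  shows "\<exists>K. \<forall>T\<ge>1. a T \<le> K"
proof -
  obtain K where K: "\<And>T t. 0 \<le> T \<Longrightarrow> t \<in> {0..T} \<Longrightarrow> growth \<beta> (a T) t \<le> K"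
    using unif unfolding uniform_in_time_def by blast
  have g: "growth \<beta> 1 1 > 0" using \<beta> by (simp add: growth_def divide_neg_neg)
  have "a T \<le> K / growth \<beta> 1 1" if "T \<ge> 1" for T
    using K[of T 1] that g unfolding growth_cmult[of \<beta> "a T"] by (simp add: le_divide_eq)
  then show ?thesis by blast
qed

section \<open>Synchronous coupling\<close>

context mean_field
begin

text \<open>The empirical measure of \<open>x\<close> is compared with \<open>\<nu>\<close> through the empirical measure of \<open>y\<close>. Functions with
Lipschitz constant \<open>K > 0\<close> are scaled to Lipschitz constant 1.\<close>

lemma empirical_drift_deviation:
  fixes x y :: "nat \<Rightarrow> real ^ 'd"
  assumes n: "n \<ge> 1" and \<nu>: "\<nu> \<in> Pp p"
    and D: "\<And>f. (\<And>a b. \<bar>f a - f b\<bar> \<le> norm (a - b)) \<Longrightarrow> \<bar>(\<Sum>i=1..n. f (y i)) / real n - (\<integral>z. f z \<partial>\<nu>)\<bar> \<le> D"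
  shows "norm (intrinsic_deriv dH (empirical_measure n x) z - intrinsic_deriv dH \<nu> z)
    \<le> L * ((\<Sum>i=1..n. norm (x i - y i)) / real n + D)"
proof (rule drift_lipschitz_in_measure[OF empirical_measure_in_Pp[OF n] \<nu>])
  fix K :: real and g :: "real ^ 'd \<Rightarrow> real"
  assume K: "0 \<le> K" and g: "\<And>a b. \<bar>g a - g b\<bar> \<le> K * norm (a - b)"
  interpret nu: prob_space \<nu> using PpD[OF \<nu>] by simp
  have "continuous_on UNIV g"
    using K g by (intro lipschitz_on_continuous_on[of K]) (auto simp: lipschitz_on_def dist_norm)
  then have gm: "g \<in> borel_measurable borel" by (rule borel_measurable_continuous_onI)
  have 1: "\<bar>(\<Sum>i=1..n. g (x i)) / real n - (\<Sum>i=1..n. g (y i)) / real n\<bar> \<le> K * ((\<Sum>i=1..n. norm (x i - y i)) / real n)"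
  proof -
    have "\<bar>\<Sum>i=1..n. g (x i) - g (y i)\<bar> \<le> (\<Sum>i=1..n. K * norm (x i - y i))"
      using g by (intro order_trans[OF sum_abs] sum_mono)
    then have "\<bar>(\<Sum>i=1..n. g (x i) - g (y i)) / real n\<bar> \<le> (\<Sum>i=1..n. K * norm (x i - y i)) / real n"
      by (simp add: divide_right_mono)
    then show ?thesis by (simp add: sum_subtractf diff_divide_distrib sum_distrib_left)
  qed
  have 2: "\<bar>(\<Sum>i=1..n. g (y i)) / real n - (\<integral>z. g z \<partial>\<nu>)\<bar> \<le> K * D"
  proof (cases "K = 0")
    case True
    then have c: "g a = g 0" for a using g[of a 0] by simp
    have "(\<Sum>i=1..n. g (y i)) = real n * g 0" by (subst c) simp
    moreover have "(\<integral>z. g z \<partial>\<nu>) = g 0" by (subst c) (simp add: nu.prob_space)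
    ultimately show ?thesis using True n by simp
  next
    case False
    then have K: "K > 0" using K by simp
    have "\<bar>(\<Sum>i=1..n. g (y i) / K) / real n - (\<integral>z. g z / K \<partial>\<nu>)\<bar> \<le> D"
    proof (rule D)
      fix a b
      have "\<bar>g a / K - g b / K\<bar> = \<bar>g a - g b\<bar> / K" using K by (simp flip: diff_divide_distrib)
      then show "\<bar>g a / K - g b / K\<bar> \<le> norm (a - b)" using K g[of a b] by (simp add: divide_le_eq mult.commute)
    qed
    moreover have "(\<Sum>i=1..n. g (y i) / K) / real n - (\<integral>z. g z / K \<partial>\<nu>)
        = ((\<Sum>i=1..n. g (y i)) / real n - (\<integral>z. g z \<partial>\<nu>)) / K"
      by (simp add: sum_divide_distrib[symmetric] diff_divide_distrib)
    ultimately show ?thesis using K by (simp add: divide_le_eq mult.commute)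
  qed
  show "\<bar>(\<integral>y. g y \<partial>empirical_measure n x) - (\<integral>y. g y \<partial>\<nu>)\<bar> \<le> K * ((\<Sum>i=1..n. norm (x i - y i)) / real n + D)"
    unfolding integral_empirical_measure[OF gm] distrib_left using 1 2 by linarith
qed

text \<open>The drift difference is split at \<open>b(\<mu>\<^sub>x, y\<^sub>i)\<close>, with \<open>\<mu>\<^sub>x\<close> the empirical measure of \<open>x\<close>: convexity in space
handles one part, and the Lipschitz bound in the measure the other. The products are separated by
\<open>2cd \<le> c\<^sup>2 + d\<^sup>2\<close>. For a single index this costs one \<open>L\<close> for each of the two products and leaves \<open>L z\<close>
as a source; in the average, \<open>z\<close> joins the left-hand side, whence \<open>3L\<close>.\<close>

lemma coupling_dissipation:
  fixes x y :: "nat \<Rightarrow> real ^ 'd"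
  assumes n: "n \<ge> 1" and \<nu>: "\<nu> \<in> Pp p"
    and D: "\<And>f. (\<And>a b. \<bar>f a - f b\<bar> \<le> norm (a - b)) \<Longrightarrow> \<bar>(\<Sum>i=1..n. f (y i)) / real n - (\<integral>z. f z \<partial>\<nu>)\<bar> \<le> D"
  defines "v \<equiv> \<lambda>i. intrinsic_deriv dH \<nu> (y i) - intrinsic_deriv dH (empirical_measure n x) (x i)"
    and "z \<equiv> (\<Sum>j=1..n. (norm (x j - y j))\<^sup>2) / real n"
  shows "2 * ((x i - y i) \<bullet> v i) \<le> (2 * L - 2 * lam) * (norm (x i - y i))\<^sup>2 + (L * z + L * D\<^sup>2)"
    and "(\<Sum>i=1..n. 2 * ((x i - y i) \<bullet> v i)) / real n \<le> (3 * L - 2 * lam) * z + L * D\<^sup>2"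
proof -
  let ?b = "intrinsic_deriv dH" and ?e = "empirical_measure n x"
  define a where "a i = norm (x i - y i)" for i
  define m where "m = (\<Sum>i=1..n. a i) / real n"
  have L0: "0 \<le> L" by (rule L_nonneg[OF \<nu>])
  have z: "z = (\<Sum>i=1..n. (a i)\<^sup>2) / real n" by (simp add: z_def a_def)
  have mz: "m\<^sup>2 \<le> z"
  proof -
    have "(\<Sum>i=1..n. 1 * a i)\<^sup>2 \<le> (\<Sum>i=1..n. 1\<^sup>2) * (\<Sum>i=1..n. (a i)\<^sup>2)" by (rule Cauchy_Schwarz_ineq_sum)
    then have "(\<Sum>i=1..n. a i)\<^sup>2 / (real n)\<^sup>2 \<le> (real n * (\<Sum>i=1..n. (a i)\<^sup>2)) / (real n)\<^sup>2"
      by (intro divide_right_mono) auto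
    then show ?thesis using n by (simp add: m_def z power_divide power2_eq_square)
  qed
  have one: "2 * ((x i - y i) \<bullet> v i) \<le> 2 * L * (a i * (m + D)) - 2 * lam * (a i)\<^sup>2" for i
  proof -
    have "(x i - y i) \<bullet> v i = - ((?b ?e (x i) - ?b ?e (y i)) \<bullet> (x i - y i)) - (x i - y i) \<bullet> (?b ?e (y i) - ?b \<nu> (y i))"
      by (simp add: v_def inner_diff_left inner_diff_right inner_commute)
    moreover have "(?b ?e (x i) - ?b ?e (y i)) \<bullet> (x i - y i) \<ge> lam * (a i)\<^sup>2"
      unfolding a_def by (rule mono[OF empirical_measure_in_Pp[OF n]])
    moreover have "- ((x i - y i) \<bullet> (?b ?e (y i) - ?b \<nu> (y i))) \<le> a i * (L * (m + D))"
    proof -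
      have "- ((x i - y i) \<bullet> (?b ?e (y i) - ?b \<nu> (y i))) \<le> a i * norm (?b ?e (y i) - ?b \<nu> (y i))"
        using Cauchy_Schwarz_ineq2[of "x i - y i" "?b ?e (y i) - ?b \<nu> (y i)"] by (simp add: a_def)
      also have "\<dots> \<le> a i * (L * (m + D))"
        using empirical_drift_deviation[OF n \<nu> D, of x "y i"] unfolding m_def a_def by (intro mult_left_mono) auto
      finally show ?thesis .
    qed
    ultimately have "(x i - y i) \<bullet> v i \<le> a i * (L * (m + D)) - lam * (a i)\<^sup>2" by linarith
    then show ?thesis by (simp add: algebra_simps)
  qed
  have sq: "2 * (c * d) \<le> c\<^sup>2 + d\<^sup>2" for c d :: real
    using zero_le_power2[of "c - d"] by (simp add: power2_diff)
  have "2 * (a i * (m + D)) \<le> 2 * (a i)\<^sup>2 + z + D\<^sup>2"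
    using sq[of "a i" m] sq[of "a i" D] mz by (simp add: distrib_left)
  from mult_left_mono[OF this L0] one[of i]
  show "2 * ((x i - y i) \<bullet> v i) \<le> (2 * L - 2 * lam) * (norm (x i - y i))\<^sup>2 + (L * z + L * D\<^sup>2)"
    unfolding a_def[symmetric] by (simp add: algebra_simps)
  have "(\<Sum>i=1..n. 2 * ((x i - y i) \<bullet> v i)) / real n
      \<le> (\<Sum>i=1..n. 2 * L * (a i * (m + D)) - 2 * lam * (a i)\<^sup>2) / real n"
    by (intro divide_right_mono sum_mono one) auto
  also have "\<dots> = 2 * L * (m * (m + D)) - 2 * lam * z"
    by (simp add: m_def z sum_subtractf sum_distrib_left[symmetric] sum_distrib_right[symmetric] diff_divide_distrib)
  also have "\<dots> \<le> (3 * L - 2 * lam) * z + L * D\<^sup>2"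
  proof -
    have "2 * (m * (m + D)) \<le> 3 * z + D\<^sup>2"
      using sq[of m D] mz by (simp add: distrib_left power2_eq_square)
    from mult_left_mono[OF this L0] show ?thesis by (simp add: algebra_simps)
  qed
  finally show "(\<Sum>i=1..n. 2 * ((x i - y i) \<bullet> v i)) / real n \<le> (3 * L - 2 * lam) * z + L * D\<^sup>2" .
qed

end

locale langevin_coupling = mean_field_process p H dH d2H lam M \<F> W X
  for p :: real and H :: "(real ^ 'd) measure \<Rightarrow> real" and dH d2H lam and M :: "'w measure" and \<F> W X +
  fixes n :: nat and B Xs Xt
  assumes n: "n \<ge> 1"
    and particles: "particle_system dH n M \<F> B Xs"
    and copies: "independent_copies M X Xt"
    and coupled: "synchronously_coupled dH n M \<F> B X Xs Xt"
begin

lemma Xs_solution: "i \<in> {1..n} \<Longrightarrow> langevin_solution M \<F> (B i)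
    (\<lambda>s \<omega>. intrinsic_deriv dH (empirical_measure n (\<lambda>j. Xs j s \<omega>)) (Xs i s \<omega>)) (Xs i)"
  using particles unfolding particle_system_def by blast

lemma Xt_solution: "i \<in> {1..n} \<Longrightarrow> langevin_solution M \<F> (B i)
    (\<lambda>s \<omega>. intrinsic_deriv dH (\<mu> s) (Xt i s \<omega>)) (Xt i)"
  using coupled unfolding synchronously_coupled_def by blast

lemma langevin_solution_measurable:
  "langevin_solution M \<F> B' b Y \<Longrightarrow> 0 \<le> s \<Longrightarrow> Y s \<in> borel_measurable M"
  using filtration_measurable(1)[OF filtered W]
  unfolding langevin_solution_def adapted_continuous_def by blast

lemma langevin_solution_paths:
  "langevin_solution M \<F> B' b Y \<Longrightarrow> AE \<omega> in M. continuous_on {0..} (\<lambda>s. Y s \<omega>)"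
  unfolding langevin_solution_def adapted_continuous_def by blast

text \<open>Independence and equality of the laws are assumed on path space and pass to the time marginals by evaluation.\<close>

lemma iid_at:
  assumes s: "0 \<le> s"
  shows "iid_sample M (\<lambda>i. Xt i s) n (\<mu> s)"
proof
  have ev: "(\<lambda>f. f s) \<in> measurable (path_space :: (real \<Rightarrow> real ^ 'd) measure) borel"
    unfolding path_space_def using s by (intro measurable_component_singleton) simp
  have path: "sample_path Y \<omega> s = Y s \<omega>" for Y :: "real \<Rightarrow> 'w \<Rightarrow> real ^ 'd" and \<omega>
    using s by (simp add: sample_path_def)
  have "indep_vars (\<lambda>_. path_space) (\<lambda>i. sample_path (Xt i)) {1..n}"
    using copies unfolding independent_copies_def by (auto intro: indep_vars_subset)
  from indep_vars_compose2[OF this, where Y = "\<lambda>_ f. f s" and N = "\<lambda>_. borel"] ev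
  show "indep_vars (\<lambda>_. borel) (\<lambda>i. Xt i s) {1..n}" by (simp add: path)
  show "1 \<le> n" by (rule n)
  show "integrable (\<mu> s) (\<lambda>x. (norm x)\<^sup>2)" by (rule second_moment_bound(2)[OF s])
  fix i assume i: "i \<in> {1..n}"
  have Xtm: "sample_path (Xt i) \<in> measurable M path_space"
    using copies i unfolding independent_copies_def indep_vars_def by auto
  have Xm: "sample_path X \<in> measurable M path_space"
    unfolding path_space_def sample_path_def[abs_def]
    by (intro measurable_restrict X_measurable) simp
  have "distr M borel (Xt i s) = distr (distr M path_space (sample_path (Xt i))) borel (\<lambda>f. f s)"
    by (subst distr_distr[OF ev Xtm]) (simp add: comp_def path)
  also have "distr M path_space (sample_path (Xt i)) = distr M path_space (sample_path X)"
    using copies i unfolding independent_copies_def by auto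
  also have "distr (distr M path_space (sample_path X)) borel (\<lambda>f. f s) = \<mu> s"
    by (subst distr_distr[OF ev Xm]) (simp add: comp_def path law_def)
  finally show "distr M borel (Xt i s) = \<mu> s" .
qed

text \<open>The coupling error of particle \<open>i\<close> and its derivative in time, which no longer contains the noise.\<close>

definition Z :: "nat \<Rightarrow> real \<Rightarrow> 'w \<Rightarrow> real ^ 'd" where
  "Z i s \<omega> = Xs i s \<omega> - Xt i s \<omega>"

definition dZ :: "nat \<Rightarrow> real \<Rightarrow> 'w \<Rightarrow> real ^ 'd" where
  "dZ i s \<omega> = intrinsic_deriv dH (\<mu> s) (Xt i s \<omega>)
     - intrinsic_deriv dH (empirical_measure n (\<lambda>j. Xs j s \<omega>)) (Xs i s \<omega>)"

lemma Z_measurable: "i \<in> {1..n} \<Longrightarrow> 0 \<le> s \<Longrightarrow> Z i s \<in> borel_measurable M"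
  unfolding Z_def[abs_def]
  by (intro borel_measurable_diff langevin_solution_measurable[OF Xs_solution] langevin_solution_measurable[OF Xt_solution])

lemma empirical_drift_continuous:
  assumes i: "i \<in> {1..n}"
  shows "AE \<omega> in M. continuous_on {0..} (\<lambda>s. intrinsic_deriv dH (empirical_measure n (\<lambda>j. Xs j s \<omega>)) (Xs i s \<omega>))"
proof -
  have "AE \<omega> in M. \<forall>j\<in>{1..n}. continuous_on {0..} (\<lambda>s. Xs j s \<omega>)"
    using langevin_solution_paths[OF Xs_solution] by (intro AE_finite_allI) auto
  then show ?thesis
  proof eventually_elim
    case (elim \<omega>)
    have "continuous_on ({0..} \<times> UNIV) (\<lambda>(s, x). intrinsic_deriv dH (empirical_measure n (\<lambda>j. Xs j s \<omega>)) x)"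
    proof (rule drift_continuous[OF empirical_measure_in_Pp[OF n]])
      fix f :: "(real ^ 'd) \<Rightarrow>\<^sub>C real"
      have fc: "continuous_on UNIV f" by (rule continuous_on_apply_bcontfun)
      have fm: "apply_bcontfun f \<in> borel_measurable borel"
        by (intro borel_measurable_continuous_onI fc)
      have "continuous_on {0..} (\<lambda>s. f (Xs j s \<omega>))" if "j \<in> {1..n}" for j
        by (rule continuous_on_compose2[OF fc]) (use elim that in auto)
      then show "continuous_on {0..} (\<lambda>s. \<integral>x. f x \<partial>empirical_measure n (\<lambda>j. Xs j s \<omega>))"
        unfolding integral_empirical_measure[OF fm] using n by (intro continuous_intros) auto
    qed
    moreover have "continuous_on {0..} (\<lambda>s. (s, Xs i s \<omega>))" using elim i by (intro continuous_intros) auto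
    ultimately show ?case using continuous_on_compose2[OF _ _ image_subsetI] by fastforce
  qed
qed

lemma mean_drift_path_continuous:
  assumes i: "i \<in> {1..n}"
  shows "AE \<omega> in M. continuous_on {0..} (\<lambda>s. intrinsic_deriv dH (\<mu> s) (Xt i s \<omega>))"
  using langevin_solution_paths[OF Xt_solution[OF i]]
proof eventually_elim
  case (elim \<omega>)
  then have "continuous_on {0..} (\<lambda>s. (s, Xt i s \<omega>))" by (intro continuous_intros)
  from continuous_on_compose2[OF mean_drift_continuous this image_subsetI] show ?case by simp
qed

lemma Z_path:
  assumes i: "i \<in> {1..n}"
  shows "AE \<omega> in M. Z i 0 \<omega> = 0 \<and> continuous_on {0..t} (\<lambda>s. dZ i s \<omega>) \<and>
    (\<forall>s\<in>{0..t}. ((\<lambda>s. Z i s \<omega>) has_vector_derivative dZ i s \<omega>) (at s within {0..t}))"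
proof -
  have "AE \<omega> in M. Xt i 0 \<omega> = Xs i 0 \<omega>"
    using coupled i unfolding synchronously_coupled_def by blast
  with langevin_solution_integral_form[OF Xs_solution[OF i] empirical_drift_continuous[OF i]]
    langevin_solution_integral_form[OF Xt_solution[OF i] mean_drift_path_continuous[OF i]]
  show ?thesis
  proof eventually_elim
    case (elim \<omega>)
    define c1 where "c1 s = intrinsic_deriv dH (empirical_measure n (\<lambda>j. Xs j s \<omega>)) (Xs i s \<omega>)" for s
    define c2 where "c2 s = intrinsic_deriv dH (\<mu> s) (Xt i s \<omega>)" for s
    have c: "continuous_on {0..t} c1" "continuous_on {0..t} c2"
      unfolding c1_def[abs_def] c2_def[abs_def]
      by (rule continuous_on_subset[OF conjunct1[OF elim(1)]], simp, rule continuous_on_subset[OF conjunct1[OF elim(2)]], simp)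
    have cd: "continuous_on {0..t} (\<lambda>s. dZ i s \<omega>)"
      unfolding dZ_def c1_def[symmetric] c2_def[symmetric] by (intro continuous_on_diff c)
    have Zeq: "Z i s \<omega> = integral {0..s} (\<lambda>s. dZ i s \<omega>)" if s: "s \<in> {0..t}" for s
    proof -
      have s0: "0 \<le> s" using s by simp
      have "c1 integrable_on {0..s}" "c2 integrable_on {0..s}"
        using s by (auto intro!: integrable_continuous_real continuous_on_subset[OF c(1)] continuous_on_subset[OF c(2)])
      then have "integral {0..s} (\<lambda>s. dZ i s \<omega>) = integral {0..s} c2 - integral {0..s} c1"
        unfolding dZ_def c1_def[symmetric] c2_def[symmetric] by (intro integral_diff)
      moreover have "Xs i s \<omega> = Xs i 0 \<omega> + sqrt 2 *\<^sub>R B i s \<omega> - integral {0..s} c1"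
        unfolding c1_def by (rule conjunct2[OF elim(1), rule_format, OF s0])
      moreover have "Xt i s \<omega> = Xt i 0 \<omega> + sqrt 2 *\<^sub>R B i s \<omega> - integral {0..s} c2"
        unfolding c2_def by (rule conjunct2[OF elim(2), rule_format, OF s0])
      ultimately show ?thesis unfolding Z_def elim(3) by simp
    qed
    have "((\<lambda>s. Z i s \<omega>) has_vector_derivative dZ i s \<omega>) (at s within {0..t})" if s: "s \<in> {0..t}" for s
      by (rule has_vector_derivative_transform[OF s _ integral_has_vector_derivative[OF cd s]]) (simp add: Zeq)
    moreover have "Z i 0 \<omega> = 0" unfolding Z_def elim(3) by simp
    ultimately show ?case using cd by blast
  qed
qed

lemma Z_square_path:
  assumes i: "i \<in> {1..n}"
  shows "AE \<omega> in M. (norm (Z i 0 \<omega>))\<^sup>2 = 0 \<and> continuous_on {0..t} (\<lambda>s. 2 * (Z i s \<omega> \<bullet> dZ i s \<omega>)) \<and>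
    (\<forall>s\<in>{0..t}. ((\<lambda>s. (norm (Z i s \<omega>))\<^sup>2) has_real_derivative 2 * (Z i s \<omega> \<bullet> dZ i s \<omega>)) (at s within {0..t}))"
  using Z_path[OF i, of t]
proof eventually_elim
  case (elim \<omega>)
  have d: "((\<lambda>s. Z i s \<omega>) has_vector_derivative dZ i s \<omega>) (at s within {0..t})" if "s \<in> {0..t}" for s
    using elim that by blast
  have "continuous_on {0..t} (\<lambda>s. Z i s \<omega>)"
    by (rule continuous_on_vector_derivative[OF d])
  then have "continuous_on {0..t} (\<lambda>s. 2 * (Z i s \<omega> \<bullet> dZ i s \<omega>))"
    using elim by (intro continuous_intros) auto
  moreover have "((\<lambda>s. (norm (Z i s \<omega>))\<^sup>2) has_real_derivative 2 * (Z i s \<omega> \<bullet> dZ i s \<omega>)) (at s within {0..t})"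
    if "s \<in> {0..t}" for s
  proof -
    note d' = d[OF that, unfolded has_vector_derivative_def]
    have "((\<lambda>s. Z i s \<omega> \<bullet> Z i s \<omega>) has_derivative (\<lambda>h. Z i s \<omega> \<bullet> (h *\<^sub>R dZ i s \<omega>) + (h *\<^sub>R dZ i s \<omega>) \<bullet> Z i s \<omega>)) (at s within {0..t})"
      by (rule has_derivative_inner[OF d' d'])
    moreover have "(\<lambda>h. Z i s \<omega> \<bullet> (h *\<^sub>R dZ i s \<omega>) + (h *\<^sub>R dZ i s \<omega>) \<bullet> Z i s \<omega>) = (*) (2 * (Z i s \<omega> \<bullet> dZ i s \<omega>))"
      by (simp add: fun_eq_iff inner_commute)
    ultimately show ?thesis unfolding has_field_derivative_def power2_norm_eq_inner by simp
  qed
  ultimately show ?case using elim by simp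
qed

text \<open>Gronwall's inequality is used twice. The first use bounds the average \<open>z\<close> of all coupling errors by
the claimed function. The second bounds the error of the first particle, with \<open>z\<close> as a source; the
comparison equation has the same solution because \<open>(2L - 2\<lambda>) u + L u = (3L - 2\<lambda>) u\<close>.\<close>

lemma coupling_error:
  assumes t: "t \<in> {0..T}"
  shows "integrable M (\<lambda>\<omega>. (norm (Z 1 t \<omega>))\<^sup>2)"
    and "(\<integral>\<omega>. (norm (Z 1 t \<omega>))\<^sup>2 \<partial>M) \<le> growth (3 * L - 2 * lam)
      (L * chaos_const TYPE('d) * (SUP t\<in>{0..T}. second_moment (\<mu> t)) * rate CARD('d) n) t"
proof -
  define K where "K = (SUP t\<in>{0..T}. second_moment (\<mu> t))"
  define A where "A = L * chaos_const TYPE('d) * K * rate CARD('d) n"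
  let ?\<beta> = "3 * L - 2 * lam"
  have t0: "0 \<le> t" "0 \<le> T" using t by auto
  have K0: "0 \<le> K" unfolding K_def by (rule SUP_second_moment_nonneg[OF t0(2)])
  have A0: "0 \<le> A" unfolding A_def chaos_const_def using L_ge_0 K0 rate_pos[OF n, of "CARD('d)"]
    by (intro mult_nonneg_nonneg) auto
  have one: "1 \<in> {1..n}" using n by simp
  have main: "(\<integral>\<^sup>+\<omega>. ennreal ((norm (Z 1 t \<omega>))\<^sup>2) \<partial>M) \<le> ennreal (growth ?\<beta> A t)"
  proof (cases "t = 0")
    case True
    have "AE \<omega> in M. (norm (Z 1 0 \<omega>))\<^sup>2 = 0" using Z_square_path[OF one, of 0] by eventually_elim blast
    then have "(\<integral>\<^sup>+\<omega>. ennreal ((norm (Z 1 t \<omega>))\<^sup>2) \<partial>M) = (\<integral>\<^sup>+\<omega>. 0 \<partial>M)"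
      unfolding True by (intro nn_integral_cong_AE) (auto elim!: eventually_mono)
    then show ?thesis by simp
  next
    case False
    then have "0 < T" using t by auto
    \<comment> \<open>A positive \<open>K\<close> provides the positive radius \<open>sqrt K\<close> of the innermost shell.\<close>
    then have K: "0 < K" unfolding K_def by (rule SUP_second_moment_pos)
    have "\<exists>D. D \<in> borel_measurable M \<and> integrable M (\<lambda>\<omega>. (D \<omega>)\<^sup>2) \<and>
       (\<integral>\<omega>. (D \<omega>)\<^sup>2 \<partial>M) \<le> chaos_const TYPE('d) * K * rate CARD('d) n \<and>
       (\<forall>f \<omega>. (\<forall>x y. \<bar>f x - f y\<bar> \<le> norm (x - y)) \<longrightarrow>
          \<bar>(\<Sum>i=1..n. f (Xt i s \<omega>)) / real n - (\<integral>x. f x \<partial>\<mu> s)\<bar> \<le> D \<omega>)" if s: "s \<in> {0..t}" for s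
    proof -
      have "(\<integral>x. (norm x)\<^sup>2 \<partial>\<mu> s) \<le> (sqrt K)\<^sup>2"
        using second_moment_le_SUP[of s T] s t K0 by (simp add: K_def second_moment_def)
      moreover have "0 < sqrt K" "(sqrt K)\<^sup>2 = K" using K by auto
      ultimately show ?thesis
        using iid_sample.empirical_lipschitz_deviation[OF iid_at[of s], of "sqrt K"] s by auto
    qed
    then obtain D where D: "\<And>s. s \<in> {0..t} \<Longrightarrow> D s \<in> borel_measurable M"
      "\<And>s. s \<in> {0..t} \<Longrightarrow> integrable M (\<lambda>\<omega>. (D s \<omega>)\<^sup>2)"
      "\<And>s. s \<in> {0..t} \<Longrightarrow> (\<integral>\<omega>. (D s \<omega>)\<^sup>2 \<partial>M) \<le> chaos_const TYPE('d) * K * rate CARD('d) n"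
      "\<And>s f \<omega>. s \<in> {0..t} \<Longrightarrow> (\<And>x y. \<bar>f x - f y\<bar> \<le> norm (x - y)) \<Longrightarrow>
          \<bar>(\<Sum>i=1..n. f (Xt i s \<omega>)) / real n - (\<integral>x. f x \<partial>\<mu> s)\<bar> \<le> D s \<omega>"
      by metis
    have D_nn: "(\<integral>\<^sup>+\<omega>. ennreal (L * (D s \<omega>)\<^sup>2) \<partial>M) \<le> ennreal A" if s: "s \<in> {0..t}" for s
    proof -
      have "(\<integral>\<^sup>+\<omega>. ennreal (L * (D s \<omega>)\<^sup>2) \<partial>M) = ennreal (\<integral>\<omega>. L * (D s \<omega>)\<^sup>2 \<partial>M)"
        using D(2)[OF s] L_ge_0 by (intro nn_integral_eq_integral) auto
      also have "\<dots> \<le> ennreal A"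
        using mult_left_mono[OF D(3)[OF s] L_ge_0] by (intro ennreal_leI) (simp add: A_def mult.assoc)
      finally show ?thesis .
    qed
    define z where "z s \<omega> = (\<Sum>i=1..n. (norm (Z i s \<omega>))\<^sup>2) / real n" for s \<omega>
    define z' where "z' s \<omega> = (\<Sum>i=1..n. 2 * (Z i s \<omega> \<bullet> dZ i s \<omega>)) / real n" for s \<omega>
    have all: "AE \<omega> in M. \<forall>i\<in>{1..n}. (norm (Z i 0 \<omega>))\<^sup>2 = 0 \<and> continuous_on {0..r} (\<lambda>s. 2 * (Z i s \<omega> \<bullet> dZ i s \<omega>)) \<and>
      (\<forall>s\<in>{0..r}. ((\<lambda>s. (norm (Z i s \<omega>))\<^sup>2) has_real_derivative 2 * (Z i s \<omega> \<bullet> dZ i s \<omega>)) (at s within {0..r}))" for r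
      by (rule AE_finite_allI[OF _ Z_square_path]) auto
    have z0: "0 \<le> z s \<omega>" for s \<omega> unfolding z_def by (intro divide_nonneg_nonneg sum_nonneg) auto
    have zm: "z s \<in> borel_measurable M" if "0 \<le> s" for s
      unfolding z_def[abs_def] using Z_measurable[OF _ that]
      by (intro borel_measurable_divide borel_measurable_sum borel_measurable_power borel_measurable_const
          measurable_compose[OF _ borel_measurable_norm]) auto
    have diss: "2 * (Z i s \<omega> \<bullet> dZ i s \<omega>) \<le> (2 * L - 2 * lam) * (norm (Z i s \<omega>))\<^sup>2 + (L * z s \<omega> + L * (D s \<omega>)\<^sup>2)"
      "z' s \<omega> \<le> ?\<beta> * z s \<omega> + L * (D s \<omega>)\<^sup>2" if s: "s \<in> {0..t}" for s \<omega> i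
    proof -
      have "\<mu> s \<in> Pp p" using s by (intro law_in_Pp) simp
      note c = coupling_dissipation[where x = "\<lambda>j. Xs j s \<omega>" and y = "\<lambda>j. Xt j s \<omega>" and D = "D s \<omega>",
          OF n this D(4)[OF s]]
      show "2 * (Z i s \<omega> \<bullet> dZ i s \<omega>) \<le> (2 * L - 2 * lam) * (norm (Z i s \<omega>))\<^sup>2 + (L * z s \<omega> + L * (D s \<omega>)\<^sup>2)"
        unfolding z_def Z_def dZ_def by (rule c(1))
      show "z' s \<omega> \<le> ?\<beta> * z s \<omega> + L * (D s \<omega>)\<^sup>2"
        unfolding z_def z'_def Z_def dZ_def by (rule c(2))
    qed
    have z_le: "(\<integral>\<^sup>+\<omega>. ennreal (z r \<omega>) \<partial>M) \<le> ennreal (growth ?\<beta> A r)" if r: "r \<in> {0..t}" for r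
    proof (rule gronwall_in_expectation[where t = r and e = z and u = "growth ?\<beta> A" and e' = z' and \<gamma> = ?\<beta> and G = "\<lambda>s \<omega>. L * (D s \<omega>)\<^sup>2" and a = "\<lambda>_. A"])
      show "AE \<omega> in M. (\<forall>s\<in>{0..r}. ((\<lambda>s. z s \<omega>) has_real_derivative z' s \<omega>) (at s within {0..r}) \<and>
        z' s \<omega> \<le> ?\<beta> * z s \<omega> + L * (D s \<omega>)\<^sup>2) \<and> continuous_on {0..r} (\<lambda>s. z' s \<omega>) \<and> z 0 \<omega> = 0"
        using all[of r]
      proof eventually_elim
        case (elim \<omega>)
        have "((\<lambda>s. z s \<omega>) has_real_derivative z' s \<omega>) (at s within {0..r})" if "s \<in> {0..r}" for s
          unfolding z_def z'_def using elim that by (intro DERIV_cdivide DERIV_sum) blast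
        moreover have "z' s \<omega> \<le> ?\<beta> * z s \<omega> + L * (D s \<omega>)\<^sup>2" if "s \<in> {0..r}" for s
          using that r by (intro diss(2)) auto
        moreover have "continuous_on {0..r} (\<lambda>s. z' s \<omega>)"
          unfolding z'_def using elim n by (intro continuous_on_divide continuous_on_sum continuous_on_const) auto
        moreover have "z 0 \<omega> = 0" unfolding z_def using elim by simp
        ultimately show ?case by blast
      qed
    qed (use r D(1) D_nn L_ge_0 A0 growth_ode in auto)
    show ?thesis
    proof (rule gronwall_in_expectation[where t = t and u = "growth ?\<beta> A" and e = "\<lambda>s \<omega>. (norm (Z 1 s \<omega>))\<^sup>2" and e' = "\<lambda>s \<omega>. 2 * (Z 1 s \<omega> \<bullet> dZ 1 s \<omega>)"
          and \<gamma> = "2 * L - 2 * lam" and G = "\<lambda>s \<omega>. L * z s \<omega> + L * (D s \<omega>)\<^sup>2" and a = "\<lambda>s. L * growth ?\<beta> A s + A"])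
      show "AE \<omega> in M. (\<forall>s\<in>{0..t}. ((\<lambda>s. (norm (Z 1 s \<omega>))\<^sup>2) has_real_derivative 2 * (Z 1 s \<omega> \<bullet> dZ 1 s \<omega>)) (at s within {0..t}) \<and>
          2 * (Z 1 s \<omega> \<bullet> dZ 1 s \<omega>) \<le> (2 * L - 2 * lam) * (norm (Z 1 s \<omega>))\<^sup>2 + (L * z s \<omega> + L * (D s \<omega>)\<^sup>2)) \<and>
        continuous_on {0..t} (\<lambda>s. 2 * (Z 1 s \<omega> \<bullet> dZ 1 s \<omega>)) \<and> (norm (Z 1 0 \<omega>))\<^sup>2 = 0"
        using Z_square_path[OF one, of t] by eventually_elim (use diss(1) in blast)
      fix s assume s: "s \<in> {0..t}"
      then have s0: "0 \<le> s" by simp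
      show "(\<lambda>\<omega>. L * z s \<omega> + L * (D s \<omega>)\<^sup>2) \<in> borel_measurable M"
        using zm[OF s0] D(1)[OF s]
        by (intro borel_measurable_add borel_measurable_times borel_measurable_power borel_measurable_const)
      show "0 \<le> L * z s \<omega> + L * (D s \<omega>)\<^sup>2" for \<omega>
        using L_ge_0 z0 by (intro add_nonneg_nonneg mult_nonneg_nonneg) auto
      have g0: "0 \<le> growth ?\<beta> A s" by (rule growth_nonneg[OF s0 A0])
      show "0 \<le> L * growth ?\<beta> A s + A" using L_ge_0 g0 A0 by simp
      have "(\<integral>\<^sup>+\<omega>. ennreal (L * z s \<omega> + L * (D s \<omega>)\<^sup>2) \<partial>M)
          = ennreal L * (\<integral>\<^sup>+\<omega>. ennreal (z s \<omega>) \<partial>M) + (\<integral>\<^sup>+\<omega>. ennreal (L * (D s \<omega>)\<^sup>2) \<partial>M)"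
      proof -
        have "ennreal (L * z s \<omega> + L * (D s \<omega>)\<^sup>2) = ennreal L * ennreal (z s \<omega>) + ennreal (L * (D s \<omega>)\<^sup>2)" for \<omega>
          using L_ge_0 z0 by (simp add: ennreal_mult)
        then show ?thesis using zm[OF s0] D(1)[OF s] by (simp add: nn_integral_add nn_integral_cmult)
      qed
      also have "\<dots> \<le> ennreal L * ennreal (growth ?\<beta> A s) + ennreal A"
        using z_le[OF s] D_nn[OF s] by (intro add_mono mult_left_mono) auto
      also have "\<dots> = ennreal (L * growth ?\<beta> A s + A)"
        using L_ge_0 g0 A0 by (simp add: ennreal_mult)
      finally show "(\<integral>\<^sup>+\<omega>. ennreal (L * z s \<omega> + L * (D s \<omega>)\<^sup>2) \<partial>M) \<le> ennreal (L * growth ?\<beta> A s + A)" .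
      have "?\<beta> * growth ?\<beta> A s + A = (2 * L - 2 * lam) * growth ?\<beta> A s + (L * growth ?\<beta> A s + A)"
        by (simp add: algebra_simps)
      then show "(growth ?\<beta> A has_real_derivative (2 * L - 2 * lam) * growth ?\<beta> A s + (L * growth ?\<beta> A s + A)) (at s within {0..t})"
        using growth_ode by metis
    next
      show "continuous_on {0..t} (\<lambda>s. L * growth ?\<beta> A s + A)"
        by (intro continuous_intros DERIV_continuous_on[OF growth_ode])
    qed (use t0 in auto)
  qed
  show i: "integrable M (\<lambda>\<omega>. (norm (Z 1 t \<omega>))\<^sup>2)"
  proof (rule integrableI_nonneg)
    show "(\<lambda>\<omega>. (norm (Z 1 t \<omega>))\<^sup>2) \<in> borel_measurable M" using Z_measurable[OF one t0(1)] by simp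
    show "(\<integral>\<^sup>+\<omega>. ennreal ((norm (Z 1 t \<omega>))\<^sup>2) \<partial>M) < \<infinity>"
      using order_le_less_trans[OF main ennreal_less_top] by simp
  qed simp
  have "ennreal (\<integral>\<omega>. (norm (Z 1 t \<omega>))\<^sup>2 \<partial>M) \<le> ennreal (growth ?\<beta> A t)"
    using main by (subst nn_integral_eq_integral[OF i, symmetric]) auto
  then have "(\<integral>\<omega>. (norm (Z 1 t \<omega>))\<^sup>2 \<partial>M) \<le> growth ?\<beta> A t"
    using growth_nonneg[OF t0(1) A0] by simp
  then show "(\<integral>\<omega>. (norm (Z 1 t \<omega>))\<^sup>2 \<partial>M) \<le> growth ?\<beta>
      (L * chaos_const TYPE('d) * (SUP t\<in>{0..T}. second_moment (\<mu> t)) * rate CARD('d) n) t"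
    by (simp only: A_def K_def)
qed

end

section \<open>Propagation of chaos\<close>

lemma chaos_const_pos: "0 < chaos_const TYPE('d::finite)"
  by (simp add: chaos_const_def)

context langevin_coupling
begin

text \<open>Only the sign of \<open>\<beta>\<close> matters: the homogeneous part of the Gronwall bound is at most the initial
second moment, and the inhomogeneous part at most \<open>-\<alpha> / \<beta>\<close>.\<close>

lemma uniform_estimates:
  assumes \<beta>: "- 2 * (lam - S) < 0"
  defines "Q \<equiv> second_moment (\<mu> 0) - (2 * real CARD('d) + 2 * S) / (- 2 * (lam - S))"
  shows "0 \<le> t \<Longrightarrow> moment_bound t \<le> Q"
    and "0 \<le> T \<Longrightarrow> (SUP t\<in>{0..T}. second_moment (\<mu> t)) \<le> Q"
    and "0 \<le> T \<Longrightarrow> 0 \<le> (SUP t\<in>{0..T}. moment_bound t) \<and> (SUP t\<in>{0..T}. moment_bound t) \<le> Q"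
proof -
  show g: "moment_bound t \<le> Q" if "0 \<le> t" for t
  proof -
    have "exp (- 2 * (lam - S) * t) \<le> 1" using \<beta> that by (simp add: mult_nonpos_nonneg)
    then have "exp (- 2 * (lam - S) * t) * second_moment (\<mu> 0) \<le> 1 * second_moment (\<mu> 0)"
      by (intro mult_right_mono second_moment_nonneg)
    moreover have "growth (- 2 * (lam - S)) (2 * real CARD('d) + 2 * S) t \<le> (2 * real CARD('d) + 2 * S) / (- (- 2 * (lam - S)))"
      using S_ge_0 by (intro growth_le[OF \<beta>]) simp
    ultimately show ?thesis unfolding gronwall_bound_growth Q_def minus_divide_right[symmetric] by linarith
  qed
  show "(SUP t\<in>{0..T}. second_moment (\<mu> t)) \<le> Q" if "0 \<le> T"
    using that by (intro cSUP_least order_trans[OF second_moment_bound(3) g]) auto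
  show "0 \<le> (SUP t\<in>{0..T}. moment_bound t) \<and> (SUP t\<in>{0..T}. moment_bound t) \<le> Q" if "0 \<le> T"
  proof
    have "0 \<le> moment_bound 0" using second_moment_nonneg[of "\<mu> 0"] by (simp add: gronwall_bound_growth)
    also have "\<dots> \<le> (SUP t\<in>{0..T}. moment_bound t)" using that by (intro cSUP_upper[OF _ bdd_moment_bound]) auto
    finally show "0 \<le> (SUP t\<in>{0..T}. moment_bound t)" .
    show "(SUP t\<in>{0..T}. moment_bound t) \<le> Q" using that by (intro cSUP_least g) auto
  qed
qed

text \<open>Lower bounds for the second moment factors: both are at least the positive value at \<open>T = 1\<close> of the
actual one, and for \<open>\<beta> \<ge> 0\<close> the Gronwall factor grows at least linearly.\<close>

lemma SUP_moment_bound_ge: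
  assumes "1 \<le> T"
  shows "(SUP t\<in>{0..1}. second_moment (\<mu> t)) \<le> (SUP t\<in>{0..T}. second_moment (\<mu> t))"
    and "(SUP t\<in>{0..1}. second_moment (\<mu> t)) \<le> (SUP t\<in>{0..T}. moment_bound t)"
    and "- 2 * (lam - S) \<ge> 0 \<Longrightarrow> (2 * real CARD('d) + 2 * S) * T \<le> (SUP t\<in>{0..T}. moment_bound t)"
proof -
  show "(SUP t\<in>{0..1}. second_moment (\<mu> t)) \<le> (SUP t\<in>{0..T}. second_moment (\<mu> t))"
    using assms by (intro cSUP_least second_moment_le_SUP) auto
  have moment_le: "moment_bound t \<le> (SUP t\<in>{0..T}. moment_bound t)" if "t \<in> {0..T}" for t
    by (rule cSUP_upper[OF that bdd_moment_bound])
  show "(SUP t\<in>{0..1}. second_moment (\<mu> t)) \<le> (SUP t\<in>{0..T}. moment_bound t)"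
    using assms by (intro cSUP_least order_trans[OF second_moment_bound(3) moment_le]) auto
  assume \<beta>: "- 2 * (lam - S) \<ge> 0"
  have "(2 * real CARD('d) + 2 * S) * T \<le> (2 * real CARD('d) + 2 * S) * growth (- 2 * (lam - S)) 1 T"
    using assms S_ge_0 by (intro mult_left_mono growth_unit_ge[OF \<beta>]) auto
  also have "\<dots> = growth (- 2 * (lam - S)) (2 * real CARD('d) + 2 * S) T"
    by (rule growth_cmult[symmetric])
  also have "\<dots> \<le> moment_bound T"
    unfolding gronwall_bound_growth using second_moment_nonneg[of "\<mu> 0"] by simp
  also have "\<dots> \<le> (SUP t\<in>{0..T}. moment_bound t)" using assms by (intro moment_le) auto
  finally show "(2 * real CARD('d) + 2 * S) * T \<le> (SUP t\<in>{0..T}. moment_bound t)" .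
qed

lemma propagation_of_chaos:
  "(let L = Sup (deriv2_opnorms p d2H);
         S = Sup (grad0_norms p dH);
         \<beta>1 = 3 * L - 2 * lam;
         \<alpha> = 2 * real CARD('d) + 2 * S;
         \<beta> = - 2 * (lam - S);
         m0 = second_moment (law M X 0);
         err = (\<lambda>t. \<integral>\<omega>. (norm (Xs 1 t \<omega> - Xt 1 t \<omega>))\<^sup>2 \<partial>M);
         U = chaos_bound \<beta>1 L (chaos_const TYPE('d)) (\<lambda>T. SUP t\<in>{0..T}. second_moment (law M X t)) CARD('d) n;
         V = chaos_bound \<beta>1 L (chaos_const TYPE('d)) (\<lambda>T. SUP t\<in>{0..T}. gronwall_bound \<alpha> \<beta> m0 t) CARD('d) n
     in (\<forall>T\<ge>0. \<forall>t\<in>{0..T}.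
           integrable M (\<lambda>\<omega>. (norm (Xs 1 t \<omega> - Xt 1 t \<omega>))\<^sup>2) \<and> err t \<le> U T t) \<and>
        (\<forall>t\<ge>0. law M X t \<in> Pp 2 \<and> second_moment (law M X t) \<le> gronwall_bound \<alpha> \<beta> m0 t) \<and>
        (\<beta> < 0 \<and> \<beta>1 < 0 \<longrightarrow>
           uniform_in_time U \<and> uniform_in_time V \<and>
           (SUP t\<in>{0..}. ereal (err t)) \<le>
             ereal (L * chaos_const TYPE('d) / (2 * lam - 3 * L) * (m0 - \<alpha> / \<beta>) * rate CARD('d) n)) \<and>
        (L > 0 \<longrightarrow>
           (uniform_in_time V \<longrightarrow> \<beta> < 0 \<and> \<beta>1 < 0) \<and> (uniform_in_time U \<longrightarrow> \<beta>1 < 0)))"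
proof -
  let ?C = "chaos_const TYPE('d)" and ?r = "rate CARD('d) n"
  let ?\<beta>1 = "3 * L - 2 * lam" and ?\<beta> = "- 2 * (lam - S)" and ?\<alpha> = "2 * real CARD('d) + 2 * S"
  let ?m = "\<lambda>T. SUP t\<in>{0..T}. second_moment (\<mu> t)" and ?g = "\<lambda>T. SUP t\<in>{0..T}. moment_bound t"
  let ?U = "chaos_bound ?\<beta>1 L ?C ?m CARD('d) n" and ?V = "chaos_bound ?\<beta>1 L ?C ?g CARD('d) n"
  let ?err = "\<lambda>t. \<integral>\<omega>. (norm (Xs 1 t \<omega> - Xt 1 t \<omega>))\<^sup>2 \<partial>M"
  let ?Q = "second_moment (\<mu> 0) - ?\<alpha> / ?\<beta>"
  have r: "0 < ?r" by (rule rate_pos[OF n])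
  have c0: "0 \<le> L * ?C * x * ?r" if "0 \<le> x" for x
    using L_ge_0 chaos_const_pos[where 'd = 'd] r that by (intro mult_nonneg_nonneg) auto
  have err: "integrable M (\<lambda>\<omega>. (norm (Xs 1 t \<omega> - Xt 1 t \<omega>))\<^sup>2) \<and> ?err t \<le> ?U T t" if "t \<in> {0..T}" for t T
    using coupling_error[OF that] unfolding chaos_bound_growth alpha1_def Z_def by blast
  have U: "chaos_bound ?\<beta>1 L ?C m CARD('d) n T t \<le> L * ?C * ?Q * ?r / (- ?\<beta>1)"
    if "?\<beta>1 < 0" "0 \<le> m T" "m T \<le> ?Q" for m T t
  proof -
    have "chaos_bound ?\<beta>1 L ?C m CARD('d) n T t \<le> L * ?C * m T * ?r / (- ?\<beta>1)"
      unfolding chaos_bound_growth alpha1_def by (rule growth_le[OF that(1) c0[OF that(2)]])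
    also have "\<dots> \<le> L * ?C * ?Q * ?r / (- ?\<beta>1)"
      using that L_ge_0 chaos_const_pos[where 'd = 'd] r
      by (intro divide_right_mono mult_right_mono mult_left_mono) auto
    finally show ?thesis .
  qed
  have unif: "uniform_in_time ?U \<and> uniform_in_time ?V \<and>
      (SUP t\<in>{0..}. ereal (?err t)) \<le> ereal (L * ?C / (2 * lam - 3 * L) * ?Q * ?r)"
    if \<beta>: "?\<beta> < 0" and \<beta>1: "?\<beta>1 < 0"
  proof (intro conjI)
    note est = uniform_estimates[OF \<beta>]
    have UT: "?U T t \<le> L * ?C * ?Q * ?r / (- ?\<beta>1)" if "0 \<le> T" for T t
      by (rule U[of ?m T t, OF \<beta>1 SUP_second_moment_nonneg[OF that] est(2)[OF that]])
    then show "uniform_in_time ?U" unfolding uniform_in_time_def by blast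
    have "?V T t \<le> L * ?C * ?Q * ?r / (- ?\<beta>1)" if "0 \<le> T" for T t
      using est(3)[OF that] by (intro U[OF \<beta>1]) auto
    then show "uniform_in_time ?V" unfolding uniform_in_time_def by blast
    show "(SUP t\<in>{0..}. ereal (?err t)) \<le> ereal (L * ?C / (2 * lam - 3 * L) * ?Q * ?r)"
    proof (rule SUP_least)
      fix t :: real assume "t \<in> {0..}"
      then have t: "0 \<le> t" by simp
      have "?err t \<le> ?U t t" using err[of t t] t by simp
      also have "\<dots> \<le> L * ?C * ?Q * ?r / (- ?\<beta>1)" by (rule UT[OF t])
      also have "\<dots> = L * ?C / (2 * lam - 3 * L) * ?Q * ?r" by simp
      finally show "ereal (?err t) \<le> ereal (L * ?C / (2 * lam - 3 * L) * ?Q * ?r)" by simp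
    qed
  qed
  have conv: "(uniform_in_time ?V \<longrightarrow> ?\<beta> < 0 \<and> ?\<beta>1 < 0) \<and> (uniform_in_time ?U \<longrightarrow> ?\<beta>1 < 0)" if L: "0 < L"
  proof -
    have c: "0 < L * ?C * x * ?r" if "0 < x" for x
      using L chaos_const_pos[where 'd = 'd] r that by (intro mult_pos_pos) auto
    have mono: "L * ?C * x * ?r \<le> L * ?C * y * ?r" if "x \<le> y" for x y
      using L chaos_const_pos[where 'd = 'd] r that by (intro mult_right_mono mult_left_mono) auto
    have \<kappa>: "0 < L * ?C * ?m 1 * ?r" by (intro c SUP_second_moment_pos) simp
    have neg: "?\<beta>1 < 0"
      if "uniform_in_time (chaos_bound ?\<beta>1 L ?C m CARD('d) n)" "\<And>T. 1 \<le> T \<Longrightarrow> ?m 1 \<le> m T" for m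
      using that(1) unfolding chaos_bound_growth[abs_def] alpha1_def
      by (rule uniform_in_time_growth_neg[OF _ \<kappa>]) (intro mono that(2))
    have "?\<beta> < 0" if V: "uniform_in_time ?V"
    proof (rule ccontr)
      assume "\<not> ?\<beta> < 0"
      then have \<beta>: "?\<beta> \<ge> 0" by simp
      have g1: "?\<alpha> * T \<le> ?g T" if "1 \<le> T" for T by (rule SUP_moment_bound_ge(3)[OF that \<beta>])
      have \<alpha>: "0 < ?\<alpha>" using S_ge_0 by (intro add_pos_nonneg) auto
      have pos: "0 < ?g T" if "1 \<le> T" for T
      proof -
        have "0 < ?\<alpha> * T" using \<alpha> that by (intro mult_pos_pos) auto
        then show ?thesis using g1[OF that] by (rule order_less_le_trans)
      qed
      have "?\<beta>1 < 0" by (rule neg[OF V SUP_moment_bound_ge(2)])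
      moreover have "uniform_in_time (\<lambda>T. growth ?\<beta>1 (L * ?C * ?g T * ?r))"
        using V unfolding chaos_bound_growth[abs_def] alpha1_def .
      ultimately have "\<exists>K. \<forall>T\<ge>1. L * ?C * ?g T * ?r \<le> K"
        by (intro uniform_in_time_growth_bounded c0 less_imp_le[OF pos])
      then obtain K where K: "\<And>T. 1 \<le> T \<Longrightarrow> L * ?C * ?g T * ?r \<le> K" by blast
      define a where "a = L * ?C * ?\<alpha> * ?r"
      have a: "0 < a" unfolding a_def by (rule c[OF \<alpha>])
      define T where "T = max 1 (\<bar>K\<bar> / a + 1)"
      have T: "1 \<le> T" "\<bar>K\<bar> / a < T" by (auto simp: T_def)
      have "K < a * T" using T(2) a by (simp add: divide_less_eq mult.commute)
      also have "a * T = L * ?C * (?\<alpha> * T) * ?r" by (simp only: a_def mult_ac)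
      also have "\<dots> \<le> L * ?C * ?g T * ?r" by (rule mono[OF g1[OF T(1)]])
      also have "\<dots> \<le> K" by (rule K[OF T(1)])
      finally show False by simp
    qed
    then show ?thesis using neg[of ?g, OF _ SUP_moment_bound_ge(2)] neg[of ?m, OF _ SUP_moment_bound_ge(1)] by blast
  qed
  show ?thesis
    unfolding Let_def L_def[symmetric] S_def[symmetric]
    using err second_moment_bound(1,3) unif conv by (intro conjI allI impI ballI) blast+
qed

end

theorem theorem3p3:
  shows "\<exists>C > 0. \<forall>(p :: real) (H :: (real ^ 'd) measure \<Rightarrow> real) dH d2H (lam :: real) (n :: nat)
      (M :: 'w measure) \<F> W X B Xs Xt.
    p \<ge> 0 \<longrightarrow>
    flat_derivative p H dH \<longrightarrow>
    second_flat_derivative p dH d2H \<longrightarrow>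
    continuous_map (prod_topology (weak_topology p) (prod_topology euclidean euclidean)) euclideanreal
      (\<lambda>(\<mu>, x, y). d2H \<mu> x y) \<longrightarrow>
    (\<forall>\<mu>\<in>Pp p. C2 (dH \<mu>)) \<longrightarrow>
    (\<forall>\<mu>\<in>Pp p. C2 (\<lambda>(x, y). d2H \<mu> x y)) \<longrightarrow>
    bdd_above (grad0_norms p dH) \<longrightarrow>
    lam > 0 \<longrightarrow>
    (\<forall>\<mu>\<in>Pp p. \<forall>x y.
      inner (intrinsic_deriv dH \<mu> x - intrinsic_deriv dH \<mu> y) (x - y) \<ge> lam * (norm (x - y))\<^sup>2) \<longrightarrow>
    bdd_above (deriv2_opnorms p d2H) \<longrightarrow>
    lam > Sup (deriv2_opnorms p d2H) \<longrightarrow>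
    n \<ge> 1 \<longrightarrow>
    filtered_prob_space M \<F> \<longrightarrow>
    mean_field_langevin p dH M \<F> W X \<longrightarrow>
    law M X 0 \<in> Pp 2 \<longrightarrow>
    particle_system dH n M \<F> B Xs \<longrightarrow>
    independent_copies M X Xt \<longrightarrow>
    synchronously_coupled dH n M \<F> B X Xs Xt \<longrightarrow>
    (let L = Sup (deriv2_opnorms p d2H);
         S = Sup (grad0_norms p dH);
         \<beta>1 = 3 * L - 2 * lam;
         \<alpha> = 2 * real CARD('d) + 2 * S;
         \<beta> = - 2 * (lam - S);
         m0 = second_moment (law M X 0);
         err = (\<lambda>t. \<integral>\<omega>. (norm (Xs 1 t \<omega> - Xt 1 t \<omega>))\<^sup>2 \<partial>M);
         U = chaos_bound \<beta>1 L C (\<lambda>T. SUP t\<in>{0..T}. second_moment (law M X t)) CARD('d) n;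
         V = chaos_bound \<beta>1 L C (\<lambda>T. SUP t\<in>{0..T}. gronwall_bound \<alpha> \<beta> m0 t) CARD('d) n
     in (\<forall>T\<ge>0. \<forall>t\<in>{0..T}.
           integrable M (\<lambda>\<omega>. (norm (Xs 1 t \<omega> - Xt 1 t \<omega>))\<^sup>2) \<and> err t \<le> U T t) \<and>
        (\<forall>t\<ge>0. law M X t \<in> Pp 2 \<and> second_moment (law M X t) \<le> gronwall_bound \<alpha> \<beta> m0 t) \<and>
        (\<beta> < 0 \<and> \<beta>1 < 0 \<longrightarrow>
           uniform_in_time U \<and> uniform_in_time V \<and>
           (SUP t\<in>{0..}. ereal (err t)) \<le>
             ereal (L * C / (2 * lam - 3 * L) * (m0 - \<alpha> / \<beta>) * rate CARD('d) n)) \<and>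
        (L > 0 \<longrightarrow>
           (uniform_in_time V \<longrightarrow> \<beta> < 0 \<and> \<beta>1 < 0) \<and> (uniform_in_time U \<longrightarrow> \<beta>1 < 0)))"
proof (intro exI[of _ "chaos_const TYPE('d)"] conjI allI impI chaos_const_pos, goal_cases)
  case (1 p H dH d2H lam n M \<F> W X B Xs Xt)
  then interpret langevin_coupling p H dH d2H lam M \<F> W X n B Xs Xt
    by unfold_locales auto
  show ?case by (rule propagation_of_chaos)
qed

end
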